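(* Let $N\ge1$ and $b>-N/2$, and let $\mathcal F_b$ be the generalized Fourier transform on $L^2(\mathbb R^N,|x|^{2b}dx)$ defined in the context. 1. For all $\ell,m\in\mathbb Z_{\ge0}$ and $p\in\mathcal H^m(\mathbb R^N)$, $$\mathcal F_b\Phi_{b,\ell,p}=i^{-(2\ell+m)}\Phi_{b,\ell,p}.$$ 2. The following inversion formula holds: for $f\in L^2(\mathbb R^N,|x|^{2b}dx)$, $$\mathcal F_b^2f(x)=f(-x),\qquad\text{in particular}\qquad\mathcal F_b^4=1,$$ and $$\mathcal F_b\overline{\mathcal F}_b=\overline{\mathcal F}_b\mathcal F_b=1.$$
   Context: $\mathcal H^m(\mathbb R^N)$ is the space of homogeneous harmonic polynomials of degree $m$ on $\mathbb R^N$ with complex coefficients; $\lambda_{N,m}:=\frac{N-2}{2}+m$; $L_\ell^{(\nu)}(t):=\sum_{k=0}^{\ell}\frac{(-1)^k\Gamma(\nu+\ell+1)}{\Gamma(\nu+k+1)(\ell-k)!}\frac{t^k}{k!}$ is the Laguerre polynomial. For $p\in\mathcal H^m(\mathbb R^N)$, $\ell\in\mathbb Z_{\ge0}$: $\Phi_{b,\ell,p}(x):=e^{-|x|^2/2}L_\ell^{(b+\lambda_{N,m})}(|x|^2)p(x)$. $W_{b,alg}$ is the complex linear span of all $\Phi_{b,\ell,p}$, dense in $L^2(\mathbb R^N,|x|^{2b}dx)$. $E=\sum_k x_k\partial_{x_k}$. On $W_{b,alg}$, $H_b:=\Delta+\frac{2b}{|x|^2}\mathcal R$, where $\mathcal R$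 is linear with $\mathcal R(f(|x|^2)p(x))=E(f(|x|^2))p(x)$ for $p\in\mathcal H^m(\mathbb R^N)$. The operator $\frac12(H_b-|x|^2)$ is essentially self-adjoint on $W_{b,alg}$. The generalized Fourier transform is the unitary-group element times a constant $$\mathcal F_b:=i^{b+\frac N2}e^{\frac{\pi i}{4}(H_b-|x|^2)},\qquad i:=e^{\pi i/2}\ (\text{so } i^{s}=e^{\pi i s/2}),$$ where the exponential is defined by the spectral theorem for the closure of $H_b-|x|^2$. Equivalently, $\mathcal F_b=i^{b+N/2}\Omega_b(e^{\frac\pi2\left(\begin{smallmatrix}0&-1\\1&0\end{smallmatrix}\right)})$ for the unitary representation $\Omega_b$ of the universal covering $\widetilde{SL}(2,\mathbb R)$ whose differential on $W_{b,alg}$ is $\begin{pmatrix}0&1\\0&0\end{pmatrix}\mapsto\frac i2|x|^2$, $\begin{pmatrix}0&0\\1&0\end{pmatrix}\mapsto\frac i2H_b$, $\begin{pmatrix}1&0\\0&-1\end{pmatrix}\mapsto E+\frac{N+2b}2$. $\overline{\mathcal F}_b$ is the complex conjugate operator, $\overline{\mathcal F}_bf:=\overline{\mathcal F_b(\overline f)}$. *)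

theory Defs
  imports
    "HOL-Analysis.Analysis"
    "HOL-Library.Function_Algebras"
    "HOL-Computational_Algebra.Polynomial"
begin

section \<open>Square-integrable functions and spectral calculus\<close>

text \<open>
  Elements of an \<open>L\<^sup>2\<close> space are represented by functions; equality of classes is
  equality almost everywhere.
\<close>

definition L2 :: "'a measure \<Rightarrow> ('a \<Rightarrow> complex) set" where
  "L2 M = {f \<in> borel_measurable M. integrable M (\<lambda>x. (cmod (f x))\<^sup>2)}"

definition inner_L2 :: "'a measure \<Rightarrow> ('a \<Rightarrow> complex) \<Rightarrow> ('a \<Rightarrow> complex) \<Rightarrow> complex" where
  "inner_L2 M f g = (\<integral>x. f x * cnj (g x) \<partial>M)"

definition sqnorm_L2 :: "'a measure \<Rightarrow> ('a \<Rightarrow> complex) \<Rightarrow> ennreal" where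
  "sqnorm_L2 M f = (\<integral>\<^sup>+x. ennreal ((cmod (f x))\<^sup>2) \<partial>M)"

definition tendsto_L2 :: "'a measure \<Rightarrow> (nat \<Rightarrow> 'a \<Rightarrow> complex) \<Rightarrow> ('a \<Rightarrow> complex) \<Rightarrow> bool" where
  "tendsto_L2 M u f \<longleftrightarrow> (\<lambda>n. sqnorm_L2 M (\<lambda>x. u n x - f x)) \<longlonglongrightarrow> 0"

text \<open>Unbounded operators are represented by their graphs.\<close>

type_synonym 'a op_graph = "(('a \<Rightarrow> complex) \<times> ('a \<Rightarrow> complex)) set"

definition graph_closure :: "'a measure \<Rightarrow> 'a op_graph \<Rightarrow> 'a op_graph" where
  "graph_closure M A = {(f, g). f \<in> L2 M \<and> g \<in> L2 M \<and>
     (\<exists>u v. (\<forall>n. (u n, v n) \<in> A) \<and> tendsto_L2 M u f \<and> tendsto_L2 M v g)}"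

text \<open>
  A projection-valued measure on the Borel sets of the real line. Each \<open>P B\<close> is symmetric and
  everywhere defined, hence linear and compatible with almost-everywhere equality, and
  multiplicativity makes it idempotent.
\<close>

definition projection_valued_measure ::
  "'a measure \<Rightarrow> (real set \<Rightarrow> ('a \<Rightarrow> complex) \<Rightarrow> ('a \<Rightarrow> complex)) \<Rightarrow> bool" where
  "projection_valued_measure M P \<longleftrightarrow>
     (\<forall>B\<in>sets borel. \<forall>f\<in>L2 M. P B f \<in> L2 M) \<and>
     (\<forall>B\<in>sets borel. \<forall>f\<in>L2 M. \<forall>g\<in>L2 M. inner_L2 M (P B f) g = inner_L2 M f (P B g)) \<and>
     (\<forall>A\<in>sets borel. \<forall>B\<in>sets borel. \<forall>f\<in>L2 M. AE x in M. P (A \<inter> B) f x = P A (P B f) x) \<and>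
     (\<forall>f\<in>L2 M. AE x in M. P UNIV f x = f x) \<and>
     (\<forall>B. range B \<subseteq> sets borel \<longrightarrow> disjoint_family B \<longrightarrow>
       (\<forall>f\<in>L2 M. tendsto_L2 M (\<lambda>n x. \<Sum>i<n. P (B i) f x) (P (\<Union>i. B i) f)))"

definition scalar_spectral_measure ::
  "'a measure \<Rightarrow> (real set \<Rightarrow> ('a \<Rightarrow> complex) \<Rightarrow> ('a \<Rightarrow> complex)) \<Rightarrow> ('a \<Rightarrow> complex) \<Rightarrow> real measure" where
  "scalar_spectral_measure M P f = measure_of UNIV (sets borel) (\<lambda>B. sqnorm_L2 M (P B f))"

definition simple_spectral_integral ::
  "(real set \<Rightarrow> ('a \<Rightarrow> complex) \<Rightarrow> ('a \<Rightarrow> complex)) \<Rightarrow> (real \<Rightarrow> complex) \<Rightarrow> ('a \<Rightarrow> complex) \<Rightarrow> ('a \<Rightarrow> complex)" where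
  "simple_spectral_integral P s f = (\<lambda>x. \<Sum>y\<in>range s. y * P (s -` {y}) f x)"

text \<open>
  Graph of the operator \<open>\<integral> \<phi> dP\<close>: the domain consists of the \<open>f\<close> with
  \<open>\<phi>\<close> square-integrable for the measure \<open>\<parallel>P(\<cdot>) f\<parallel>\<^sup>2\<close>, and the value at \<open>f\<close> is the limit
  along simple functions that converge to \<open>\<phi>\<close> in the \<open>L\<^sup>2\<close> space of that measure.
\<close>

definition spectral_integral ::
  "'a measure \<Rightarrow> (real set \<Rightarrow> ('a \<Rightarrow> complex) \<Rightarrow> ('a \<Rightarrow> complex)) \<Rightarrow> (real \<Rightarrow> complex) \<Rightarrow> 'a op_graph" where
  "spectral_integral M P \<phi> = {(f, g). f \<in> L2 M \<and> g \<in> L2 M \<and>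
     (\<exists>s. (\<forall>n. simple_function borel (s n)) \<and>
          tendsto_L2 (scalar_spectral_measure M P f) s \<phi> \<and>
          tendsto_L2 M (\<lambda>n. simple_spectral_integral P (s n) f) g)}"

definition spectral_measure_of ::
  "'a measure \<Rightarrow> 'a op_graph \<Rightarrow> (real set \<Rightarrow> ('a \<Rightarrow> complex) \<Rightarrow> ('a \<Rightarrow> complex)) \<Rightarrow> bool" where
  "spectral_measure_of M T P \<longleftrightarrow>
     projection_valued_measure M P \<and> spectral_integral M P (\<lambda>s. of_real s) = T"

text \<open>
  \<open>\<phi>(T)\<close> for self-adjoint \<open>T\<close> and bounded Borel \<open>\<phi>\<close>. The choice is only of representatives
  of classes: the spectral measure of \<open>T\<close> is unique modulo almost-everywhere equality.
\<close>

definition functional_calculus ::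
  "'a measure \<Rightarrow> 'a op_graph \<Rightarrow> (real \<Rightarrow> complex) \<Rightarrow> ('a \<Rightarrow> complex) \<Rightarrow> ('a \<Rightarrow> complex)" where
  "functional_calculus M T \<phi> =
     (SOME U. \<exists>P. spectral_measure_of M T P \<and> (\<forall>f\<in>L2 M. (f, U f) \<in> spectral_integral M P \<phi>))"

section \<open>Differential operators and harmonic polynomials\<close>

definition partial :: "'n \<Rightarrow> (real^'n::finite \<Rightarrow> complex) \<Rightarrow> real^'n \<Rightarrow> complex" where
  "partial k f x = vector_derivative (\<lambda>t. f (x + t *\<^sub>R axis k 1)) (at 0)"

definition laplacian :: "(real^'n::finite \<Rightarrow> complex) \<Rightarrow> real^'n \<Rightarrow> complex" where
  "laplacian f x = (\<Sum>k\<in>UNIV. partial k (partial k f) x)"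

definition euler :: "(real^'n::finite \<Rightarrow> complex) \<Rightarrow> real^'n \<Rightarrow> complex" where
  "euler f x = (\<Sum>k\<in>UNIV. of_real (x $ k) * partial k f x)"

definition homogeneous_polys :: "nat \<Rightarrow> (real^'n::finite \<Rightarrow> complex) set" where
  "homogeneous_polys m =
     {p. \<exists>c. p = (\<lambda>x. \<Sum>\<alpha> | (\<Sum>i\<in>UNIV. \<alpha> i) = m. c \<alpha> * (\<Prod>i\<in>UNIV. of_real (x $ i) ^ \<alpha> i))}"

definition harmonic_polys :: "nat \<Rightarrow> (real^'n::finite \<Rightarrow> complex) set" where
  "harmonic_polys m = {p \<in> homogeneous_polys m. \<forall>x. laplacian p x = 0}"

section \<open>The generalized Fourier transform\<close>

definition weighted_measure :: "real \<Rightarrow> (real^'n::finite) measure" where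
  "weighted_measure b = density lborel (\<lambda>x. ennreal (norm x powr (2 * b)))"

definition laguerre :: "real \<Rightarrow> nat \<Rightarrow> real \<Rightarrow> real" where
  "laguerre \<nu> l t =
     (\<Sum>k=0..l. ((-1) ^ k * Gamma (\<nu> + real l + 1)) / (Gamma (\<nu> + real k + 1) * fact (l - k))
        * (t ^ k / fact k))"

definition lambda_Nm :: "nat \<Rightarrow> nat \<Rightarrow> real" where
  "lambda_Nm N m = (real N - 2) / 2 + real m"

text \<open>The degree \<open>m\<close> of \<open>p\<close> is an explicit argument.\<close>

definition Phi :: "real \<Rightarrow> nat \<Rightarrow> nat \<Rightarrow> (real^'n::finite \<Rightarrow> complex) \<Rightarrow> real^'n \<Rightarrow> complex" where
  "Phi b l m p = (\<lambda>x. of_real (exp (- (norm x)\<^sup>2 / 2) *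
     laguerre (b + lambda_Nm CARD('n) m) l ((norm x)\<^sup>2)) * p x)"

definition W_alg :: "real \<Rightarrow> (real^'n::finite \<Rightarrow> complex) set" where
  "W_alg b = module.span (\<lambda>c u x. c * u x) {Phi b l m p |l m p. p \<in> harmonic_polys m}"

text \<open>
  The functions \<open>f(|x|\<^sup>2) p(x)\<close> in \<open>W_alg\<close> with \<open>p \<noteq> 0\<close> harmonic and homogeneous are those with
  \<open>f(t) = exp (-t/2) q(t)\<close> for a polynomial \<open>q\<close>. The operator \<open>\<R>\<close> is the linear extension of
  its values on them, that is, its graph is the linear span of the corresponding pairs.
\<close>

definition radial_gauss :: "complex poly \<Rightarrow> real^'n::finite \<Rightarrow> complex" where
  "radial_gauss q x = of_real (exp (- (norm x)\<^sup>2 / 2)) * poly q (of_real ((norm x)\<^sup>2))"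

definition R_graph :: "(real^'n::finite) op_graph" where
  "R_graph = module.span (\<lambda>c (u, v). (\<lambda>x. c * u x, \<lambda>x. c * v x))
     {(\<lambda>x. radial_gauss q x * p x, \<lambda>x. euler (radial_gauss q) x * p x) |q p m.
        p \<in> harmonic_polys m}"

text \<open>The value at the null set \<open>{0}\<close>, where \<open>2b/|x|\<^sup>2\<close> is undefined, is irrelevant.\<close>

definition H_graph :: "real \<Rightarrow> (real^'n::finite) op_graph" where
  "H_graph b = {(u, \<lambda>x. laplacian u x + of_real (2 * b / (norm x)\<^sup>2) * v x) |u v.
     u \<in> W_alg b \<and> (u, v) \<in> R_graph}"

definition oscillator_graph :: "real \<Rightarrow> (real^'n::finite) op_graph" where
  "oscillator_graph b = {(u, \<lambda>x. h x - of_real ((norm x)\<^sup>2) * u x) |u h. (u, h) \<in> H_graph b}"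

definition gen_fourier :: "real \<Rightarrow> (real^'n::finite \<Rightarrow> complex) \<Rightarrow> real^'n \<Rightarrow> complex" where
  "gen_fourier b f = (\<lambda>x. exp (of_real pi * \<i> * of_real (b + real CARD('n) / 2) / 2) *
     functional_calculus (weighted_measure b)
       (graph_closure (weighted_measure b) (oscillator_graph b))
       (\<lambda>s. exp (of_real pi * \<i> / 4 * of_real s)) f x)"

definition gen_fourier_conj :: "real \<Rightarrow> (real^'n::finite \<Rightarrow> complex) \<Rightarrow> real^'n \<Rightarrow> complex" where
  "gen_fourier_conj b f = (\<lambda>x. cnj (gen_fourier b (\<lambda>y. cnj (f y)) x))"

end

theory Submission
  imports Defs
begin

text \<open>
  The function \<open>\<Phi>\<^bsub>b,l,p\<^esub>\<close> is an eigenfunction of \<open>H\<^sub>b - |x|\<^sup>2\<close> for the eigenvalue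
  \<open>\<mu> = -(4l + 2m + N + 2b)\<close>, because on \<open>e\<^bsup>-t/2\<^esup> q(t) p(x)\<close>, \<open>t = |x|\<^sup>2\<close>, the operator acts on \<open>q\<close>
  as four times the Laguerre operator \<open>t q'' + (a - t) q'\<close> minus \<open>2a\<close>, with \<open>a = b + N/2 + m\<close>
  (\<open>oscillator_radial_gauss\<close>). If moreover these eigenfunctions are complete, the closure of
  \<open>H\<^sub>b - |x|\<^sup>2\<close> is diagonal, and \<open>\<F>\<^sub>b\<close> multiplies \<open>\<Phi>\<^bsub>b,l,p\<^esub>\<close> by
  \<open>e\<^bsup>i\<pi>(b+N/2)/2\<^esup> e\<^bsup>i\<pi>\<mu>/4\<^esup> = i\<^bsup>-(2l+m)\<^esup>\<close>. This is the first claim. Since \<open>p(-x) = (-1)\<^sup>m p(x)\<close>, the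
  square of this number is the parity of \<open>\<Phi>\<^bsub>b,l,p\<^esub>\<close>, which gives \<open>\<F>\<^sub>b\<^sup>2 f(x) = f(-x)\<close>; the conjugate
  of \<open>\<Phi>\<^bsub>b,l,p\<^esub>\<close> belongs to the same eigenvalue and the multiplier has modulus one, which gives the
  inversion by the conjugate operator.

  Three points need work. The functional calculus refers to an unspecified spectral measure of
  the closure. Its existence is shown by writing down the projections onto spans of eigenvectors,
  for which the Riesz-Fischer theorem supplies the infinite sums (\<open>spectral_integral_diagonal\<close>); its
  choice does not matter, since every spectral measure \<open>P\<close> of an operator with \<open>T v = \<mu> v\<close> satisfies
  \<open>P{\<mu>} v = v\<close> (\<open>eigenvector_of_spectral_integral\<close>).

  The second point is orthogonality of the \<open>\<Phi>\<close>. In the variable \<open>t = |x|\<^sup>2\<close> an inner product is an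
  angular constant, depending on the two harmonic polynomials only, times the integral of a
  polynomial against \<open>t\<^bsup>a-1\<^esup> e\<^bsup>-t\<^esup>\<close> (\<open>inner_radial_gauss\<close>). The Laguerre operator is symmetric for the
  latter; the angular constant of two different degrees vanishes by Green's formula with a Gaussian
  weight (\<open>gaussian_Green\<close>). That the constant is the same for all \<open>b\<close> reduces this to \<open>b = 0\<close>, where no
  singular weight disturbs the integration by parts.

  The third point is completeness (\<open>Phi_complete\<close>). By the decomposition of polynomials into
  \<open>|x|\<^bsup>2j\<^esup>\<close> times harmonics, a function \<open>f\<close> orthogonal to all \<open>\<Phi>\<close> is orthogonal to \<open>e\<^bsup>-|x|\<^sup>2/2\<^esup>\<close> times
  every polynomial. Expanding Gaussians in power series increases the exponent, so \<open>f e\<^bsup>-|x|\<^sup>2/2\<^esup>\<close> is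
  orthogonal to the algebra spanned by \<open>e\<^bsup>-k|x|\<^sup>2\<^esup> x\<^sup>\<alpha>\<close>, \<open>k \<ge> 1\<close>. The map
  \<open>x \<mapsto> (e\<^bsup>-|x|\<^sup>2\<^esup>, e\<^bsup>-|x|\<^sup>2\<^esup> x)\<close> takes values in a compact ball, polynomials without constant term pull back
  along it into this algebra, and the Stone-Weierstrass theorem makes \<open>f\<close> orthogonal to enough continuous functions.
\<close>

section \<open>The space of square-integrable functions\<close>

lemma borel_measurable_cnj [measurable (raw)]:
  "f \<in> borel_measurable M \<Longrightarrow> (\<lambda>x. cnj (f x)) \<in> borel_measurable M"
  by (rule borel_measurable_continuous_on[OF continuous_on_cnj[OF continuous_on_id]])

lemma L2_measurable [measurable_dest]: "f \<in> L2 M \<Longrightarrow> f \<in> borel_measurable M"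
  by (simp add: L2_def)

lemma L2_integrable_sq: "f \<in> L2 M \<Longrightarrow> integrable M (\<lambda>x. (cmod (f x))\<^sup>2)"
  by (simp add: L2_def)

lemma cmod_add_sq_le: "(cmod (x + y))\<^sup>2 \<le> 2 * (cmod x)\<^sup>2 + 2 * (cmod y)\<^sup>2"
proof -
  have "(cmod (x + y))\<^sup>2 \<le> (cmod x + cmod y)\<^sup>2"
    by (simp add: norm_triangle_ineq power_mono)
  also have "\<dots> \<le> 2 * (cmod x)\<^sup>2 + 2 * (cmod y)\<^sup>2"
    using sum_squares_bound[of "cmod x" "cmod y"] by (simp add: power2_sum)
  finally show ?thesis .
qed

lemma L2_mult_left: "f \<in> L2 M \<Longrightarrow> (\<lambda>x. c * f x) \<in> L2 M"
  by (auto simp: L2_def norm_mult power_mult_distrib)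

lemma L2_add:
  assumes "f \<in> L2 M" "g \<in> L2 M"
  shows "(\<lambda>x. f x + g x) \<in> L2 M"
  unfolding L2_def
proof safe
  show m: "(\<lambda>x. f x + g x) \<in> borel_measurable M"
    using assms by (auto dest!: L2_measurable)
  show "integrable M (\<lambda>x. (cmod (f x + g x))\<^sup>2)"
  proof (rule Bochner_Integration.integrable_bound)
    show "integrable M (\<lambda>x. 2 * (cmod (f x))\<^sup>2 + 2 * (cmod (g x))\<^sup>2)"
      using assms by (intro Bochner_Integration.integrable_add integrable_mult_right L2_integrable_sq) auto
    show "(\<lambda>x. (cmod (f x + g x))\<^sup>2) \<in> borel_measurable M" using m by measurable
    show "AE x in M. norm ((cmod (f x + g x))\<^sup>2) \<le> norm (2 * (cmod (f x))\<^sup>2 + 2 * (cmod (g x))\<^sup>2)"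
      using cmod_add_sq_le by auto
  qed
qed

lemma L2_zero: "(\<lambda>x. 0) \<in> L2 M" by (simp add: L2_def)

lemma L2_diff: "f \<in> L2 M \<Longrightarrow> g \<in> L2 M \<Longrightarrow> (\<lambda>x. f x - g x) \<in> L2 M"
  using L2_add[of f M "\<lambda>x. (-1) * g x"] L2_mult_left[of g M "-1"] by simp

lemma L2_cnj: "f \<in> L2 M \<Longrightarrow> (\<lambda>x. cnj (f x)) \<in> L2 M"
  by (auto simp: L2_def)

lemma L2_sum: "(\<And>i. i \<in> I \<Longrightarrow> f i \<in> L2 M) \<Longrightarrow> (\<lambda>x. \<Sum>i\<in>I. f i x) \<in> L2 M"
  by (induction I rule: infinite_finite_induct) (auto intro: L2_zero L2_add)

lemma L2_cong_AE:
  assumes "f \<in> L2 M" "AE x in M. f x = g x" "g \<in> borel_measurable M"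
  shows "g \<in> L2 M"
proof -
  have "integrable M (\<lambda>x. (cmod (g x))\<^sup>2)"
    by (rule integrable_cong_AE_imp[OF L2_integrable_sq[OF assms(1)]])
       (use assms in \<open>auto dest: L2_measurable\<close>)
  then show ?thesis using assms by (simp add: L2_def)
qed

lemma L2_product_integrable:
  assumes "f \<in> L2 M" "g \<in> L2 M"
  shows "integrable M (\<lambda>x. f x * cnj (g x))"
proof (rule Bochner_Integration.integrable_bound)
  show "integrable M (\<lambda>x. (cmod (f x))\<^sup>2 + (cmod (g x))\<^sup>2)"
    using assms by (intro Bochner_Integration.integrable_add L2_integrable_sq) auto
  show "(\<lambda>x. f x * cnj (g x)) \<in> borel_measurable M"
    using assms by (auto dest!: L2_measurable)
  show "AE x in M. norm (f x * cnj (g x)) \<le> norm ((cmod (f x))\<^sup>2 + (cmod (g x))\<^sup>2)"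
  proof (rule AE_I2)
    fix x
    have "2 * (cmod (f x) * cmod (g x)) \<le> (cmod (f x))\<^sup>2 + (cmod (g x))\<^sup>2"
      using sum_squares_bound[of "cmod (f x)" "cmod (g x)"] by simp
    moreover have "0 \<le> cmod (f x) * cmod (g x)" by simp
    ultimately have "cmod (f x) * cmod (g x) \<le> (cmod (f x))\<^sup>2 + (cmod (g x))\<^sup>2"
      by linarith
    then show "norm (f x * cnj (g x)) \<le> norm ((cmod (f x))\<^sup>2 + (cmod (g x))\<^sup>2)"
      by (simp add: norm_mult)
  qed
qed

lemma inner_L2_add_left:
  "f \<in> L2 M \<Longrightarrow> g \<in> L2 M \<Longrightarrow> h \<in> L2 M \<Longrightarrow>
    inner_L2 M (\<lambda>x. f x + g x) h = inner_L2 M f h + inner_L2 M g h"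
  unfolding inner_L2_def distrib_right
  by (intro Bochner_Integration.integral_add L2_product_integrable)

lemma inner_L2_mult_left: "inner_L2 M (\<lambda>x. c * f x) g = c * inner_L2 M f g"
  unfolding inner_L2_def mult.assoc by (rule integral_mult_right_zero)

lemma inner_L2_diff_left:
  "f \<in> L2 M \<Longrightarrow> g \<in> L2 M \<Longrightarrow> h \<in> L2 M \<Longrightarrow>
    inner_L2 M (\<lambda>x. f x - g x) h = inner_L2 M f h - inner_L2 M g h"
  unfolding inner_L2_def left_diff_distrib
  by (intro Bochner_Integration.integral_diff L2_product_integrable)

lemma inner_L2_commute: "inner_L2 M g f = cnj (inner_L2 M f g)"
  unfolding inner_L2_def by (simp flip: Bochner_Integration.integral_cnj add: mult.commute)

lemma inner_L2_cnj: "inner_L2 M (\<lambda>x. cnj (f x)) (\<lambda>x. cnj (g x)) = cnj (inner_L2 M f g)"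
  unfolding inner_L2_def by (simp flip: Bochner_Integration.integral_cnj)

lemma inner_L2_zero_left [simp]: "inner_L2 M (\<lambda>x. 0) g = 0"
  by (simp add: inner_L2_def)

lemma inner_L2_zero_right [simp]: "inner_L2 M f (\<lambda>x. 0) = 0"
  by (simp add: inner_L2_def)

lemma inner_L2_sum_left:
  "(\<And>i. i \<in> I \<Longrightarrow> f i \<in> L2 M) \<Longrightarrow> h \<in> L2 M \<Longrightarrow>
    inner_L2 M (\<lambda>x. \<Sum>i\<in>I. f i x) h = (\<Sum>i\<in>I. inner_L2 M (f i) h)"
  by (induction I rule: infinite_finite_induct) (auto simp: inner_L2_add_left L2_sum)

lemma inner_L2_mult_right: "inner_L2 M f (\<lambda>x. c * g x) = cnj c * inner_L2 M f g"
  by (simp add: inner_L2_commute[of M f] inner_L2_mult_left)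

lemma inner_L2_sum_right:
  "(\<And>i. i \<in> I \<Longrightarrow> f i \<in> L2 M) \<Longrightarrow> h \<in> L2 M \<Longrightarrow>
    inner_L2 M h (\<lambda>x. \<Sum>i\<in>I. f i x) = (\<Sum>i\<in>I. inner_L2 M h (f i))"
  by (simp add: inner_L2_commute[of M h] inner_L2_sum_left)

lemma inner_L2_add_right:
  "f \<in> L2 M \<Longrightarrow> g \<in> L2 M \<Longrightarrow> h \<in> L2 M \<Longrightarrow>
    inner_L2 M h (\<lambda>x. f x + g x) = inner_L2 M h f + inner_L2 M h g"
  by (simp add: inner_L2_commute[of M h] inner_L2_add_left)

lemma inner_L2_diff_right:
  "f \<in> L2 M \<Longrightarrow> g \<in> L2 M \<Longrightarrow> h \<in> L2 M \<Longrightarrow>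
    inner_L2 M h (\<lambda>x. f x - g x) = inner_L2 M h f - inner_L2 M h g"
  by (simp add: inner_L2_commute[of M h] inner_L2_diff_left)

lemma inner_L2_cong_AE:
  assumes "AE x in M. f x = f' x" "AE x in M. g x = g' x"
    and "f \<in> L2 M" "f' \<in> L2 M" "g \<in> L2 M" "g' \<in> L2 M"
  shows "inner_L2 M f g = inner_L2 M f' g'"
  unfolding inner_L2_def
proof (rule integral_cong_AE)
  show "AE x in M. f x * cnj (g x) = f' x * cnj (g' x)" using assms(1,2) by eventually_elim simp
qed (use assms in \<open>auto dest!: L2_measurable\<close>)

text \<open>
  Real-valued, for arithmetic with inner products. On \<^const>\<open>L2\<close> it agrees with \<^const>\<open>sqnorm_L2\<close>;
  outside, where the integral may diverge, the default value of the Bochner integral applies.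
\<close>

definition l2sq :: "'a measure \<Rightarrow> ('a \<Rightarrow> complex) \<Rightarrow> real" where
  "l2sq M f = (\<integral>x. (cmod (f x))\<^sup>2 \<partial>M)"

lemma l2sq_nonneg [simp]: "0 \<le> l2sq M f" by (simp add: l2sq_def)

lemma sqnorm_eq_l2sq: "f \<in> L2 M \<Longrightarrow> sqnorm_L2 M f = ennreal (l2sq M f)"
  unfolding sqnorm_L2_def l2sq_def by (intro nn_integral_eq_integral L2_integrable_sq) auto

lemma inner_L2_self: "inner_L2 M f f = of_real (l2sq M f)"
  unfolding inner_L2_def l2sq_def complex_norm_square[symmetric]
  by (simp flip: integral_complex_of_real)

lemma l2sq_eq_0_iff: "f \<in> L2 M \<Longrightarrow> l2sq M f = 0 \<longleftrightarrow> (AE x in M. f x = 0)"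
  unfolding l2sq_def using integral_nonneg_eq_0_iff_AE[OF L2_integrable_sq, of f M] by simp

lemma l2sq_mult: "l2sq M (\<lambda>x. c * f x) = (cmod c)\<^sup>2 * l2sq M f"
  by (simp add: l2sq_def norm_mult power_mult_distrib)

lemma l2sq_add:
  assumes "f \<in> L2 M" "g \<in> L2 M"
  shows "l2sq M (\<lambda>x. f x + g x) = l2sq M f + l2sq M g + 2 * Re (inner_L2 M f g)"
proof -
  have "complex_of_real (l2sq M (\<lambda>x. f x + g x)) =
      of_real (l2sq M f) + of_real (l2sq M g) + (inner_L2 M f g + cnj (inner_L2 M f g))"
    using assms inner_L2_commute[of M g f]
    by (simp flip: inner_L2_self add: inner_L2_add_left inner_L2_add_right L2_add)
  from arg_cong[OF this, of Re] show ?thesis by simp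
qed

lemma l2sq_diff_commute: "l2sq M (\<lambda>x. f x - g x) = l2sq M (\<lambda>x. g x - f x)"
  by (simp add: l2sq_def norm_minus_commute)

lemma l2sq_cong_AE:
  assumes "AE x in M. f x = g x" "f \<in> L2 M" "g \<in> L2 M"
  shows "l2sq M f = l2sq M g"
  using inner_L2_cong_AE[OF assms(1) assms(1) assms(2,3,2,3)] by (simp add: inner_L2_self)

text \<open>
  The squared norm of \<open>f + c g\<close> is nonnegative; \<open>c = - \<langle>f, g\<rangle> / \<parallel>g\<parallel>\<^sup>2\<close> minimizes it.
\<close>

lemma Cauchy_Schwarz_L2:
  assumes f: "f \<in> L2 M" and g: "g \<in> L2 M"
  shows "(cmod (inner_L2 M f g))\<^sup>2 \<le> l2sq M f * l2sq M g"
proof (cases "l2sq M g = 0")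
  case True
  then have "AE x in M. g x = 0" using l2sq_eq_0_iff[OF g] by simp
  then have "inner_L2 M f g = inner_L2 M f (\<lambda>x. 0)"
    using f g by (intro inner_L2_cong_AE) (auto intro: L2_zero)
  then show ?thesis by simp
next
  case False
  define i where "i = inner_L2 M f g"
  define G where "G = l2sq M g"
  have G: "G > 0" using False l2sq_nonneg[of M g] unfolding G_def by linarith
  define c where "c = - (i / of_real G)"
  have "0 \<le> l2sq M (\<lambda>x. f x + c * g x)" by simp
  also have "\<dots> = l2sq M f + (cmod c)\<^sup>2 * G + 2 * Re (cnj c * i)"
    using f g by (simp add: l2sq_add L2_mult_left l2sq_mult inner_L2_mult_right i_def G_def)
  also have "cnj c * i = - of_real ((cmod i)\<^sup>2 / G)"
    using complex_norm_square[of i] by (simp add: c_def mult.commute)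
  also have "(cmod c)\<^sup>2 * G = (cmod i)\<^sup>2 / G"
    using G by (simp add: c_def norm_divide power_divide power2_eq_square)
  finally have "(cmod i)\<^sup>2 / G \<le> l2sq M f" by simp
  then show ?thesis using G by (simp add: field_simps i_def G_def)
qed

lemma tendsto_L2_iff:
  assumes "\<And>n. u n \<in> L2 M" "f \<in> L2 M"
  shows "tendsto_L2 M u f \<longleftrightarrow> (\<lambda>n. l2sq M (\<lambda>x. u n x - f x)) \<longlonglongrightarrow> 0"
proof -
  have "sqnorm_L2 M (\<lambda>x. u n x - f x) = ennreal (l2sq M (\<lambda>x. u n x - f x))" for n
    using assms by (intro sqnorm_eq_l2sq L2_diff)
  then show ?thesis
    unfolding tendsto_L2_def by (simp add: tendsto_ennreal_iff flip: ennreal_0)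
qed

lemma tendsto_L2_inner:
  assumes "\<And>n. u n \<in> L2 M" "f \<in> L2 M" "g \<in> L2 M" "tendsto_L2 M u f"
  shows "(\<lambda>n. inner_L2 M (u n) g) \<longlonglongrightarrow> inner_L2 M f g"
proof -
  have lim: "(\<lambda>n. l2sq M (\<lambda>x. u n x - f x)) \<longlonglongrightarrow> 0"
    using assms tendsto_L2_iff by blast
  have "(\<lambda>n. sqrt (l2sq M (\<lambda>x. u n x - f x) * l2sq M g)) \<longlonglongrightarrow> sqrt (0 * l2sq M g)"
    by (intro tendsto_intros lim)
  then have l0: "(\<lambda>n. sqrt (l2sq M (\<lambda>x. u n x - f x) * l2sq M g)) \<longlonglongrightarrow> 0" by simp
  have "(\<lambda>n. inner_L2 M (u n) g - inner_L2 M f g) \<longlonglongrightarrow> 0"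
  proof (rule Lim_null_comparison[OF _ l0], rule always_eventually, rule allI)
    fix n
    show "norm (inner_L2 M (u n) g - inner_L2 M f g) \<le> sqrt (l2sq M (\<lambda>x. u n x - f x) * l2sq M g)"
      using Cauchy_Schwarz_L2[OF L2_diff[OF assms(1,2)] assms(3), of n] assms
      by (intro real_le_rsqrt) (simp add: inner_L2_diff_left)
  qed
  then show ?thesis by (simp add: LIM_zero_iff)
qed

text \<open>
  Riesz-Fischer. Along a fast subsequence the increments satisfy \<open>\<parallel>D\<^sub>k\<parallel>\<^sup>2 \<le> 4\<^bsup>-k\<^esup>\<close>, so that
  \<open>\<Sum>k. 2\<^sup>k \<bar>D\<^sub>k\<bar>\<^sup>2\<close> is integrable, and \<open>\<bar>D\<^sub>k\<bar> \<le> 2\<^bsup>-k\<^esup> + 2\<^sup>k \<bar>D\<^sub>k\<bar>\<^sup>2\<close> makes the subsequence converge almost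
  everywhere. Fatou's lemma carries the Cauchy estimate over to the limit.
\<close>

lemma L2_Cauchy_convergent:
  assumes s: "\<And>n. s n \<in> L2 M"
    and cau: "\<And>e. e > 0 \<Longrightarrow> \<exists>K. \<forall>m\<ge>K. \<forall>n\<ge>K. l2sq M (\<lambda>x. s m x - s n x) < e"
  shows "\<exists>g\<in>L2 M. tendsto_L2 M s g"
proof -
  have "\<exists>K. \<forall>m\<ge>K. \<forall>n\<ge>K. l2sq M (\<lambda>x. s m x - s n x) < (1/4::real)^k" for k
    by (rule cau) simp
  then obtain K where K: "\<And>k m n. m \<ge> K k \<Longrightarrow> n \<ge> K k \<Longrightarrow> l2sq M (\<lambda>x. s m x - s n x) < (1/4::real)^k"
    by metis
  \<comment> \<open>A nondecreasing sequence of indices with \<open>r k \<ge> K k\<close>.\<close>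
  define r where "r k = (\<Sum>i\<le>k. K i)" for k
  have rK: "r k \<ge> K k" for k unfolding r_def by (rule member_le_sum) auto
  have rK': "r j \<ge> K k" if "j \<ge> k" for j k
  proof -
    have "r k \<le> r j" unfolding r_def using that by (intro sum_mono2) auto
    then show ?thesis using rK[of k] by simp
  qed
  have [measurable]: "s n \<in> borel_measurable M" for n using s by (rule L2_measurable)
  define D where "D k x = s (r (Suc k)) x - s (r k) x" for k x
  have D: "D k \<in> L2 M" for k unfolding D_def by (intro L2_diff s)
  have [measurable]: "D k \<in> borel_measurable M" for k using D by (rule L2_measurable)
  have Dsq: "(\<integral>\<^sup>+x. ennreal ((cmod (D k x))\<^sup>2) \<partial>M) \<le> ennreal ((1/4)^k)" for k
  proof -
    have "(\<integral>\<^sup>+x. ennreal ((cmod (D k x))\<^sup>2) \<partial>M) = ennreal (l2sq M (D k))"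
      using sqnorm_eq_l2sq[OF D] by (simp add: sqnorm_L2_def)
    moreover have "l2sq M (D k) \<le> (1/4)^k"
      unfolding D_def using K[of k "r (Suc k)" "r k"] rK'[of k "Suc k"] rK[of k] by simp
    ultimately show ?thesis by (simp add: ennreal_leI)
  qed
  have "(\<integral>\<^sup>+x. (\<Sum>k. ennreal (2^k * (cmod (D k x))\<^sup>2)) \<partial>M) = (\<Sum>k. \<integral>\<^sup>+x. ennreal (2^k * (cmod (D k x))\<^sup>2) \<partial>M)"
    by (rule nn_integral_suminf) simp
  also have "\<dots> \<le> (\<Sum>k. ennreal ((1/2)^k))"
  proof (rule suminf_le)
    fix k
    have "(\<integral>\<^sup>+x. ennreal (2^k * (cmod (D k x))\<^sup>2) \<partial>M) = ennreal (2^k) * (\<integral>\<^sup>+x. ennreal ((cmod (D k x))\<^sup>2) \<partial>M)"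
      by (simp add: ennreal_mult nn_integral_cmult)
    also have "\<dots> \<le> ennreal (2^k) * ennreal ((1/4)^k)" by (intro mult_left_mono Dsq) simp
    also have "\<dots> = ennreal ((1/2)^k)"
      by (simp flip: ennreal_mult power_mult_distrib)
    finally show "(\<integral>\<^sup>+x. ennreal (2^k * (cmod (D k x))\<^sup>2) \<partial>M) \<le> ennreal ((1/2)^k)" .
  qed auto
  also have "\<dots> < \<infinity>"
    by (subst suminf_ennreal2) (auto simp: summable_geometric)
  finally have "(\<integral>\<^sup>+x. (\<Sum>k. ennreal (2^k * (cmod (D k x))\<^sup>2)) \<partial>M) \<noteq> \<infinity>" by simp
  then have "AE x in M. (\<Sum>k. ennreal (2^k * (cmod (D k x))\<^sup>2)) \<noteq> \<infinity>"
    by (intro nn_integral_PInf_AE) simp_all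
  then have conv: "AE x in M. convergent (\<lambda>k. s (r k) x)"
  proof eventually_elim
    case (elim x)
    have "summable (\<lambda>k. 2^k * (cmod (D k x))\<^sup>2)"
      using elim by (intro summable_suminf_not_top) auto
    then have "summable (\<lambda>k. (1/2)^k + 2^k * (cmod (D k x))\<^sup>2)"
      by (intro summable_add) (auto simp: summable_geometric)
    then have "summable (\<lambda>k. D k x)"
    proof (rule summable_comparison_test'[where N = 0])
      fix k :: nat
      \<comment> \<open>\<open>a \<le> 1 + a\<^sup>2\<close>, scaled by \<open>2\<^bsup>-k\<^esup>\<close>.\<close>
      define a where "a = (2::real)^k * cmod (D k x)"
      have "a \<le> 1 + a\<^sup>2"
        using sum_squares_bound[of a 1] zero_le_power2[of a] by (cases "a \<ge> 0") (simp, linarith)+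
      then have "(1/2)^k * a \<le> (1/2)^k * (1 + a\<^sup>2)" by (intro mult_left_mono) auto
      moreover have "(1/2)^k * a = cmod (D k x)" by (simp add: a_def power_one_over)
      moreover have "(1/2)^k * a\<^sup>2 = 2^k * (cmod (D k x))\<^sup>2"
        by (simp add: a_def power_one_over power2_eq_square)
      ultimately show "norm (D k x) \<le> (1/2)^k + 2^k * (cmod (D k x))\<^sup>2"
        by (simp add: distrib_left)
    qed
    then have "convergent (\<lambda>n. \<Sum>k<n. D k x)" by (simp add: summable_iff_convergent)
    moreover have "(\<Sum>k<n. D k x) = s (r n) x - s (r 0) x" for n
      unfolding D_def by (rule sum_lessThan_telescope)
    ultimately have "convergent (\<lambda>n. (s (r n) x - s (r 0) x) + s (r 0) x)"
      by (intro convergent_add convergent_const) simp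
    then show ?case by simp
  qed
  define g where "g x = lim (\<lambda>k. s (r k) x)" for x
  have [measurable]: "g \<in> borel_measurable M" unfolding g_def by measurable
  have lim: "AE x in M. (\<lambda>k. s (r k) x) \<longlonglongrightarrow> g x"
    using conv by eventually_elim (simp add: g_def convergent_LIMSEQ_iff)
  have fatou: "(\<integral>\<^sup>+x. ennreal ((cmod (s n x - g x))\<^sup>2) \<partial>M) \<le> ennreal e"
    if n: "\<And>m. m \<ge> L \<Longrightarrow> l2sq M (\<lambda>x. s n x - s (r m) x) \<le> e" for n L e
  proof -
    have "(\<integral>\<^sup>+x. ennreal ((cmod (s n x - g x))\<^sup>2) \<partial>M)
        = (\<integral>\<^sup>+x. liminf (\<lambda>m. ennreal ((cmod (s n x - s (r m) x))\<^sup>2)) \<partial>M)"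
    proof (rule nn_integral_cong_AE)
      show "AE x in M. ennreal ((cmod (s n x - g x))\<^sup>2) = liminf (\<lambda>m. ennreal ((cmod (s n x - s (r m) x))\<^sup>2))"
        using lim
      proof eventually_elim
        case (elim x)
        have "(\<lambda>m. ennreal ((cmod (s n x - s (r m) x))\<^sup>2)) \<longlonglongrightarrow> ennreal ((cmod (s n x - g x))\<^sup>2)"
          by (intro tendsto_intros elim)
        then show ?case by (intro lim_imp_Liminf[symmetric]) simp
      qed
    qed
    also have "\<dots> \<le> liminf (\<lambda>m. \<integral>\<^sup>+x. ennreal ((cmod (s n x - s (r m) x))\<^sup>2) \<partial>M)"
      by (rule nn_integral_liminf) measurable
    also have "\<dots> \<le> ennreal e"
    proof (rule Liminf_le)
      show "\<forall>\<^sub>F m in sequentially. (\<integral>\<^sup>+x. ennreal ((cmod (s n x - s (r m) x))\<^sup>2) \<partial>M) \<le> ennreal e"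
        using eventually_ge_at_top[of L]
      proof eventually_elim
        case (elim m)
        then show ?case using n[of m] sqnorm_eq_l2sq[OF L2_diff[OF s s], of n "r m"]
          by (simp add: sqnorm_L2_def ennreal_leI)
      qed
    qed simp
    finally show ?thesis .
  qed
  have "(\<lambda>x. s (r 0) x - g x) \<in> L2 M"
  proof -
    have "(\<integral>\<^sup>+x. ennreal ((cmod (s (r 0) x - g x))\<^sup>2) \<partial>M) \<le> ennreal 1"
    proof (rule fatou[of 0])
      fix m
      show "l2sq M (\<lambda>x. s (r 0) x - s (r m) x) \<le> 1"
        using K[of 0 "r 0" "r m"] rK'[of 0 m] rK[of 0] by simp
    qed
    then have "(\<integral>\<^sup>+x. ennreal ((cmod (s (r 0) x - g x))\<^sup>2) \<partial>M) < \<infinity>"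
      by (simp add: order_le_less_trans)
    then show ?thesis by (simp add: L2_def integrable_iff_bounded)
  qed
  from L2_diff[OF s[of "r 0"] this] have g: "g \<in> L2 M" by simp
  have "tendsto_L2 M s g"
    unfolding tendsto_L2_iff[OF s g]
  proof (rule LIMSEQ_I)
    fix e :: real assume e: "e > 0"
    obtain k where k: "(1/4::real)^k < e/2"
      using e real_arch_pow_inv[of "e/2" "1/4::real"] by (metis half_gt_zero one_less_numeral_iff divide_less_eq_1_pos semiring_norm(76) zero_less_numeral)
    show "\<exists>no. \<forall>n\<ge>no. norm (l2sq M (\<lambda>x. s n x - g x) - 0) < e"
    proof (intro exI allI impI)
      fix n assume n: "n \<ge> K k"
      have "(\<integral>\<^sup>+x. ennreal ((cmod (s n x - g x))\<^sup>2) \<partial>M) \<le> ennreal (e/2)"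
      proof (rule fatou[of k])
        fix m assume "m \<ge> k"
        then show "l2sq M (\<lambda>x. s n x - s (r m) x) \<le> e / 2"
          using K[OF n, of "r m"] rK'[of k m] k by simp
      qed
      then have "l2sq M (\<lambda>x. s n x - g x) \<le> e / 2"
        using sqnorm_eq_l2sq[OF L2_diff[OF s g], of n] e by (simp add: sqnorm_L2_def)
      then show "norm (l2sq M (\<lambda>x. s n x - g x) - 0) < e" using e by simp
    qed
  qed
  with g show ?thesis by blast
qed

section \<open>Projection-valued measures\<close>

locale pvm =
  fixes M :: "'a measure" and P :: "real set \<Rightarrow> ('a \<Rightarrow> complex) \<Rightarrow> ('a \<Rightarrow> complex)"
  assumes pvm: "projection_valued_measure M P"
begin

lemma P_L2: "B \<in> sets borel \<Longrightarrow> f \<in> L2 M \<Longrightarrow> P B f \<in> L2 M"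
  using pvm by (auto simp: projection_valued_measure_def)

lemma P_sym: "B \<in> sets borel \<Longrightarrow> f \<in> L2 M \<Longrightarrow> g \<in> L2 M \<Longrightarrow> inner_L2 M (P B f) g = inner_L2 M f (P B g)"
  using pvm by (auto simp: projection_valued_measure_def)

lemma P_mult: "A \<in> sets borel \<Longrightarrow> B \<in> sets borel \<Longrightarrow> f \<in> L2 M \<Longrightarrow> AE x in M. P (A \<inter> B) f x = P A (P B f) x"
  using pvm by (simp add: projection_valued_measure_def)

lemma P_UNIV: "f \<in> L2 M \<Longrightarrow> AE x in M. P UNIV f x = f x"
  using pvm by (simp add: projection_valued_measure_def)

lemma P_sigma: "range B \<subseteq> sets borel \<Longrightarrow> disjoint_family B \<Longrightarrow> f \<in> L2 M \<Longrightarrow>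
    tendsto_L2 M (\<lambda>n x. \<Sum>i<n. P (B i) f x) (P (\<Union>i. B i) f)"
  using pvm by (simp add: projection_valued_measure_def)

text \<open>
  The series of \<open>\<emptyset> = \<Union>i. \<emptyset>\<close> has constant terms and converges, so its terms vanish.
\<close>

lemma P_empty:
  assumes f: "f \<in> L2 M" shows "l2sq M (P {} f) = 0"
proof -
  let ?g = "P {} f"
  have g: "?g \<in> L2 M" using f by (intro P_L2) auto
  have "tendsto_L2 M (\<lambda>n x. \<Sum>i<n. P ((\<lambda>_. {}) i) f x) (P (\<Union>i. (\<lambda>_::nat. {}) i) f)"
    using f by (intro P_sigma) (auto simp: disjoint_family_on_def)
  then have "tendsto_L2 M (\<lambda>n x. of_nat n * ?g x) ?g" by simp
  then have "(\<lambda>n. inner_L2 M (\<lambda>x. of_nat n * ?g x) ?g) \<longlonglongrightarrow> inner_L2 M ?g ?g"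
    using g by (intro tendsto_L2_inner L2_mult_left)
  then have "(\<lambda>n. of_nat n * inner_L2 M ?g ?g) \<longlonglongrightarrow> inner_L2 M ?g ?g"
    by (simp add: inner_L2_mult_left)
  from LIMSEQ_Suc[OF this] this have
    "(\<lambda>n. of_nat (Suc n) * inner_L2 M ?g ?g - of_nat n * inner_L2 M ?g ?g) \<longlonglongrightarrow> inner_L2 M ?g ?g - inner_L2 M ?g ?g"
    by (rule tendsto_diff)
  then have "inner_L2 M ?g ?g = 0"
    by (simp add: algebra_simps LIMSEQ_const_iff)
  then show ?thesis by (simp add: inner_L2_self)
qed

lemma inner_P_P:
  assumes "A \<in> sets borel" "B \<in> sets borel" "f \<in> L2 M" "g \<in> L2 M"
  shows "inner_L2 M (P A f) (P B g) = inner_L2 M (P (B \<inter> A) f) g"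
proof -
  have "inner_L2 M (P A f) (P B g) = inner_L2 M (P B (P A f)) g"
    using assms by (simp add: P_sym P_L2)
  also have "\<dots> = inner_L2 M (P (B \<inter> A) f) g"
    by (rule inner_L2_cong_AE) (use assms P_mult[of B A f] in \<open>auto intro: P_L2\<close>)
  finally show ?thesis .
qed

lemma inner_P_self:
  assumes "B \<in> sets borel" "f \<in> L2 M"
  shows "inner_L2 M (P B f) f = of_real (l2sq M (P B f))"
  using inner_P_P[of B B f f] assms by (simp add: inner_L2_self)

lemma inner_P_empty: "f \<in> L2 M \<Longrightarrow> g \<in> L2 M \<Longrightarrow> inner_L2 M (P {} f) g = 0"
proof -
  assume "f \<in> L2 M" "g \<in> L2 M"
  then show ?thesis
    using P_empty[of f] Cauchy_Schwarz_L2[of "P {} f" M g] P_L2[of "{}" f] by simp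
qed

abbreviation \<nu> :: "('a \<Rightarrow> complex) \<Rightarrow> real measure" where
  "\<nu> f \<equiv> scalar_spectral_measure M P f"

lemma sets_\<nu> [simp, measurable_cong]: "sets (\<nu> f) = sets borel"
  unfolding scalar_spectral_measure_def 
  using sets.sigma_sets_eq[of "borel :: real measure"] by simp

lemma space_\<nu> [simp]: "space (\<nu> f) = UNIV"
  using sets_eq_imp_space_eq[OF sets_\<nu>[of f]] by simp

text \<open>
  Since \<open>\<parallel>P B f\<parallel>\<^sup>2 = \<langle>P B f, f\<rangle>\<close> is linear in \<open>P B f\<close>, the convergence \<open>\<Sum>i. P (B\<^sub>i) f = P (\<Union>i. B\<^sub>i) f\<close>
  gives countable additivity.
\<close>

lemma emeasure_\<nu>:
  assumes f: "f \<in> L2 M" and B: "B \<in> sets borel"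
  shows "emeasure (\<nu> f) B = ennreal (l2sq M (P B f))"
proof -
  have "emeasure (\<nu> f) B = sqnorm_L2 M (P B f)"
    unfolding scalar_spectral_measure_def
  proof (rule emeasure_measure_of_sigma)
    show "sigma_algebra UNIV (sets (borel :: real measure))"
      using sets.sigma_algebra_axioms[of "borel :: real measure"] by simp
    show "positive (sets borel) (\<lambda>B. sqnorm_L2 M (P B f))"
      using f by (simp add: positive_def sqnorm_eq_l2sq P_L2 P_empty)
    show "countably_additive (sets borel) (\<lambda>B. sqnorm_L2 M (P B f))"
    proof (rule countably_additiveI)
      fix A :: "nat \<Rightarrow> real set"
      assume A: "range A \<subseteq> sets borel" "disjoint_family A" "\<Union> (range A) \<in> sets borel"
      have Ai: "A i \<in> sets borel" for i using A by auto
      have L: "P (A i) f \<in> L2 M" "P (\<Union> (range A)) f \<in> L2 M" for i using f A Ai by (auto intro: P_L2)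
      have "(\<lambda>n. inner_L2 M (\<lambda>x. \<Sum>i<n. P (A i) f x) f) \<longlonglongrightarrow> inner_L2 M (P (\<Union> (range A)) f) f"
        using P_sigma[OF A(1,2) f] L f by (intro tendsto_L2_inner L2_sum) auto
      then have "(\<lambda>n. \<Sum>i<n. complex_of_real (l2sq M (P (A i) f))) \<longlonglongrightarrow> of_real (l2sq M (P (\<Union> (range A)) f))"
        using L f A Ai by (simp add: inner_L2_sum_left inner_P_self)
      then have "(\<lambda>i. l2sq M (P (A i) f)) sums l2sq M (P (\<Union> (range A)) f)"
        unfolding sums_def of_real_sum[symmetric] tendsto_of_real_iff .
      then have "(\<Sum>i. ennreal (l2sq M (P (A i) f))) = ennreal (l2sq M (P (\<Union> (range A)) f))"
        by (intro suminf_ennreal_eq) auto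
      then show "(\<Sum>i. sqnorm_L2 M (P (A i) f)) = sqnorm_L2 M (P (\<Union> (range A)) f)"
        using L by (simp add: sqnorm_eq_l2sq)
    qed
  qed fact
  then show ?thesis using f B by (simp add: sqnorm_eq_l2sq P_L2)
qed

lemma finite_measure_\<nu>: "f \<in> L2 M \<Longrightarrow> finite_measure (\<nu> f)"
  by (rule finite_measureI) (simp add: emeasure_\<nu>)

lemma measure_\<nu>: "f \<in> L2 M \<Longrightarrow> B \<in> sets borel \<Longrightarrow> measure (\<nu> f) B = l2sq M (P B f)"
  by (simp add: measure_def emeasure_\<nu>)

lemma simple_preimage: "simple_function borel s \<Longrightarrow> s -` {y} \<in> sets borel" for s :: "real \<Rightarrow> complex"
  using measurable_sets[OF borel_measurable_simple_function, of borel s "{y}"] by simp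

lemma simple_integral_L2:
  "simple_function borel s \<Longrightarrow> f \<in> L2 M \<Longrightarrow> simple_spectral_integral P s f \<in> L2 M"
  unfolding simple_spectral_integral_def by (intro L2_sum L2_mult_left P_L2 simple_preimage)

lemma inner_simple_integral:
  assumes s: "simple_function borel s" and f: "f \<in> L2 M" and g: "g \<in> L2 M"
  shows "inner_L2 M (simple_spectral_integral P s f) g = (\<Sum>y\<in>range s. y * inner_L2 M (P (s -` {y}) f) g)"
  unfolding simple_spectral_integral_def
  using assms by (subst inner_L2_sum_left)
    (auto simp: inner_L2_mult_left intro!: L2_mult_left P_L2 simple_preimage)

text \<open>
  \<open>P{\<mu>} v = v\<close> means that \<open>v\<close> is carried by \<open>{\<mu>}\<close>: multiplicativity turns \<open>\<langle>P B f, v\<rangle>\<close> into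
  \<open>\<langle>P({\<mu>} \<inter> B) f, v\<rangle>\<close>.
\<close>

lemma inner_P_eigenvector:
  assumes v: "v \<in> L2 M" "AE x in M. P {\<mu>} v x = v x" and f: "f \<in> L2 M" and B: "B \<in> sets borel"
  shows "inner_L2 M (P B f) v = (if \<mu> \<in> B then inner_L2 M f v else 0)"
proof -
  have step: "inner_L2 M g v = inner_L2 M (P {\<mu>} g) v" if g: "g \<in> L2 M" for g
  proof -
    have "inner_L2 M g v = inner_L2 M g (P {\<mu>} v)"
      using v g P_L2[of "{\<mu>}" v] by (intro inner_L2_cong_AE) auto
    then show ?thesis using g v by (simp add: P_sym)
  qed
  have "inner_L2 M (P B f) v = inner_L2 M (P {\<mu>} (P B f)) v"
    using B f by (intro step P_L2)
  also have "\<dots> = inner_L2 M (P ({\<mu>} \<inter> B) f) v"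
    using P_mult[of "{\<mu>}" B f] B f v by (intro inner_L2_cong_AE) (auto intro: P_L2)
  also have "\<dots> = (if \<mu> \<in> B then inner_L2 M f v else 0)"
    using step[OF f] inner_P_empty[OF f v(1)] by auto
  finally show ?thesis .
qed

lemma inner_simple_integral_eigenvector:
  assumes v: "v \<in> L2 M" "AE x in M. P {\<mu>} v x = v x" and f: "f \<in> L2 M" and s: "simple_function borel s"
  shows "inner_L2 M (simple_spectral_integral P s f) v = s \<mu> * inner_L2 M f v"
proof -
  have fin: "finite (range s)" using s by (simp add: simple_function_def)
  have "inner_L2 M (simple_spectral_integral P s f) v = (\<Sum>y\<in>range s. if s \<mu> = y then y * inner_L2 M f v else 0)"
    using assms by (subst inner_simple_integral)
      (auto intro!: sum.cong simp: inner_P_eigenvector[OF v f simple_preimage[OF s]])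
  also have "\<dots> = s \<mu> * inner_L2 M f v" using fin by (subst sum.delta') auto
  finally show ?thesis .
qed

text \<open>
  The approximating simple functions give \<open>\<langle>g, v\<rangle> = lim s\<^sub>n(\<mu>) \<langle>f, v\<rangle>\<close>. Unless \<open>\<langle>f, v\<rangle> = 0\<close>, the measure
  \<open>\<parallel>P(\<cdot>) f\<parallel>\<^sup>2\<close> has an atom at \<open>\<mu>\<close>, so that convergence in its \<open>L\<^sup>2\<close> space forces \<open>s\<^sub>n(\<mu>) \<longlonglongrightarrow> \<phi>(\<mu>)\<close>.
\<close>

lemma spectral_integral_eigenvector:
  assumes v: "v \<in> L2 M" "AE x in M. P {\<mu>} v x = v x" and fg: "(f, g) \<in> spectral_integral M P \<phi>"
  shows "inner_L2 M g v = \<phi> \<mu> * inner_L2 M f v"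
proof -
  from fg obtain s where fg: "f \<in> L2 M" "g \<in> L2 M" and s: "\<And>n. simple_function borel (s n)"
    and lim: "tendsto_L2 (\<nu> f) s \<phi>" and limM: "tendsto_L2 M (\<lambda>n. simple_spectral_integral P (s n) f) g"
    unfolding spectral_integral_def by blast
  have "(\<lambda>n. inner_L2 M (simple_spectral_integral P (s n) f) v) \<longlonglongrightarrow> inner_L2 M g v"
    using s fg v limM by (intro tendsto_L2_inner simple_integral_L2)
  then have l: "(\<lambda>n. s n \<mu> * inner_L2 M f v) \<longlonglongrightarrow> inner_L2 M g v"
    using s v fg by (simp add: inner_simple_integral_eigenvector)
  show ?thesis
  proof (cases "inner_L2 M f v = 0")
    case True
    then show ?thesis using l by (simp add: LIMSEQ_const_iff)
  next
    case False
    define A where "A = l2sq M (P {\<mu>} f)"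
    have "A \<noteq> 0"
    proof
      assume "A = 0"
      then have "inner_L2 M (P {\<mu>} f) v = 0"
        using Cauchy_Schwarz_L2[of "P {\<mu>} f" M v] P_L2[of "{\<mu>}" f] fg v by (simp add: A_def)
      then show False using False inner_P_eigenvector[OF v fg(1), of "{\<mu>}"] by simp
    qed
    then have A: "A > 0" using l2sq_nonneg[of M "P {\<mu>} f"] unfolding A_def by linarith
    have le: "ennreal ((cmod (s n \<mu> - \<phi> \<mu>))\<^sup>2 * A) \<le> sqnorm_L2 (\<nu> f) (\<lambda>x. s n x - \<phi> x)" for n
    proof -
      have "ennreal ((cmod (s n \<mu> - \<phi> \<mu>))\<^sup>2 * A) = ennreal ((cmod (s n \<mu> - \<phi> \<mu>))\<^sup>2) * emeasure (\<nu> f) {\<mu>}"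
        using fg by (simp add: emeasure_\<nu> A_def ennreal_mult)
      also have "\<dots> = (\<integral>\<^sup>+x. ennreal ((cmod (s n \<mu> - \<phi> \<mu>))\<^sup>2) * indicator {\<mu>} x \<partial>\<nu> f)"
        by (subst nn_integral_cmult_indicator) auto
      also have "\<dots> \<le> sqnorm_L2 (\<nu> f) (\<lambda>x. s n x - \<phi> x)"
        unfolding sqnorm_L2_def by (intro nn_integral_mono) (auto simp: indicator_def)
      finally show ?thesis .
    qed
    have "(\<lambda>n. ennreal ((cmod (s n \<mu> - \<phi> \<mu>))\<^sup>2 * A)) \<longlonglongrightarrow> 0"
      using lim le unfolding tendsto_L2_def
      by (intro tendsto_sandwich[OF _ _ tendsto_const lim[unfolded tendsto_L2_def]]) auto
    then have "(\<lambda>n. (cmod (s n \<mu> - \<phi> \<mu>))\<^sup>2 * A) \<longlonglongrightarrow> 0"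
      using A by (simp add: tendsto_ennreal_iff flip: ennreal_0)
    from tendsto_divide[OF this tendsto_const[of A]] A
    have "(\<lambda>n. (cmod (s n \<mu> - \<phi> \<mu>))\<^sup>2) \<longlonglongrightarrow> 0" by simp
    from tendsto_real_sqrt[OF this] have "(\<lambda>n. s n \<mu>) \<longlonglongrightarrow> \<phi> \<mu>"
      by (simp add: LIM_zero_iff tendsto_norm_zero_iff)
    from tendsto_mult[OF this tendsto_const[of "inner_L2 M f v"]] l show ?thesis
      using LIMSEQ_unique by blast
  qed
qed

text \<open>
  Both sides are \<open>\<Sum>y. y \<parallel>P(s -` {y} \<inter> B) f\<parallel>\<^sup>2\<close>.
\<close>

lemma inner_simple_integral_P:
  assumes s: "simple_function borel s" and f: "f \<in> L2 M" and B: "B \<in> sets borel"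
  shows "inner_L2 M (simple_spectral_integral P s f) (P B f) = inner_L2 (\<nu> f) s (indicator B)"
proof -
  interpret F: finite_measure "\<nu> f" using f by (rule finite_measure_\<nu>)
  have fin: "finite (range s)" using s by (simp add: simple_function_def)
  have "inner_L2 (\<nu> f) s (indicator B) = (\<integral>x. (\<Sum>y\<in>range s. indicator (B \<inter> s -` {y}) x *\<^sub>R y) \<partial>\<nu> f)"
    unfolding inner_L2_def
  proof (rule Bochner_Integration.integral_cong[OF refl])
    fix x
    have "(\<Sum>y\<in>range s. indicator (B \<inter> s -` {y}) x *\<^sub>R y) = (\<Sum>y\<in>range s. if s x = y then indicator B x *\<^sub>R y else 0)"
      by (intro sum.cong) (auto simp: indicator_def)
    also have "\<dots> = indicator B x *\<^sub>R s x" using fin by (subst sum.delta') auto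
    finally show "s x * cnj (indicator B x) = (\<Sum>y\<in>range s. indicator (B \<inter> s -` {y}) x *\<^sub>R y)"
      by (simp add: indicator_def)
  qed
  also have "\<dots> = (\<Sum>y\<in>range s. \<integral>x. indicator (B \<inter> s -` {y}) x *\<^sub>R y \<partial>\<nu> f)"
    using B s by (intro Bochner_Integration.integral_sum integrable_scaleR_left)
      (auto intro!: integrable_real_indicator simple_preimage simp: F.emeasure_finite less_top[symmetric])
  also have "\<dots> = (\<Sum>y\<in>range s. y * inner_L2 M (P (s -` {y}) f) (P B f))"
    using B f simple_preimage[OF s]
    by (intro sum.cong) (auto simp: inner_P_P inner_P_self measure_\<nu> scaleR_conv_of_real)
  also have "\<dots> = inner_L2 M (simple_spectral_integral P s f) (P B f)"
    using assms by (subst inner_simple_integral) (auto intro: P_L2)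
  finally show ?thesis by simp
qed

lemma bounded_L2_\<nu>:
  assumes "f \<in> L2 M" "h \<in> borel_measurable borel" "\<And>x. cmod (h x) \<le> C"
  shows "h \<in> L2 (\<nu> f)"
proof -
  interpret F: finite_measure "\<nu> f" using assms(1) by (rule finite_measure_\<nu>)
  have [measurable]: "h \<in> borel_measurable borel" by fact
  have "integrable (\<nu> f) (\<lambda>x. (cmod (h x))\<^sup>2)"
    by (rule F.integrable_const_bound[where B = "C\<^sup>2"]) (use assms(3) in \<open>auto intro!: AE_I2 power_mono\<close>)
  then show ?thesis by (simp add: L2_def)
qed

lemma simple_L2_\<nu>:
  assumes f: "f \<in> L2 M" and s: "simple_function borel s"
  shows "s \<in> L2 (\<nu> f)"
proof -
  have fin: "finite (range s)" using s by (simp add: simple_function_def)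
  have "cmod (s x) \<le> Max (cmod ` range s)" for x using fin by (intro Max_ge) auto
  with f s show ?thesis by (intro bounded_L2_\<nu>) (auto intro: borel_measurable_simple_function)
qed

text \<open>
  Testing \<open>\<integral> x dP v = \<mu> v\<close> against \<open>P B v\<close> gives \<open>\<integral>\<^sub>B (x - \<mu>) d\<nu> = 0\<close> for the measure
  \<open>\<nu> = \<parallel>P(\<cdot>) v\<parallel>\<^sup>2\<close> and all \<open>B\<close>. So \<open>x - \<mu>\<close> is orthogonal to simple functions, hence to itself, and \<open>\<nu>\<close> is
  carried by \<open>{\<mu>}\<close>.
\<close>

lemma eigenvector_of_spectral_integral:
  assumes vh: "(v, h) \<in> spectral_integral M P (\<lambda>s. of_real s)" and h: "AE x in M. h x = of_real \<mu> * v x"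
  shows "AE x in M. P {\<mu>} v x = v x"
proof -
  from vh obtain s where L: "v \<in> L2 M" "h \<in> L2 M" and s: "\<And>n. simple_function borel (s n)"
    and lim: "tendsto_L2 (\<nu> v) s (\<lambda>s. of_real s)"
    and limM: "tendsto_L2 M (\<lambda>n. simple_spectral_integral P (s n) v) h"
    unfolding spectral_integral_def by blast
  interpret F: finite_measure "\<nu> v" using L(1) by (rule finite_measure_\<nu>)
  define X :: "real \<Rightarrow> complex" where "X = (\<lambda>s. of_real s)"
  have sL: "s n \<in> L2 (\<nu> v)" for n using L s by (intro simple_L2_\<nu>)
  have [measurable]: "s n \<in> borel_measurable borel" for n
    using s by (intro borel_measurable_simple_function)
  have [measurable]: "X \<in> borel_measurable borel" by (simp add: X_def)
  have X: "X \<in> L2 (\<nu> v)"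
  proof -
    from lim have "\<forall>\<^sub>F n in sequentially. sqnorm_L2 (\<nu> v) (\<lambda>x. s n x - X x) < 1"
      unfolding tendsto_L2_def X_def by (rule order_tendstoD) simp
    then obtain n where "sqnorm_L2 (\<nu> v) (\<lambda>x. s n x - X x) < 1"
      by (meson eventually_sequentially order_refl)
    then have "(\<lambda>x. s n x - X x) \<in> L2 (\<nu> v)"
      by (auto simp: L2_def integrable_iff_bounded sqnorm_L2_def intro: less_trans)
    from L2_diff[OF sL[of n] this] show ?thesis by simp
  qed
  have C: "(\<lambda>x. c) \<in> L2 (\<nu> v)" for c by (rule bounded_L2_\<nu>[OF L(1), of _ "cmod c"]) auto
  have I: "indicator B \<in> L2 (\<nu> v)" if "B \<in> sets borel" for B
    using that by (intro bounded_L2_\<nu>[OF L(1), of _ 1]) (auto simp: indicator_def)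
  have orth: "inner_L2 (\<nu> v) (\<lambda>x. X x - of_real \<mu>) (indicator B) = 0" if B: "B \<in> sets borel" for B
  proof -
    have PB: "P B v \<in> L2 M" using L B by (intro P_L2)
    have "(\<lambda>n. inner_L2 M (simple_spectral_integral P (s n) v) (P B v)) \<longlonglongrightarrow> inner_L2 M h (P B v)"
      using s L limM PB by (intro tendsto_L2_inner simple_integral_L2)
    moreover have "(\<lambda>n. inner_L2 (\<nu> v) (s n) (indicator B)) \<longlonglongrightarrow> inner_L2 (\<nu> v) X (indicator B)"
      using sL X I[OF B] lim unfolding X_def[symmetric] by (intro tendsto_L2_inner)
    ultimately have "inner_L2 (\<nu> v) X (indicator B) = inner_L2 M h (P B v)"
      using s L B by (simp add: inner_simple_integral_P LIMSEQ_unique)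
    also have "\<dots> = inner_L2 M (\<lambda>x. of_real \<mu> * v x) (P B v)"
      using h L PB by (intro inner_L2_cong_AE) (auto intro: L2_mult_left)
    also have "\<dots> = of_real \<mu> * of_real (l2sq M (P B v))"
      using L B PB by (simp add: inner_L2_mult_left P_sym[symmetric] inner_P_self)
    also have "\<dots> = inner_L2 (\<nu> v) (\<lambda>x. of_real \<mu>) (indicator B)"
    proof -
      have "inner_L2 (\<nu> v) (\<lambda>x. of_real \<mu>) (indicator B) = (\<integral>x. indicator B x *\<^sub>R complex_of_real \<mu> \<partial>\<nu> v)"
        unfolding inner_L2_def by (intro Bochner_Integration.integral_cong) (auto simp: indicator_def)
      also have "\<dots> = of_real \<mu> * of_real (l2sq M (P B v))"
        using L B by (subst integral_scaleR_left)
          (auto intro!: integrable_real_indicator simp: measure_\<nu> scaleR_conv_of_real F.emeasure_finite less_top[symmetric])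
      finally show ?thesis by simp
    qed
    finally show ?thesis using X C I[OF B] by (simp add: inner_L2_diff_left)
  qed
  define D where "D x = X x - of_real \<mu>" for x
  have D: "D \<in> L2 (\<nu> v)" unfolding D_def using X C by (intro L2_diff)
  have "inner_L2 (\<nu> v) D (s n) = 0" for n
  proof -
    have fin: "finite (range (s n))" using s by (simp add: simple_function_def)
    have eq: "s n x = (\<Sum>y\<in>range (s n). y * indicator (s n -` {y}) x)" for x
    proof -
      have "(\<Sum>y\<in>range (s n). y * indicator (s n -` {y}) x) = (\<Sum>y\<in>range (s n). if s n x = y then y else 0)"
        by (intro sum.cong) (auto simp: indicator_def)
      also have "\<dots> = s n x" using fin by (subst sum.delta') auto
      finally show ?thesis by simp
    qed
    have "inner_L2 (\<nu> v) D (\<lambda>x. \<Sum>y\<in>range (s n). y * indicator (s n -` {y}) x) = 0"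
      using D I simple_preimage[OF s] orth unfolding D_def
      by (subst inner_L2_sum_right) (auto intro!: L2_mult_left sum.neutral simp: inner_L2_mult_right)
    then show ?thesis by (simp only: eq[symmetric])
  qed
  moreover have "(\<lambda>n. inner_L2 (\<nu> v) (s n) D) \<longlonglongrightarrow> inner_L2 (\<nu> v) X D"
    using sL X D lim unfolding X_def[symmetric] by (intro tendsto_L2_inner)
  ultimately have "inner_L2 (\<nu> v) X D = 0"
    by (simp add: inner_L2_commute[of "\<nu> v" _ D] LIMSEQ_const_iff)
  moreover have "inner_L2 (\<nu> v) (\<lambda>x. of_real \<mu>) D = 0"
  proof -
    have "inner_L2 (\<nu> v) D (\<lambda>x. of_real \<mu> * indicator UNIV x) = 0"
      using orth[of UNIV] unfolding D_def by (simp only: inner_L2_mult_right) simp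
    then show ?thesis by (simp add: inner_L2_commute[of "\<nu> v" _ D])
  qed
  ultimately have "inner_L2 (\<nu> v) D D = 0"
    using inner_L2_diff_left[OF X C[of "of_real \<mu>"] D] by (simp add: D_def[abs_def])
  then have "AE x in \<nu> v. D x = 0"
    using l2sq_eq_0_iff[OF D] by (simp add: inner_L2_self)
  then have "AE x in \<nu> v. x \<in> {\<mu>}"
    by eventually_elim (simp add: D_def X_def)
  then have "emeasure (\<nu> v) (UNIV - {\<mu>}) = 0"
    by (subst (asm) AE_iff_measurable[of "UNIV - {\<mu>}"]) auto
  then have "measure (\<nu> v) (UNIV - {\<mu>}) = 0" by (simp add: measure_def)
  then have "measure (\<nu> v) {\<mu>} = measure (\<nu> v) UNIV"
    using F.finite_measure_Diff[of UNIV "{\<mu>}"] by simp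
  then have eq: "l2sq M (P {\<mu>} v) = l2sq M v"
    using L l2sq_cong_AE[OF P_UNIV[OF L(1)]] P_L2[of UNIV v] by (simp add: measure_\<nu>)
  have PL: "P {\<mu>} v \<in> L2 M" using L by (intro P_L2) auto
  have "inner_L2 M (\<lambda>x. P {\<mu>} v x - v x) (\<lambda>x. P {\<mu>} v x - v x) = 0"
  proof -
    have "inner_L2 M (\<lambda>x. P {\<mu>} v x - v x) (\<lambda>x. P {\<mu>} v x - v x) =
        (inner_L2 M (P {\<mu>} v) (P {\<mu>} v) - inner_L2 M (P {\<mu>} v) v) - (inner_L2 M v (P {\<mu>} v) - inner_L2 M v v)"
      using L PL by (simp add: inner_L2_diff_left inner_L2_diff_right L2_diff)
    then show ?thesis
      using L eq inner_P_self[of "{\<mu>}" v] inner_L2_commute[of M v "P {\<mu>} v"] by (simp add: inner_L2_self)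
  qed
  then show ?thesis
    using l2sq_eq_0_iff[OF L2_diff[OF PL L(1)]] by (simp add: inner_L2_self)
qed

end

section \<open>Operators diagonal in an orthonormal system\<close>

text \<open>
  Null vectors are admitted in the system, so that Gram-Schmidt can be applied to linearly dependent
  vectors without renumbering. The coefficients against them vanish.
\<close>

locale complete_orthosystem =
  fixes M :: "'a measure" and e :: "nat \<Rightarrow> 'a \<Rightarrow> complex"
  assumes e_L2: "e j \<in> L2 M"
    and e_orth: "i \<noteq> j \<Longrightarrow> inner_L2 M (e i) (e j) = 0"
    and e_norm: "l2sq M (e j) = 0 \<or> l2sq M (e j) = 1"
    and e_complete: "f \<in> L2 M \<Longrightarrow> (\<And>j. inner_L2 M f (e j) = 0) \<Longrightarrow> AE x in M. f x = 0"
begin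

abbreviation coef :: "('a \<Rightarrow> complex) \<Rightarrow> nat \<Rightarrow> complex" where
  "coef f j \<equiv> inner_L2 M f (e j)"

definition partial_sum :: "(nat \<Rightarrow> complex) \<Rightarrow> nat \<Rightarrow> 'a \<Rightarrow> complex" where
  "partial_sum a n x = (\<Sum>j<n. a j * e j x)"

lemma partial_sum_L2: "partial_sum a n \<in> L2 M"
  unfolding partial_sum_def by (intro L2_sum L2_mult_left e_L2)

lemma coef_null: "f \<in> L2 M \<Longrightarrow> l2sq M (e j) = 0 \<Longrightarrow> coef f j = 0"
  using Cauchy_Schwarz_L2[of f M "e j"] e_L2[of j] by simp

lemma eq_AE_of_coef:
  assumes "f \<in> L2 M" "g \<in> L2 M" "\<And>j. coef f j = coef g j"
  shows "AE x in M. f x = g x"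
proof -
  have "AE x in M. f x - g x = 0"
    using assms by (intro e_complete L2_diff) (auto simp: inner_L2_diff_left e_L2)
  then show ?thesis by simp
qed

lemma inner_e_e: "inner_L2 M (e i) (e j) = (if i = j then of_real (l2sq M (e j)) else 0)"
  using e_orth by (simp add: inner_L2_self)

lemma coef_partial_sum:
  "coef (partial_sum a n) j = (if j < n then a j * of_real (l2sq M (e j)) else 0)"
proof -
  have "coef (partial_sum a n) j = (\<Sum>i<n. if i = j then a i * of_real (l2sq M (e j)) else 0)"
    unfolding partial_sum_def
  proof (subst inner_L2_sum_left)
    show "(\<Sum>i<n. coef (\<lambda>x. a i * e i x) j) = (\<Sum>i<n. if i = j then a i * of_real (l2sq M (e j)) else 0)"
      by (intro sum.cong) (auto simp: inner_L2_mult_left inner_e_e)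
  qed (auto intro!: L2_mult_left e_L2)
  then show ?thesis by (simp add: sum.delta)
qed

lemma inner_partial_sum_right:
  assumes "f \<in> L2 M"
  shows "inner_L2 M f (partial_sum a n) = (\<Sum>j<n. cnj (a j) * coef f j)"
  unfolding partial_sum_def using assms
  by (subst inner_L2_sum_right) (auto simp: inner_L2_mult_right intro!: L2_mult_left e_L2)

text \<open>
  Pythagoras. The condition on \<open>a\<close> makes \<open>a\<^sub>j \<parallel>e\<^sub>j\<parallel>\<^sup>2 = a\<^sub>j\<close> hold for the null vectors too.
\<close>

lemma l2sq_partial_sum_diff:
  assumes a: "\<And>j. l2sq M (e j) = 0 \<Longrightarrow> a j = 0" and mn: "m \<le> n"
  shows "l2sq M (\<lambda>x. partial_sum a n x - partial_sum a m x) = (\<Sum>j=m..<n. (cmod (a j))\<^sup>2)"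
proof -
  have a1: "a j * of_real (l2sq M (e j)) = a j" for j using a[of j] e_norm[of j] by auto
  have c: "coef (\<lambda>x. partial_sum a n x - partial_sum a m x) j = (if j < n \<and> \<not> j < m then a j else 0)" for j
    using mn by (auto simp: inner_L2_diff_left partial_sum_L2 e_L2 coef_partial_sum a1)
  have "inner_L2 M (\<lambda>x. partial_sum a n x - partial_sum a m x) (\<lambda>x. partial_sum a n x - partial_sum a m x)
     = (\<Sum>j<n. cnj (a j) * (if j < n \<and> \<not> j < m then a j else 0)) - (\<Sum>j<m. cnj (a j) * (if j < n \<and> \<not> j < m then a j else 0))"
    by (subst inner_L2_diff_right)
      (auto simp only: partial_sum_L2 L2_diff inner_partial_sum_right c)
  also have "(\<Sum>j<m. cnj (a j) * (if j < n \<and> \<not> j < m then a j else 0)) = 0"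
    by (intro sum.neutral) auto
  also have "(\<Sum>j<n. cnj (a j) * (if j < n \<and> \<not> j < m then a j else 0)) = (\<Sum>j=m..<n. cnj (a j) * a j)"
    by (rule sum.mono_neutral_cong_right) auto
  also have "(\<Sum>j=m..<n. cnj (a j) * a j) - 0 = of_real (\<Sum>j=m..<n. (cmod (a j))\<^sup>2)"
    by (simp only: diff_zero of_real_sum complex_norm_square mult.commute)
  finally show ?thesis unfolding inner_L2_self of_real_eq_iff .
qed

lemma ex_of_coef:
  assumes a: "\<And>j. l2sq M (e j) = 0 \<Longrightarrow> a j = 0" and sm: "summable (\<lambda>j. (cmod (a j))\<^sup>2)"
  shows "\<exists>g\<in>L2 M. tendsto_L2 M (partial_sum a) g \<and> (\<forall>j. coef g j = a j)"
proof -
  have "\<exists>g\<in>L2 M. tendsto_L2 M (partial_sum a) g"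
  proof (rule L2_Cauchy_convergent)
    fix d :: real assume "d > 0"
    then obtain K where K: "\<And>m n. m \<ge> K \<Longrightarrow> norm (\<Sum>j=m..<n. (cmod (a j))\<^sup>2) < d"
      using sm unfolding summable_Cauchy by blast
    have le: "l2sq M (\<lambda>x. partial_sum a n x - partial_sum a m x) < d" if "K \<le> m" "m \<le> n" for m n
      using K[of m n] that a by (simp add: l2sq_partial_sum_diff sum_nonneg)
    show "\<exists>K. \<forall>m\<ge>K. \<forall>n\<ge>K. l2sq M (\<lambda>x. partial_sum a m x - partial_sum a n x) < d"
    proof (intro exI allI impI)
      fix m n assume "K \<le> m" "K \<le> n"
      then show "l2sq M (\<lambda>x. partial_sum a m x - partial_sum a n x) < d"
        using le[of m n] le[of n m] l2sq_diff_commute[of M "partial_sum a m" "partial_sum a n"]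
        by (cases "m \<le> n") auto
    qed
  qed (rule partial_sum_L2)
  then obtain g where g: "g \<in> L2 M" "tendsto_L2 M (partial_sum a) g" by blast
  have "coef g j = a j" for j
  proof -
    have "(\<lambda>n. coef (partial_sum a n) j) \<longlonglongrightarrow> coef g j"
      using g by (intro tendsto_L2_inner partial_sum_L2 e_L2)
    moreover have "\<forall>\<^sub>F n in sequentially. coef (partial_sum a n) j = a j"
      using eventually_gt_at_top[of j] by eventually_elim (use a[of j] e_norm[of j] in \<open>auto simp: coef_partial_sum\<close>)
    then have "(\<lambda>n. coef (partial_sum a n) j) \<longlonglongrightarrow> a j" by (rule tendsto_eventually)
    ultimately show ?thesis by (rule LIMSEQ_unique)
  qed
  with g show ?thesis by blast
qed

lemma Bessel:
  assumes f: "f \<in> L2 M" shows "(\<Sum>j<n. (cmod (coef f j))\<^sup>2) \<le> l2sq M f"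
proof -
  let ?s = "partial_sum (coef f) n"
  have s: "?s \<in> L2 M" by (rule partial_sum_L2)
  have sum: "(\<Sum>j<n. cnj (coef f j) * coef f j) = of_real (\<Sum>j<n. (cmod (coef f j))\<^sup>2)"
    by (simp only: of_real_sum complex_norm_square mult.commute)
  have fs: "inner_L2 M f ?s = of_real (\<Sum>j<n. (cmod (coef f j))\<^sup>2)"
    using inner_partial_sum_right[OF f, of "coef f" n] sum by simp
  have a1: "coef f j * of_real (l2sq M (e j)) = coef f j" for j
    using coef_null[OF f, of j] e_norm[of j] by auto
  have "inner_L2 M ?s ?s = (\<Sum>j<n. cnj (coef f j) * (coef f j * of_real (l2sq M (e j))))"
    by (subst inner_partial_sum_right[OF s]) (simp add: coef_partial_sum)
  then have "inner_L2 M ?s ?s = of_real (\<Sum>j<n. (cmod (coef f j))\<^sup>2)"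
    by (simp only: a1 sum)
  then have ss: "l2sq M ?s = (\<Sum>j<n. (cmod (coef f j))\<^sup>2)"
    unfolding inner_L2_self of_real_eq_iff .
  have "0 \<le> l2sq M (\<lambda>x. f x + (-1) * ?s x)" by simp
  also have "\<dots> = l2sq M f + l2sq M ?s + 2 * Re (- inner_L2 M f ?s)"
    using f s by (subst l2sq_add) (auto intro: L2_mult_left simp only: l2sq_mult inner_L2_mult_right, simp)
  also have "\<dots> = l2sq M f - (\<Sum>j<n. (cmod (coef f j))\<^sup>2)" by (simp add: fs ss)
  finally show ?thesis by simp
qed

lemma summable_coef: "f \<in> L2 M \<Longrightarrow> summable (\<lambda>j. (cmod (coef f j))\<^sup>2)"
  by (rule summableI_nonneg_bounded[of _ "l2sq M f"]) (auto intro: Bessel)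

lemma expansion:
  assumes f: "f \<in> L2 M" shows "tendsto_L2 M (partial_sum (coef f)) f"
proof -
  obtain g where g: "g \<in> L2 M" "tendsto_L2 M (partial_sum (coef f)) g" "\<And>j. coef g j = coef f j"
    using ex_of_coef[of "coef f"] coef_null[OF f] summable_coef[OF f] by blast
  have gf: "AE x in M. g x = f x" using g f by (intro eq_AE_of_coef) auto
  have "l2sq M (\<lambda>x. partial_sum (coef f) n x - g x) = l2sq M (\<lambda>x. partial_sum (coef f) n x - f x)" for n
    using gf f g by (intro l2sq_cong_AE L2_diff partial_sum_L2) auto
  then show ?thesis
    using g f by (simp add: tendsto_L2_iff partial_sum_L2)
qed

lemma Parseval_inner:
  assumes f: "f \<in> L2 M" and g: "g \<in> L2 M"
  shows "(\<lambda>j. coef f j * cnj (coef g j)) sums inner_L2 M f g"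
proof -
  have "(\<lambda>n. inner_L2 M (partial_sum (coef f) n) g) \<longlonglongrightarrow> inner_L2 M f g"
    using f g expansion by (intro tendsto_L2_inner partial_sum_L2)
  moreover have "inner_L2 M (partial_sum (coef f) n) g = (\<Sum>j<n. coef f j * cnj (coef g j))" for n
    by (simp add: inner_L2_commute[of M "partial_sum (coef f) n"] inner_partial_sum_right[OF g])
  ultimately show ?thesis by (simp add: sums_def)
qed

lemma Parseval:
  assumes f: "f \<in> L2 M" shows "(\<lambda>j. (cmod (coef f j))\<^sup>2) sums l2sq M f"
proof -
  have "(\<lambda>j. complex_of_real ((cmod (coef f j))\<^sup>2)) sums of_real (l2sq M f)"
    using Parseval_inner[OF f f] by (simp only: complex_norm_square inner_L2_self)
  then show ?thesis by (simp only: sums_of_real_iff)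
qed

text \<open>
  Dominated convergence for the series in Parseval's identity, by Tannery's theorem.
\<close>

lemma tendsto_L2_coef:
  assumes h: "\<And>n. h n \<in> L2 M" "k \<in> L2 M"
    and lim: "\<And>j. (\<lambda>n. coef (h n) j) \<longlonglongrightarrow> coef k j"
    and D: "\<And>n j. (cmod (coef (h n) j - coef k j))\<^sup>2 \<le> D j" "summable D"
  shows "tendsto_L2 M h k"
proof -
  have "(\<lambda>n. \<Sum>j. (cmod (coef (h n) j - coef k j))\<^sup>2) \<longlonglongrightarrow> (\<Sum>j::nat. (0::real))"
  proof (rule tannerys_theorem[THEN conjunct2, THEN conjunct2])
    fix j
    have "(\<lambda>n. (cmod (coef (h n) j - coef k j))\<^sup>2) \<longlonglongrightarrow> (cmod (coef k j - coef k j))\<^sup>2"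
      by (intro tendsto_intros lim)
    then show "(\<lambda>n. (cmod (coef (h n) j - coef k j))\<^sup>2) \<longlonglongrightarrow> 0" by simp
    show "\<forall>\<^sub>F (j, n) in at_top \<times>\<^sub>F sequentially. norm ((cmod (coef (h n) j - coef k j))\<^sup>2) \<le> D j"
      using D(1) by (intro always_eventually) auto
    show "summable D" by fact
  qed simp
  moreover have "(\<Sum>j. (cmod (coef (h n) j - coef k j))\<^sup>2) = l2sq M (\<lambda>x. h n x - k x)" for n
    using Parseval[OF L2_diff[OF h], THEN sums_unique] h by (simp add: inner_L2_diff_left e_L2)
  ultimately show ?thesis using h by (simp add: tendsto_L2_iff)
qed

text \<open>
  The choice is only of a representative: its coefficients determine a function almost
  everywhere.
\<close>

definition diagonal_proj :: "(nat \<Rightarrow> real) \<Rightarrow> real set \<Rightarrow> ('a \<Rightarrow> complex) \<Rightarrow> ('a \<Rightarrow> complex)" where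
  "diagonal_proj \<mu> B f = (SOME g. g \<in> L2 M \<and> (\<forall>j. coef g j = indicator B (\<mu> j) * coef f j))"

lemma ex_multiplier:
  assumes f: "f \<in> L2 M" and m: "\<And>j. cmod (m j) \<le> C"
  shows "\<exists>g. g \<in> L2 M \<and> (\<forall>j. coef g j = m j * coef f j)"
proof -
  have "summable (\<lambda>j. (cmod (m j * coef f j))\<^sup>2)"
  proof (rule summable_comparison_test'[where N = 0])
    show "summable (\<lambda>j. C\<^sup>2 * (cmod (coef f j))\<^sup>2)" by (intro summable_mult summable_coef f)
    show "norm ((cmod (m j * coef f j))\<^sup>2) \<le> C\<^sup>2 * (cmod (coef f j))\<^sup>2" for j
      using m[of j] by (auto simp: norm_mult power_mult_distrib intro!: mult_right_mono power_mono)
  qed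
  then show ?thesis using ex_of_coef[of "\<lambda>j. m j * coef f j"] coef_null[OF f] by auto
qed

lemma
  assumes f: "f \<in> L2 M"
  shows diagonal_proj_L2: "diagonal_proj \<mu> B f \<in> L2 M"
    and coef_diagonal_proj: "coef (diagonal_proj \<mu> B f) j = indicator B (\<mu> j) * coef f j"
proof -
  have "\<exists>g. g \<in> L2 M \<and> (\<forall>j. coef g j = indicator B (\<mu> j) * coef f j)"
    using f by (rule ex_multiplier[where C = 1]) (simp add: indicator_def)
  then have "diagonal_proj \<mu> B f \<in> L2 M \<and> (\<forall>j. coef (diagonal_proj \<mu> B f) j = indicator B (\<mu> j) * coef f j)"
    unfolding diagonal_proj_def by (rule someI_ex)
  then show "diagonal_proj \<mu> B f \<in> L2 M"
    and "coef (diagonal_proj \<mu> B f) j = indicator B (\<mu> j) * coef f j" by auto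
qed

lemma pvm_diagonal_proj: "projection_valued_measure M (diagonal_proj \<mu>)"
  unfolding projection_valued_measure_def
proof (intro conjI ballI allI impI)
  fix B f assume "f \<in> L2 M" then show "diagonal_proj \<mu> B f \<in> L2 M" by (rule diagonal_proj_L2)
next
  fix B f g assume f: "f \<in> L2 M" and g: "g \<in> L2 M"
  have "(\<lambda>j. coef (diagonal_proj \<mu> B f) j * cnj (coef g j)) sums inner_L2 M (diagonal_proj \<mu> B f) g"
    using f g by (intro Parseval_inner diagonal_proj_L2)
  moreover have "(\<lambda>j. coef f j * cnj (coef (diagonal_proj \<mu> B g) j)) sums inner_L2 M f (diagonal_proj \<mu> B g)"
    using f g by (intro Parseval_inner diagonal_proj_L2)
  moreover have "coef (diagonal_proj \<mu> B f) j * cnj (coef g j) = coef f j * cnj (coef (diagonal_proj \<mu> B g) j)" for j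
    using f g by (simp add: coef_diagonal_proj indicator_def)
  ultimately show "inner_L2 M (diagonal_proj \<mu> B f) g = inner_L2 M f (diagonal_proj \<mu> B g)"
    using sums_unique2 by auto
next
  fix A B f assume f: "f \<in> L2 M"
  then show "AE x in M. diagonal_proj \<mu> (A \<inter> B) f x = diagonal_proj \<mu> A (diagonal_proj \<mu> B f) x"
    by (intro eq_AE_of_coef) (auto simp: diagonal_proj_L2 coef_diagonal_proj indicator_def)
next
  fix f assume f: "f \<in> L2 M"
  then show "AE x in M. diagonal_proj \<mu> UNIV f x = f x"
    by (intro eq_AE_of_coef) (auto simp: diagonal_proj_L2 coef_diagonal_proj)
next
  fix B :: "nat \<Rightarrow> real set" and f
  assume B: "range B \<subseteq> sets borel" "disjoint_family B" and f: "f \<in> L2 M"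
  have c: "coef (\<lambda>x. \<Sum>i<n. diagonal_proj \<mu> (B i) f x) j = indicator (\<Union>i<n. B i) (\<mu> j) * coef f j" for n j
  proof -
    have "(indicator (\<Union>i<n. B i) (\<mu> j) :: complex) = (\<Sum>i<n. indicator (B i) (\<mu> j))"
      using B(2) by (intro indicator_UN_disjoint) (auto simp: disjoint_family_on_def)
    then show ?thesis
      using f by (subst inner_L2_sum_left) (auto simp: diagonal_proj_L2 e_L2 coef_diagonal_proj sum_distrib_right)
  qed
  show "tendsto_L2 M (\<lambda>n x. \<Sum>i<n. diagonal_proj \<mu> (B i) f x) (diagonal_proj \<mu> (\<Union>i. B i) f)"
  proof (rule tendsto_L2_coef)
    show "(\<lambda>x. \<Sum>i<n. diagonal_proj \<mu> (B i) f x) \<in> L2 M" for n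
      using f by (intro L2_sum diagonal_proj_L2)
    show "diagonal_proj \<mu> (\<Union>i. B i) f \<in> L2 M" using f by (rule diagonal_proj_L2)
    show "(\<lambda>n. coef (\<lambda>x. \<Sum>i<n. diagonal_proj \<mu> (B i) f x) j) \<longlonglongrightarrow> coef (diagonal_proj \<mu> (\<Union>i. B i) f) j" for j
    proof -
      have "\<forall>\<^sub>F n in sequentially. (indicator (\<Union>i<n. B i) (\<mu> j) :: complex) = indicator (\<Union>i. B i) (\<mu> j)"
      proof (cases "\<exists>i. \<mu> j \<in> B i")
        case True
        then obtain i where i: "\<mu> j \<in> B i" by blast
        show ?thesis using eventually_gt_at_top[of i] by eventually_elim (use i in \<open>auto simp: indicator_def\<close>)
      qed (auto simp: indicator_def)
      then have "\<forall>\<^sub>F n in sequentially. coef (\<lambda>x. \<Sum>i<n. diagonal_proj \<mu> (B i) f x) j = coef (diagonal_proj \<mu> (\<Union>i. B i) f) j"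
        by eventually_elim (simp add: c coef_diagonal_proj[OF f])
      then show ?thesis by (rule tendsto_eventually)
    qed
    show "(cmod (coef (\<lambda>x. \<Sum>i<n. diagonal_proj \<mu> (B i) f x) j - coef (diagonal_proj \<mu> (\<Union>i. B i) f) j))\<^sup>2
       \<le> (cmod (coef f j))\<^sup>2" for n j
      unfolding c coef_diagonal_proj[OF f] by (auto simp: indicator_def)
    show "summable (\<lambda>j. (cmod (coef f j))\<^sup>2)" by (rule summable_coef[OF f])
  qed
qed

sublocale D: pvm M "diagonal_proj \<mu>" for \<mu>
  by unfold_locales (rule pvm_diagonal_proj)

lemma diagonal_proj_e: "AE x in M. diagonal_proj \<mu> {\<mu> j} (e j) x = e j x"
proof (rule eq_AE_of_coef)
  fix i show "coef (diagonal_proj \<mu> {\<mu> j} (e j)) i = coef (e j) i"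
    by (cases "i = j") (auto simp: coef_diagonal_proj e_L2 e_orth)
qed (auto intro: diagonal_proj_L2 e_L2)

definition diagonal_operator :: "(nat \<Rightarrow> complex) \<Rightarrow> 'a op_graph" where
  "diagonal_operator m = {(f, g). f \<in> L2 M \<and> g \<in> L2 M \<and> (\<forall>j. coef g j = m j * coef f j)}"

text \<open>
  The measure \<open>\<parallel>P(\<cdot>) f\<parallel>\<^sup>2\<close> is \<open>\<Sum>\<^sub>j \<bar>\<langle>f, e\<^sub>j\<rangle>\<bar>\<^sup>2 \<delta>\<^bsub>\<mu>(j)\<^esub>\<close>, by Parseval's identity.
\<close>

lemma nn_integral_diagonal:
  assumes f: "f \<in> L2 M" and h: "h \<in> borel_measurable borel"
  shows "(\<integral>\<^sup>+x. h x \<partial>scalar_spectral_measure M (diagonal_proj \<mu>) f)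
      = (\<Sum>j. ennreal ((cmod (coef f j))\<^sup>2) * h (\<mu> j))"
proof -
  let ?N = "distr (density (count_space UNIV) (\<lambda>j. ennreal ((cmod (coef f j))\<^sup>2))) borel \<mu>"
  have "scalar_spectral_measure M (diagonal_proj \<mu>) f = ?N"
  proof (rule measure_eqI)
    fix B assume "B \<in> sets (scalar_spectral_measure M (diagonal_proj \<mu>) f)"
    then have B: "B \<in> sets borel" by simp
    have "emeasure ?N B = (\<integral>\<^sup>+j. ennreal ((cmod (coef f j))\<^sup>2) * indicator (\<mu> -` B) j \<partial>count_space UNIV)"
      using B by (simp add: emeasure_distr emeasure_density)
    also have "\<dots> = (\<Sum>j. ennreal ((cmod (coef (diagonal_proj \<mu> B f) j))\<^sup>2))"
      unfolding nn_integral_count_space_nat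
      by (intro suminf_cong) (auto simp: coef_diagonal_proj[OF f] indicator_def)
    also have "\<dots> = ennreal (l2sq M (diagonal_proj \<mu> B f))"
      using Parseval[OF diagonal_proj_L2[OF f]] by (intro suminf_ennreal_eq) auto
    finally show "emeasure (scalar_spectral_measure M (diagonal_proj \<mu>) f) B = emeasure ?N B"
      using f B by (simp add: D.emeasure_\<nu>)
  qed simp
  then show ?thesis using h
    by (simp add: nn_integral_distr nn_integral_density nn_integral_count_space_nat)
qed

text \<open>
  For the inclusion from right to left, take simple functions \<open>s\<^sub>n \<longlonglongrightarrow> \<phi>\<close> with \<open>\<bar>s\<^sub>n\<bar> \<le> 2 \<bar>\<phi>\<bar>\<close>. Both limits
  that define the spectral integral then concern the same number
  \<open>\<Sum>\<^sub>j \<bar>s\<^sub>n(\<mu> j) - \<phi>(\<mu> j)\<bar>\<^sup>2 \<bar>\<langle>f, e\<^sub>j\<rangle>\<bar>\<^sup>2\<close>, whose terms are dominated by \<open>9 \<bar>\<langle>g, e\<^sub>j\<rangle>\<bar>\<^sup>2\<close>.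
\<close>

lemma spectral_integral_diagonal:
  fixes \<phi> :: "real \<Rightarrow> complex"
  assumes \<phi>: "\<phi> \<in> borel_measurable borel"
  shows "spectral_integral M (diagonal_proj \<mu>) \<phi> = diagonal_operator (\<lambda>j. \<phi> (\<mu> j))"
proof (rule set_eqI, safe)
  fix f g assume fg: "(f, g) \<in> spectral_integral M (diagonal_proj \<mu>) \<phi>"
  have "coef g j = \<phi> (\<mu> j) * coef f j" for j
    by (rule D.spectral_integral_eigenvector[OF e_L2 diagonal_proj_e fg])
  with fg show "(f, g) \<in> diagonal_operator (\<lambda>j. \<phi> (\<mu> j))"
    by (auto simp: diagonal_operator_def spectral_integral_def)
next
  fix f g assume "(f, g) \<in> diagonal_operator (\<lambda>j. \<phi> (\<mu> j))"
  then have f: "f \<in> L2 M" and g: "g \<in> L2 M" and c: "\<And>j. coef g j = \<phi> (\<mu> j) * coef f j"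
    by (auto simp: diagonal_operator_def)
  obtain s where s: "\<And>n. simple_function borel (s n)" and lim: "\<And>x. (\<lambda>n. s n x) \<longlonglongrightarrow> \<phi> x"
    and bd: "\<And>n x. cmod (s n x) \<le> 2 * cmod (\<phi> x)"
    using borel_measurable_implies_sequence_metric[OF \<phi>, of 0] by auto
  let ?S = "\<lambda>n. simple_spectral_integral (diagonal_proj \<mu>) (s n) f"
  have SL: "?S n \<in> L2 M" for n using s f by (intro D.simple_integral_L2)
  have cS: "coef (?S n) j = s n (\<mu> j) * coef f j" for n j
    by (rule D.inner_simple_integral_eigenvector[OF e_L2 diagonal_proj_e f s])
  have l1: "tendsto_L2 M ?S g"
  proof (rule tendsto_L2_coef)
    show "(\<lambda>n. coef (?S n) j) \<longlonglongrightarrow> coef g j" for j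
      unfolding cS c by (intro tendsto_intros lim)
    show "(cmod (coef (?S n) j - coef g j))\<^sup>2 \<le> 9 * (cmod (coef g j))\<^sup>2" for n j
    proof -
      have "cmod (s n (\<mu> j) - \<phi> (\<mu> j)) \<le> 3 * cmod (\<phi> (\<mu> j))"
        using norm_triangle_ineq4[of "s n (\<mu> j)" "\<phi> (\<mu> j)"] bd[of n "\<mu> j"] by linarith
      then have "cmod (s n (\<mu> j) - \<phi> (\<mu> j)) * cmod (coef f j) \<le> 3 * cmod (\<phi> (\<mu> j)) * cmod (coef f j)"
        by (intro mult_right_mono) auto
      then have "cmod (coef (?S n) j - coef g j) \<le> 3 * cmod (coef g j)"
        unfolding cS c left_diff_distrib[symmetric] by (simp add: norm_mult mult.assoc)
      then have "(cmod (coef (?S n) j - coef g j))\<^sup>2 \<le> (3 * cmod (coef g j))\<^sup>2"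
        by (intro power_mono) auto
      then show ?thesis by (simp add: power_mult_distrib)
    qed
    show "summable (\<lambda>j. 9 * (cmod (coef g j))\<^sup>2)" by (intro summable_mult summable_coef g)
  qed (use SL g in auto)
  have "sqnorm_L2 (scalar_spectral_measure M (diagonal_proj \<mu>) f) (\<lambda>x. s n x - \<phi> x)
      = ennreal (l2sq M (\<lambda>x. ?S n x - g x))" for n
  proof -
    have [measurable]: "s n \<in> borel_measurable borel" using s by (intro borel_measurable_simple_function)
    note \<phi>[measurable]
    have "sqnorm_L2 (scalar_spectral_measure M (diagonal_proj \<mu>) f) (\<lambda>x. s n x - \<phi> x)
        = (\<Sum>j. ennreal ((cmod (coef f j))\<^sup>2) * ennreal ((cmod (s n (\<mu> j) - \<phi> (\<mu> j)))\<^sup>2))"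
      unfolding sqnorm_L2_def using f by (subst nn_integral_diagonal) auto
    also have "\<dots> = (\<Sum>j. ennreal ((cmod (coef (\<lambda>x. ?S n x - g x) j))\<^sup>2))"
    proof (intro suminf_cong)
      fix j
      have "coef (\<lambda>x. ?S n x - g x) j = (s n (\<mu> j) - \<phi> (\<mu> j)) * coef f j"
        using SL g by (simp add: inner_L2_diff_left e_L2 cS c left_diff_distrib)
      then show "ennreal ((cmod (coef f j))\<^sup>2) * ennreal ((cmod (s n (\<mu> j) - \<phi> (\<mu> j)))\<^sup>2)
          = ennreal ((cmod (coef (\<lambda>x. ?S n x - g x) j))\<^sup>2)"
        by (simp add: norm_mult power_mult_distrib ennreal_mult mult.commute)
    qed
    also have "\<dots> = ennreal (l2sq M (\<lambda>x. ?S n x - g x))"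
      using Parseval[OF L2_diff[OF SL g]] by (intro suminf_ennreal_eq) auto
    finally show ?thesis .
  qed
  moreover have "(\<lambda>n. l2sq M (\<lambda>x. ?S n x - g x)) \<longlonglongrightarrow> 0"
    using l1 tendsto_L2_iff[OF SL g] by simp
  ultimately have "tendsto_L2 (scalar_spectral_measure M (diagonal_proj \<mu>) f) s \<phi>"
    unfolding tendsto_L2_def by (simp add: tendsto_ennreal_iff flip: ennreal_0)
  with f g s l1 show "(f, g) \<in> spectral_integral M (diagonal_proj \<mu>) \<phi>"
    unfolding spectral_integral_def by blast
qed

text \<open>
  The functional calculus uses some spectral measure \<open>P\<close> of \<open>T\<close>; that there is one is shown by the
  diagonal projections. Whichever it is, the \<open>e\<^sub>j\<close> are eigenvectors of \<open>T = \<integral> x dP\<close>, so \<open>P{\<mu> j} e\<^sub>j = e\<^sub>j\<close>, and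
  this determines the coefficients of \<open>\<integral> \<phi> dP f\<close>.
\<close>

lemma functional_calculus_diagonal:
  fixes \<phi> :: "real \<Rightarrow> complex" and \<mu> :: "nat \<Rightarrow> real"
  assumes \<phi>: "\<phi> \<in> borel_measurable borel" "\<And>s. cmod (\<phi> s) \<le> C" and f: "f \<in> L2 M"
  defines "T \<equiv> diagonal_operator (\<lambda>j. of_real (\<mu> j))"
  shows "functional_calculus M T \<phi> f \<in> L2 M"
    and "coef (functional_calculus M T \<phi> f) j = \<phi> (\<mu> j) * coef f j"
proof -
  let ?Q = "\<lambda>U. \<exists>P. spectral_measure_of M T P \<and> (\<forall>f\<in>L2 M. (f, U f) \<in> spectral_integral M P \<phi>)"
  have "\<forall>f\<in>L2 M. \<exists>g. (f, g) \<in> diagonal_operator (\<lambda>j. \<phi> (\<mu> j))"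
    using ex_multiplier[of _ "\<lambda>j. \<phi> (\<mu> j)"] \<phi>(2) unfolding diagonal_operator_def by blast
  then obtain U where "\<forall>f\<in>L2 M. (f, U f) \<in> spectral_integral M (diagonal_proj \<mu>) \<phi>"
    using spectral_integral_diagonal[OF \<phi>(1)] by metis
  moreover have "spectral_measure_of M T (diagonal_proj \<mu>)"
    unfolding spectral_measure_of_def T_def
    by (intro conjI pvm_diagonal_proj spectral_integral_diagonal) simp
  ultimately have "\<exists>U. ?Q U" by blast
  then have "?Q (functional_calculus M T \<phi>)" unfolding functional_calculus_def by (rule someI_ex)
  then obtain P where P: "spectral_measure_of M T P"
    and fP: "(f, functional_calculus M T \<phi> f) \<in> spectral_integral M P \<phi>" using f by blast
  show "functional_calculus M T \<phi> f \<in> L2 M" using fP by (auto simp: spectral_integral_def)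
  interpret P: pvm M P using P by unfold_locales (simp add: spectral_measure_of_def)
  have "(e j, \<lambda>x. of_real (\<mu> j) * e j x) \<in> T"
    unfolding T_def diagonal_operator_def by (auto simp: e_L2 L2_mult_left inner_L2_mult_left inner_e_e)
  then have "(e j, \<lambda>x. of_real (\<mu> j) * e j x) \<in> spectral_integral M P (\<lambda>s. of_real s)"
    using P by (simp add: spectral_measure_of_def)
  then have "AE x in M. P {\<mu> j} (e j) x = e j x"
    by (rule P.eigenvector_of_spectral_integral) simp
  from P.spectral_integral_eigenvector[OF e_L2 this fP]
  show "coef (functional_calculus M T \<phi> f) j = \<phi> (\<mu> j) * coef f j" .
qed

end

section \<open>Gram-Schmidt orthonormalization\<close>

definition fun_subspace :: "('a \<Rightarrow> complex) set \<Rightarrow> bool" where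
  "fun_subspace S \<longleftrightarrow> (\<lambda>x. 0) \<in> S \<and> (\<forall>f\<in>S. \<forall>g\<in>S. (\<lambda>x. f x + g x) \<in> S) \<and> (\<forall>c. \<forall>f\<in>S. (\<lambda>x. c * f x) \<in> S)"

lemma fun_subspaceD:
  assumes "fun_subspace S"
  shows "f \<in> S \<Longrightarrow> g \<in> S \<Longrightarrow> (\<lambda>x. f x + g x) \<in> S" "f \<in> S \<Longrightarrow> (\<lambda>x. c * f x) \<in> S"
  using assms by (auto simp: fun_subspace_def)

lemma fun_subspace_sum: "fun_subspace S \<Longrightarrow> (\<And>i. i \<in> I \<Longrightarrow> f i \<in> S) \<Longrightarrow> (\<lambda>x. \<Sum>i\<in>I. f i x) \<in> S"
  by (induction I rule: infinite_finite_induct) (auto simp: fun_subspace_def)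

lemma fun_subspace_L2_orth: "w \<in> L2 M \<Longrightarrow> fun_subspace {u \<in> L2 M. inner_L2 M u w = 0}"
  by (simp add: fun_subspace_def L2_zero L2_add L2_mult_left inner_L2_add_left inner_L2_mult_left)

text \<open>
  Separated from the recursion below, which needs a congruence rule for the sum over earlier
  vectors.
\<close>

definition gs_residual :: "'a measure \<Rightarrow> (nat \<Rightarrow> 'a \<Rightarrow> complex) \<Rightarrow> (nat \<Rightarrow> 'a \<Rightarrow> complex) \<Rightarrow> nat \<Rightarrow> 'a \<Rightarrow> complex" where
  "gs_residual M v e j = (\<lambda>x. v j x + (-1) * (\<Sum>i<j. inner_L2 M (v j) (e i) * e i x))"

lemma gs_residual_cong [fundef_cong]:
  "M = M' \<Longrightarrow> v = v' \<Longrightarrow> j = j' \<Longrightarrow> (\<And>i. i < j' \<Longrightarrow> e i = e' i) \<Longrightarrow> gs_residual M v e j = gs_residual M' v' e' j'"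
  unfolding gs_residual_def by (auto intro!: sum.cong)

text \<open>
  As \<open>inverse 0 = 0\<close>, a null residual yields the zero function.
\<close>

fun gram_schmidt :: "'a measure \<Rightarrow> (nat \<Rightarrow> 'a \<Rightarrow> complex) \<Rightarrow> nat \<Rightarrow> 'a \<Rightarrow> complex" where
  "gram_schmidt M v j = (\<lambda>x. of_real (inverse (sqrt (l2sq M (gs_residual M v (gram_schmidt M v) j))))
      * gs_residual M v (gram_schmidt M v) j x)"

declare gram_schmidt.simps [simp del]

lemma gram_schmidt_L2: 
  assumes v: "\<And>j. v j \<in> L2 M"
  shows "gram_schmidt M v j \<in> L2 M"
proof (induction j rule: less_induct)
  case (less j)
  then show ?case
    unfolding gram_schmidt.simps[of M v j] gs_residual_def
    by (intro L2_mult_left L2_add L2_sum v) auto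
qed

lemma gs_residual_L2: "(\<And>j. v j \<in> L2 M) \<Longrightarrow> gs_residual M v (gram_schmidt M v) j \<in> L2 M"
  unfolding gs_residual_def by (intro L2_mult_left L2_add L2_sum gram_schmidt_L2) auto

lemma l2sq_gram_schmidt: "l2sq M (gram_schmidt M v j) = 0 \<or> l2sq M (gram_schmidt M v j) = 1"
proof -
  define R where "R = l2sq M (gs_residual M v (gram_schmidt M v) j)"
  have "R \<ge> 0" by (simp add: R_def)
  then have "(inverse (sqrt R))\<^sup>2 * R = (if R = 0 then 0 else 1)" by (simp add: power_inverse)
  moreover have "l2sq M (gram_schmidt M v j) = (inverse (sqrt R))\<^sup>2 * R"
    unfolding gram_schmidt.simps[of M v j] l2sq_mult R_def by (simp only: norm_of_real power2_abs)
  ultimately show ?thesis by auto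
qed

text \<open>
  Subtracting \<open>\<langle>v\<^sub>j, e\<^sub>i\<rangle> e\<^sub>i\<close> removes the component along \<open>e\<^sub>i\<close> also when \<open>e\<^sub>i\<close> is null, since then
  \<open>\<langle>v\<^sub>j, e\<^sub>i\<rangle> = 0\<close>.
\<close>

lemma gram_schmidt_orth_less:
  assumes v: "\<And>j. v j \<in> L2 M"
  shows "i < j \<Longrightarrow> inner_L2 M (gram_schmidt M v j) (gram_schmidt M v i) = 0"
proof (induction j arbitrary: i rule: less_induct)
  case (less j)
  let ?e = "gram_schmidt M v"
  note e = gram_schmidt_L2[of v M, OF v]
  have o: "inner_L2 M (?e k) (?e i) = (if k = i then of_real (l2sq M (?e i)) else 0)" if "k < j" for k
    using less.IH[of k i] less.IH[of i k] that less.prems inner_L2_commute[of M "?e k" "?e i"]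
    by (cases k i rule: linorder_cases) (auto simp: inner_L2_self)
  have "inner_L2 M (gs_residual M v ?e j) (?e i)
      = inner_L2 M (v j) (?e i) + (-1) * (\<Sum>k<j. inner_L2 M (v j) (?e k) * inner_L2 M (?e k) (?e i))"
    unfolding gs_residual_def using v e
    by (simp only: inner_L2_add_left inner_L2_mult_left inner_L2_sum_left L2_sum L2_mult_left)
  also have "(\<Sum>k<j. inner_L2 M (v j) (?e k) * inner_L2 M (?e k) (?e i))
      = (\<Sum>k<j. if k = i then inner_L2 M (v j) (?e i) * of_real (l2sq M (?e i)) else 0)"
    by (intro sum.cong) (auto simp: o)
  also have "\<dots> = inner_L2 M (v j) (?e i) * of_real (l2sq M (?e i))"
    using less.prems by (simp add: sum.delta)
  also have "\<dots> = inner_L2 M (v j) (?e i)"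
    using l2sq_gram_schmidt[of M v i] Cauchy_Schwarz_L2[of "v j" M "?e i"] v e by auto
  finally have "inner_L2 M (gs_residual M v ?e j) (?e i) = 0" by simp
  then show ?case
    unfolding gram_schmidt.simps[of M v j] by (simp add: inner_L2_mult_left)
qed

text \<open>
  Vectors with different labels \<open>\<mu>\<close> are orthogonal, so the orthonormalization subtracts only
  vectors with the same label. Membership in \<open>S\<close> serves below as an induction principle: it
  transfers linear properties of the vectors \<open>v\<^sub>i\<close> with a given label to \<open>e\<^sub>j\<close>.
\<close>

lemma gram_schmidt_in_subspace:
  assumes v: "\<And>j. v j \<in> L2 M" and orth: "\<And>i j. \<mu> i \<noteq> \<mu> j \<Longrightarrow> inner_L2 M (v i) (v j) = 0"
  shows "fun_subspace S \<Longrightarrow> (\<And>i. \<mu> i = \<mu> j \<Longrightarrow> v i \<in> S) \<Longrightarrow> gram_schmidt M v j \<in> S"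
proof (induction j arbitrary: S rule: less_induct)
  case (less j)
  let ?e = "gram_schmidt M v"
  have "(\<lambda>x. inner_L2 M (v j) (?e i) * ?e i x) \<in> S" if i: "i < j" for i
  proof (cases "\<mu> i = \<mu> j")
    case True
    have "?e i \<in> S" using less.prems True by (intro less.IH[OF i]) auto
    then show ?thesis using less.prems(1) by (auto simp: fun_subspace_def)
  next
    case False
    have "?e i \<in> {u \<in> L2 M. inner_L2 M u (v j) = 0}"
      using False v orth by (intro less.IH[OF i] fun_subspace_L2_orth) auto
    then have "inner_L2 M (v j) (?e i) = 0"
      using inner_L2_commute[of M "v j" "?e i"] by simp
    then show ?thesis using less.prems(1) by (auto simp: fun_subspace_def)
  qed
  then have "(\<lambda>x. \<Sum>i<j. inner_L2 M (v j) (?e i) * ?e i x) \<in> S"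
    using less.prems(1) by (intro fun_subspace_sum) auto
  moreover have "v j \<in> S" using less.prems(2) by simp
  ultimately have "gs_residual M v ?e j \<in> S"
    using less.prems(1) unfolding gs_residual_def by (intro fun_subspaceD)
  then show ?case
    using less.prems(1) unfolding gram_schmidt.simps[of M v j] by (intro fun_subspaceD)
qed

text \<open>
  \<open>v\<^sub>j\<close> is a combination of earlier \<open>e\<^sub>i\<close> plus the residual, which is null or a multiple of \<open>e\<^sub>j\<close>.
\<close>

lemma gram_schmidt_orth_imp:
  assumes v: "\<And>j. v j \<in> L2 M" and f: "f \<in> L2 M" and o: "\<And>j. inner_L2 M f (gram_schmidt M v j) = 0"
  shows "inner_L2 M f (v j) = 0"
proof -
  let ?e = "gram_schmidt M v" and ?r = "gs_residual M v (gram_schmidt M v) j"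
  note e = gram_schmidt_L2[of v M, OF v]
  have r: "?r \<in> L2 M" using v by (rule gs_residual_L2)
  have "inner_L2 M f ?r = inner_L2 M f (v j) + cnj (-1) * (\<Sum>k<j. cnj (inner_L2 M (v j) (?e k)) * inner_L2 M f (?e k))"
    unfolding gs_residual_def using v e f
    by (simp only: inner_L2_add_right inner_L2_mult_right inner_L2_sum_right L2_sum L2_mult_left)
  then have 1: "inner_L2 M f (v j) = inner_L2 M f ?r" by (simp add: o)
  show ?thesis
  proof (cases "l2sq M ?r = 0")
    case True
    then show ?thesis using Cauchy_Schwarz_L2[OF f r] 1 by simp
  next
    case False
    have "of_real (inverse (sqrt (l2sq M ?r))) * inner_L2 M f ?r = 0"
      using o[of j] unfolding gram_schmidt.simps[of M v j] inner_L2_mult_right by simp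
    then show ?thesis using False 1 by simp
  qed
qed

lemma complete_orthosystem_gram_schmidt:
  assumes v: "\<And>j. v j \<in> L2 M"
    and complete: "\<And>f. f \<in> L2 M \<Longrightarrow> (\<And>j. inner_L2 M f (v j) = 0) \<Longrightarrow> AE x in M. f x = 0"
  shows "complete_orthosystem M (gram_schmidt M v)"
proof
  fix i j :: nat assume "i \<noteq> j"
  then show "inner_L2 M (gram_schmidt M v i) (gram_schmidt M v j) = 0"
    using gram_schmidt_orth_less[of v M, OF v] inner_L2_commute[of M "gram_schmidt M v i" "gram_schmidt M v j"]
    by (cases i j rule: linorder_cases) auto
next
  show "gram_schmidt M v j \<in> L2 M" for j using v by (rule gram_schmidt_L2)
  show "l2sq M (gram_schmidt M v j) = 0 \<or> l2sq M (gram_schmidt M v j) = 1" for j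
    by (rule l2sq_gram_schmidt)
  show "AE x in M. f x = 0" if "f \<in> L2 M" "\<And>j. inner_L2 M f (gram_schmidt M v j) = 0" for f
    using that(1) by (rule complete) (rule gram_schmidt_orth_imp[OF v that])
qed

section \<open>Partial derivatives\<close>

text \<open>
  A derivative everywhere, so that derivatives are computed by rules and the choice operator
  in \<^const>\<open>partial\<close> is resolved once.
\<close>

definition has_partial :: "'n \<Rightarrow> (real^'n::finite \<Rightarrow> complex) \<Rightarrow> (real^'n \<Rightarrow> complex) \<Rightarrow> bool" where
  "has_partial k f f' \<longleftrightarrow> (\<forall>x. ((\<lambda>t. f (x + t *\<^sub>R axis k 1)) has_vector_derivative f' x) (at 0))"

lemma partial_eq: "has_partial k f f' \<Longrightarrow> partial k f = f'"
  unfolding has_partial_def partial_def by (intro ext vector_derivative_at) simp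

lemma has_partial_const: "has_partial k (\<lambda>x. c) (\<lambda>x. 0)"
  by (simp add: has_partial_def)

lemma has_partial_add:
  "has_partial k f f' \<Longrightarrow> has_partial k g g' \<Longrightarrow> has_partial k (\<lambda>x. f x + g x) (\<lambda>x. f' x + g' x)"
  unfolding has_partial_def by (auto intro: has_vector_derivative_add)

lemma has_partial_cmult: "has_partial k f f' \<Longrightarrow> has_partial k (\<lambda>x. c * f x) (\<lambda>x. c * f' x)"
  unfolding has_partial_def by (auto intro: has_vector_derivative_mult_right)

lemma has_partial_mult:
  "has_partial k f f' \<Longrightarrow> has_partial k g g' \<Longrightarrow> has_partial k (\<lambda>x. f x * g x) (\<lambda>x. f x * g' x + f' x * g x)"
  unfolding has_partial_def using has_vector_derivative_mult by fastforce

lemma has_partial_cong: "has_partial k f f' \<Longrightarrow> (\<And>x. f' x = g' x) \<Longrightarrow> has_partial k f g'"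
  by (simp add: has_partial_def)

lemma has_partial_coordinate:
  fixes k :: "'n::finite"
  shows "has_partial k (\<lambda>x. of_real (x $ j)) (\<lambda>x. if j = k then 1 else 0)"
proof -
  have "((\<lambda>t. x $ j + t * (if j = k then 1 else 0)) has_real_derivative (if j = k then 1 else 0)) (at 0)" for x :: "real^'n"
    by (auto intro!: derivative_eq_intros)
  then have "((\<lambda>t. complex_of_real (x $ j + t * (if j = k then 1 else 0))) has_vector_derivative of_real (if j = k then 1 else 0)) (at 0)" for x :: "real^'n"
    by (rule has_vector_derivative_of_real)
  then show ?thesis
    unfolding has_partial_def by (simp add: axis_def if_distrib cong: if_cong)
qed

definition xsq :: "real^'n::finite \<Rightarrow> complex" where "xsq x = of_real ((norm x)\<^sup>2)"

lemma norm_shift: "(norm (x + t *\<^sub>R axis k 1))\<^sup>2 = (norm x)\<^sup>2 + 2 * t * x $ k + t\<^sup>2" for x :: "real^'n::finite"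
  unfolding power2_norm_eq_inner
  by (simp add: inner_add_left inner_add_right inner_axis inner_axis' power2_eq_square algebra_simps)

lemma xsq_sum: "xsq x = (\<Sum>k\<in>UNIV. of_real (x $ k) * of_real (x $ k))"
  by (simp add: xsq_def power2_norm_eq_inner inner_vec_def)

lemma has_partial_xsq:
  fixes k :: "'n::finite"
  shows "has_partial k xsq (\<lambda>x. 2 * of_real (x $ k))"
proof -
  have "((\<lambda>t. (norm x)\<^sup>2 + 2 * t * x $ k + t\<^sup>2) has_real_derivative 2 * x $ k) (at 0)" for x :: "real^'n"
    by (auto intro!: derivative_eq_intros)
  then have "((\<lambda>t. complex_of_real ((norm x)\<^sup>2 + 2 * t * x $ k + t\<^sup>2)) has_vector_derivative of_real (2 * x $ k)) (at 0)" for x :: "real^'n"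
    by (rule has_vector_derivative_of_real)
  then show ?thesis unfolding has_partial_def xsq_def norm_shift by simp
qed

definition gauss :: "real^'n::finite \<Rightarrow> complex" where "gauss x = of_real (exp (- (norm x)\<^sup>2 / 2))"

lemma has_partial_gauss:
  fixes k :: "'n::finite"
  shows "has_partial k gauss (\<lambda>x. - of_real (x $ k) * gauss x)"
proof -
  have "((\<lambda>t. exp (- ((norm x)\<^sup>2 + 2 * t * x $ k + t\<^sup>2) / 2)) has_real_derivative - (x $ k) * exp (- (norm x)\<^sup>2 / 2)) (at 0)" for x :: "real^'n"
    by (auto intro!: derivative_eq_intros)
  then have "((\<lambda>t. complex_of_real (exp (- ((norm x)\<^sup>2 + 2 * t * x $ k + t\<^sup>2) / 2))) has_vector_derivative of_real (- (x $ k) * exp (- (norm x)\<^sup>2 / 2))) (at 0)" for x :: "real^'n"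
    by (rule has_vector_derivative_of_real)
  then show ?thesis unfolding has_partial_def gauss_def norm_shift by simp
qed

lemma has_partial_poly: "has_partial k (\<lambda>x. poly q (xsq x)) (\<lambda>x. 2 * of_real (x $ k) * poly (pderiv q) (xsq x))"
proof (induction q)
  case 0 show ?case by (simp add: has_partial_const)
next
  case (pCons a q)
  show ?case
    using has_partial_add[OF has_partial_const[of k a] has_partial_mult[OF has_partial_xsq pCons.IH]]
    by (simp add: pderiv_pCons algebra_simps)
qed

text \<open>
  The first and the pure second partial derivatives: what the Laplacian is made of.
\<close>

definition has_partial2 :: "(real^'n::finite \<Rightarrow> complex) \<Rightarrow> ('n \<Rightarrow> real^'n \<Rightarrow> complex) \<Rightarrow> ('n \<Rightarrow> real^'n \<Rightarrow> complex) \<Rightarrow> bool" where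
  "has_partial2 f f1 f2 \<longleftrightarrow> (\<forall>k. has_partial k f (f1 k) \<and> has_partial k (f1 k) (f2 k))"

lemma laplacian_eq: "has_partial2 f f1 f2 \<Longrightarrow> laplacian f x = (\<Sum>k\<in>UNIV. f2 k x)"
  unfolding has_partial2_def laplacian_def by (metis partial_eq)

lemma has_partial2_add:
  "has_partial2 f f1 f2 \<Longrightarrow> has_partial2 g g1 g2 \<Longrightarrow>
    has_partial2 (\<lambda>x. f x + g x) (\<lambda>k x. f1 k x + g1 k x) (\<lambda>k x. f2 k x + g2 k x)"
  by (simp add: has_partial2_def has_partial_add)

lemma has_partial2_cmult:
  "has_partial2 f f1 f2 \<Longrightarrow> has_partial2 (\<lambda>x. c * f x) (\<lambda>k x. c * f1 k x) (\<lambda>k x. c * f2 k x)"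
  by (simp add: has_partial2_def has_partial_cmult)

lemma has_partial2_mult:
  assumes "has_partial2 f f1 f2" "has_partial2 g g1 g2"
  shows "has_partial2 (\<lambda>x. f x * g x) (\<lambda>k x. f x * g1 k x + f1 k x * g x)
     (\<lambda>k x. (f x * g2 k x + f1 k x * g1 k x) + (f1 k x * g1 k x + f2 k x * g x))"
  using assms unfolding has_partial2_def by (intro allI conjI has_partial_mult has_partial_add) blast+

lemma laplacian_mult:
  assumes "has_partial2 f f1 f2" "has_partial2 g g1 g2"
  shows "laplacian (\<lambda>x. f x * g x) x = f x * laplacian g x + laplacian f x * g x + 2 * (\<Sum>k\<in>UNIV. f1 k x * g1 k x)"
  unfolding laplacian_eq[OF has_partial2_mult[OF assms]] laplacian_eq[OF assms(1)] laplacian_eq[OF assms(2)]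
  by (simp add: sum.distrib sum_distrib_left sum_distrib_right algebra_simps flip: sum.distrib)

lemma laplacian_add:
  assumes "has_partial2 f f1 f2" "has_partial2 g g1 g2"
  shows "laplacian (\<lambda>x. f x + g x) x = laplacian f x + laplacian g x"
  unfolding laplacian_eq[OF has_partial2_add[OF assms]] laplacian_eq[OF assms(1)] laplacian_eq[OF assms(2)]
  by (simp add: sum.distrib)

lemma laplacian_cmult:
  assumes "has_partial2 f f1 f2"
  shows "laplacian (\<lambda>x. c * f x) x = c * laplacian f x"
  unfolding laplacian_eq[OF has_partial2_cmult[OF assms]] laplacian_eq[OF assms(1)]
  by (simp add: sum_distrib_left)

section \<open>Homogeneous polynomials\<close>

lemma finite_multiindices: "finite {\<alpha> :: 'n::finite \<Rightarrow> nat. (\<Sum>i\<in>UNIV. \<alpha> i) = m}"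
proof (rule finite_subset)
  show "{\<alpha> :: 'n \<Rightarrow> nat. (\<Sum>i\<in>UNIV. \<alpha> i) = m} \<subseteq> PiE UNIV (\<lambda>_. {..m})"
  proof
    fix \<alpha> :: "'n \<Rightarrow> nat" assume "\<alpha> \<in> {\<alpha>. (\<Sum>i\<in>UNIV. \<alpha> i) = m}"
    then have "\<alpha> i \<le> m" for i using member_le_sum[of i UNIV \<alpha>] by auto
    then show "\<alpha> \<in> PiE UNIV (\<lambda>_. {..m})" by auto
  qed
  show "finite (PiE (UNIV :: 'n set) (\<lambda>_. {..m}))" by (intro finite_PiE) auto
qed

definition monomial :: "('n \<Rightarrow> nat) \<Rightarrow> real^'n::finite \<Rightarrow> complex" where
  "monomial \<alpha> x = (\<Prod>i\<in>UNIV. of_real (x $ i) ^ \<alpha> i)"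

lemma homogeneous_polys_alt:
  "homogeneous_polys m = {p. \<exists>c. p = (\<lambda>x. \<Sum>\<alpha> | (\<Sum>i\<in>UNIV. \<alpha> i) = m. c \<alpha> * monomial \<alpha> x)}"
  by (simp add: homogeneous_polys_def monomial_def)

lemma fun_subspace_homogeneous: "fun_subspace (homogeneous_polys m)"
  unfolding fun_subspace_def
proof (intro conjI ballI allI)
  show "(\<lambda>x. 0) \<in> homogeneous_polys m"
    unfolding homogeneous_polys_alt by (auto intro!: exI[of _ "\<lambda>_. 0"])
  fix f g :: "real^'n \<Rightarrow> complex" and c assume "f \<in> homogeneous_polys m"
  then obtain a where a: "f = (\<lambda>x. \<Sum>\<alpha> | (\<Sum>i\<in>UNIV. \<alpha> i) = m. a \<alpha> * monomial \<alpha> x)"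
    unfolding homogeneous_polys_alt by blast
  show "(\<lambda>x. c * f x) \<in> homogeneous_polys m"
    unfolding homogeneous_polys_alt a by (auto intro!: exI[of _ "\<lambda>\<alpha>. c * a \<alpha>"] simp: sum_distrib_left mult.assoc)
  assume "g \<in> homogeneous_polys m"
  then obtain b where b: "g = (\<lambda>x. \<Sum>\<alpha> | (\<Sum>i\<in>UNIV. \<alpha> i) = m. b \<alpha> * monomial \<alpha> x)"
    unfolding homogeneous_polys_alt by blast
  show "(\<lambda>x. f x + g x) \<in> homogeneous_polys m"
    unfolding homogeneous_polys_alt a b
    by (auto intro!: exI[of _ "\<lambda>\<alpha>. a \<alpha> + b \<alpha>"] simp: sum.distrib distrib_right)
qed

lemma monomial_homogeneous: "monomial \<alpha> \<in> homogeneous_polys (\<Sum>i\<in>UNIV. \<alpha> i)"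
  unfolding homogeneous_polys_alt
proof (intro CollectI exI ext)
  fix x
  have "(\<Sum>\<beta> | (\<Sum>i\<in>UNIV. \<beta> i) = (\<Sum>i\<in>UNIV. \<alpha> i). (if \<beta> = \<alpha> then 1 else 0) * monomial \<beta> x)
      = (\<Sum>\<beta> | (\<Sum>i\<in>UNIV. \<beta> i) = (\<Sum>i\<in>UNIV. \<alpha> i). if \<beta> = \<alpha> then monomial \<alpha> x else 0)"
    by (intro sum.cong) auto
  then show "monomial \<alpha> x = (\<Sum>\<beta> | (\<Sum>i\<in>UNIV. \<beta> i) = (\<Sum>i\<in>UNIV. \<alpha> i). (if \<beta> = \<alpha> then 1 else 0) * monomial \<beta> x)"
    by (simp add: sum.delta finite_multiindices)
qed

lemma homogeneous_poly_in_subspace: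
  assumes "p \<in> homogeneous_polys m" "fun_subspace S" "\<And>\<alpha>. (\<Sum>i\<in>UNIV. \<alpha> i) = m \<Longrightarrow> monomial \<alpha> \<in> S"
  shows "p \<in> S"
proof -
  from assms(1) obtain a where a: "p = (\<lambda>x. \<Sum>\<alpha> | (\<Sum>i\<in>UNIV. \<alpha> i) = m. a \<alpha> * monomial \<alpha> x)"
    unfolding homogeneous_polys_alt by blast
  show ?thesis unfolding a
    by (intro fun_subspace_sum assms(2) fun_subspaceD(2)) (use assms(3) in auto)
qed

lemma monomial_upd: "monomial (\<alpha>(k := Suc (\<alpha> k))) x = of_real (x $ k) * monomial \<alpha> x"
proof -
  have "monomial (\<alpha>(k := Suc (\<alpha> k))) x = of_real (x $ k) ^ Suc (\<alpha> k) * (\<Prod>i\<in>UNIV - {k}. of_real (x $ i) ^ \<alpha> i)"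
    unfolding monomial_def by (subst prod.remove[of _ k]) auto
  moreover have "monomial \<alpha> x = of_real (x $ k) ^ \<alpha> k * (\<Prod>i\<in>UNIV - {k}. of_real (x $ i) ^ \<alpha> i)"
    unfolding monomial_def by (subst prod.remove[of _ k]) auto
  ultimately show ?thesis by simp
qed

lemma sum_multiindex_upd: "(\<Sum>i\<in>UNIV. (\<alpha>(k := Suc (\<alpha> k))) i) = Suc (\<Sum>i\<in>UNIV. \<alpha> i)" for \<alpha> :: "'n::finite \<Rightarrow> nat"
  by (subst (1 2) sum.remove[of _ k]) auto

lemma homogeneous_coordinate_mult:
  fixes p :: "real^'n::finite \<Rightarrow> complex"
  assumes "p \<in> homogeneous_polys m"
  shows "(\<lambda>x. of_real (x $ k) * p x) \<in> homogeneous_polys (Suc m)"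
proof -
  have "p \<in> {p. (\<lambda>x. of_real (x $ k) * p x) \<in> homogeneous_polys (Suc m)}"
  proof (rule homogeneous_poly_in_subspace[OF assms])
    have eq: "of_real (x $ k) * (f x + g x) = of_real (x $ k) * f x + of_real (x $ k) * g x"
      "of_real (x $ k) * (c * f x) = c * (of_real (x $ k) * f x)" for f g :: "real^'n \<Rightarrow> complex" and x c
      by (auto simp: algebra_simps)
    show "fun_subspace {p :: real^'n \<Rightarrow> complex. (\<lambda>x. of_real (x $ k) * p x) \<in> homogeneous_polys (Suc m)}"
      using fun_subspace_homogeneous[of "Suc m", where 'a = 'n] unfolding fun_subspace_def mem_Collect_eq eq by auto
  next
    fix \<alpha> :: "'n \<Rightarrow> nat" assume "(\<Sum>i\<in>UNIV. \<alpha> i) = m"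
    then show "monomial \<alpha> \<in> {p. (\<lambda>x. of_real (x $ k) * p x) \<in> homogeneous_polys (Suc m)}"
      using monomial_homogeneous[of "\<alpha>(k := Suc (\<alpha> k))"]
      unfolding sum_multiindex_upd monomial_upd[abs_def] by simp
  qed
  then show ?thesis by simp
qed

text \<open>
  Homogeneous polynomials arise from constants by multiplication with coordinates and linear
  combination within a degree; multi-indices are not visible beyond this point.
\<close>

lemma homogeneous_induct [consumes 1, case_names const coordinate add scale]:
  fixes p :: "real^'n::finite \<Rightarrow> complex"
  assumes p: "p \<in> homogeneous_polys m"
    and const: "\<And>c. P 0 (\<lambda>x. c)"
    and coord: "\<And>m k q. q \<in> homogeneous_polys m \<Longrightarrow> P m q \<Longrightarrow> P (Suc m) (\<lambda>x. of_real (x $ k) * q x)"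
    and add: "\<And>m p q. p \<in> homogeneous_polys m \<Longrightarrow> q \<in> homogeneous_polys m \<Longrightarrow> P m p \<Longrightarrow> P m q \<Longrightarrow> P m (\<lambda>x. p x + q x)"
    and scale: "\<And>m c p. p \<in> homogeneous_polys m \<Longrightarrow> P m p \<Longrightarrow> P m (\<lambda>x. c * p x)"
  shows "P m p"
proof -
  have mono: "P m (monomial \<alpha>)" if "(\<Sum>i\<in>UNIV. \<alpha> i) = m" for m and \<alpha> :: "'n \<Rightarrow> nat"
    using that
  proof (induction m arbitrary: \<alpha>)
    case 0
    then have "\<alpha> = (\<lambda>_. 0)" by auto
    then have "monomial \<alpha> = (\<lambda>x. 1)" by (simp add: monomial_def fun_eq_iff)
    then show ?case using const by simp
  next
    case (Suc m)
    then obtain k where k: "\<alpha> k \<noteq> 0" by (metis sum.neutral nat.distinct(1))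
    define \<beta> where "\<beta> = \<alpha>(k := \<alpha> k - 1)"
    have \<alpha>: "\<alpha> = \<beta>(k := Suc (\<beta> k))" using k by (auto simp: \<beta>_def)
    have \<beta>: "(\<Sum>i\<in>UNIV. \<beta> i) = m" using Suc.prems sum_multiindex_upd[of \<beta> k] \<alpha> by simp
    have "P (Suc m) (\<lambda>x. of_real (x $ k) * monomial \<beta> x)"
      using coord Suc.IH[OF \<beta>] monomial_homogeneous[of \<beta>] \<beta> by blast
    moreover have "monomial \<alpha> = (\<lambda>x. of_real (x $ k) * monomial \<beta> x)"
      using monomial_upd[of \<beta> k] \<alpha> by auto
    ultimately show ?case by simp
  qed
  have "p \<in> {p \<in> homogeneous_polys m. P m p}"
  proof (rule homogeneous_poly_in_subspace[OF p])
    \<comment> \<open>The zero polynomial is reached as a multiple of some monomial of degree \<open>m\<close>.\<close>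
    obtain \<alpha> :: "'n \<Rightarrow> nat" where "(\<Sum>i\<in>UNIV. \<alpha> i) = m"
    proof
      show "(\<Sum>i\<in>UNIV. (\<lambda>i :: 'n. if i = undefined then m else 0) i) = m" by (simp add: sum.delta)
    qed
    then have m0: "monomial \<alpha> \<in> homogeneous_polys m" "P m (monomial \<alpha>)"
      using mono monomial_homogeneous[of \<alpha>] by auto
    then have "P m (\<lambda>x. 0 * monomial \<alpha> x)" by (rule scale)
    then have "P m (\<lambda>x. 0)" by simp
    then show "fun_subspace {p \<in> homogeneous_polys m. P m p}"
      using fun_subspace_homogeneous[of m, where 'a = 'n] add scale unfolding fun_subspace_def by auto
  qed (use mono monomial_homogeneous in auto)
  then show ?thesis by simp
qed

lemma homogeneous_const: "(\<lambda>x. c) \<in> homogeneous_polys 0"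
  using fun_subspaceD(2)[OF fun_subspace_homogeneous, of "\<lambda>x. 1" 0 c] monomial_homogeneous[of "\<lambda>_. 0"]
  by (simp add: monomial_def[abs_def])

lemma homogeneous_partial:
  assumes "p \<in> homogeneous_polys m"
  shows "has_partial k p (partial k p) \<and> partial k p \<in> homogeneous_polys (m - 1) \<and> (m = 0 \<longrightarrow> partial k p = (\<lambda>x. 0))"
  using assms
proof (induction rule: homogeneous_induct)
  case (const c)
  then show ?case using has_partial_const[of k c] partial_eq[OF has_partial_const[of k c]] homogeneous_const[of 0] by simp
next
  case (coordinate m j q)
  have h: "has_partial k (\<lambda>x. of_real (x $ j) * q x) (\<lambda>x. of_real (x $ j) * partial k q x + (if j = k then 1 else 0) * q x)"
    using coordinate by (intro has_partial_mult has_partial_coordinate) auto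
  have "(\<lambda>x. of_real (x $ j) * partial k q x) \<in> homogeneous_polys m"
  proof (cases m)
    case 0
    then have "(\<lambda>x. of_real (x $ j) * partial k q x) = (\<lambda>x. 0)" using coordinate by simp
    then show ?thesis using fun_subspace_homogeneous[of m] unfolding fun_subspace_def by auto
  next
    case (Suc n)
    then show ?thesis using coordinate homogeneous_coordinate_mult[of "partial k q" n j] by simp
  qed
  then have "(\<lambda>x. of_real (x $ j) * partial k q x + (if j = k then 1 else 0) * q x) \<in> homogeneous_polys m"
    using coordinate by (intro fun_subspaceD[OF fun_subspace_homogeneous]) auto
  with h show ?case by (simp add: partial_eq[OF h])
next
  case (add m p q)
  have h: "has_partial k (\<lambda>x. p x + q x) (\<lambda>x. partial k p x + partial k q x)"
    using add by (intro has_partial_add) auto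
  show ?case using add h by (auto simp: partial_eq[OF h] intro!: fun_subspaceD[OF fun_subspace_homogeneous])
next
  case (scale m c p)
  have h: "has_partial k (\<lambda>x. c * p x) (\<lambda>x. c * partial k p x)"
    using scale by (intro has_partial_cmult) auto
  show ?case using scale h by (auto simp: partial_eq[OF h] intro!: fun_subspaceD[OF fun_subspace_homogeneous])
qed

lemma homogeneous_partial2:
  "p \<in> homogeneous_polys m \<Longrightarrow> has_partial2 p (\<lambda>k. partial k p) (\<lambda>k. partial k (partial k p))"
  using homogeneous_partial unfolding has_partial2_def by blast

lemma laplacian_homogeneous:
  assumes "p \<in> homogeneous_polys m"
  shows "laplacian p \<in> homogeneous_polys (m - 2)" and "m < 2 \<Longrightarrow> laplacian p = (\<lambda>x. 0)"
proof -
  have p1: "partial k p \<in> homogeneous_polys (m - 1)" for k using homogeneous_partial[OF assms] by blast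
  have "partial k (partial k p) \<in> homogeneous_polys (m - 2)" for k
    using homogeneous_partial[OF p1, of k k] by (simp add: numeral_2_eq_2)
  then have "(\<lambda>x. \<Sum>k\<in>UNIV. partial k (partial k p) x) \<in> homogeneous_polys (m - 2)"
    by (intro fun_subspace_sum fun_subspace_homogeneous)
  then show "laplacian p \<in> homogeneous_polys (m - 2)" by (simp add: laplacian_def[abs_def])
  assume "m < 2"
  then have "partial k (partial k p) = (\<lambda>x. 0)" for k using homogeneous_partial[OF p1, of k k] by simp
  then show "laplacian p = (\<lambda>x. 0)" by (simp add: laplacian_def fun_eq_iff)
qed

lemma euler_homogeneous:
  assumes "p \<in> homogeneous_polys m"
  shows "euler p x = of_nat m * p x"
  using assms
proof (induction rule: homogeneous_induct)
  case (const c)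
  then show ?case by (simp add: euler_def partial_eq[OF has_partial_const])
next
  case (coordinate m j q)
  have h: "has_partial k (\<lambda>x. of_real (x $ j) * q x) (\<lambda>x. of_real (x $ j) * partial k q x + (if j = k then 1 else 0) * q x)" for k
    using homogeneous_partial[OF coordinate(1)] by (intro has_partial_mult has_partial_coordinate) auto
  have "euler (\<lambda>x. of_real (x $ j) * q x) x
      = (\<Sum>k\<in>UNIV. of_real (x $ j) * (of_real (x $ k) * partial k q x) + (if j = k then of_real (x $ k) * q x else 0))"
    unfolding euler_def partial_eq[OF h] by (intro sum.cong) (auto simp: algebra_simps)
  also have "\<dots> = of_real (x $ j) * euler q x + of_real (x $ j) * q x"
    by (simp add: sum.distrib euler_def sum_distrib_left)
  finally show ?case using coordinate.IH by (simp add: algebra_simps)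
next
  case (add m p q)
  have h: "has_partial k (\<lambda>x. p x + q x) (\<lambda>x. partial k p x + partial k q x)" for k
    using add homogeneous_partial by (intro has_partial_add) blast+
  show ?case using add.IH unfolding euler_def partial_eq[OF h] by (simp add: algebra_simps sum.distrib)
next
  case (scale m c p)
  have h: "has_partial k (\<lambda>x. c * p x) (\<lambda>x. c * partial k p x)" for k
    using scale homogeneous_partial by (intro has_partial_cmult) blast+
  have "euler (\<lambda>x. c * p x) x = c * euler p x"
    unfolding euler_def partial_eq[OF h] sum_distrib_left by (simp add: algebra_simps)
  then show ?case using scale.IH by simp
qed

lemma homogeneous_scaleR:
  assumes "p \<in> homogeneous_polys m"
  shows "p (r *\<^sub>R x) = of_real (r ^ m) * p x"
  using assms
  by (induction rule: homogeneous_induct) (auto simp: algebra_simps)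

lemma homogeneous_continuous:
  assumes "p \<in> homogeneous_polys m"
  shows "continuous_on UNIV p"
  using assms
  by (induction rule: homogeneous_induct) (auto intro!: continuous_intros)

lemma homogeneous_cnj:
  assumes "p \<in> homogeneous_polys m"
  shows "(\<lambda>x. cnj (p x)) \<in> homogeneous_polys m"
  using assms
  by (induction rule: homogeneous_induct)
    (auto intro!: homogeneous_const homogeneous_coordinate_mult fun_subspaceD[OF fun_subspace_homogeneous])

lemma homogeneous_mult:
  assumes "p \<in> homogeneous_polys m" and q: "q \<in> homogeneous_polys n"
  shows "(\<lambda>x. p x * q x) \<in> homogeneous_polys (m + n)"
  using assms(1)
proof (induction rule: homogeneous_induct)
  case (coordinate m k p)
  then show ?case using homogeneous_coordinate_mult[of "\<lambda>x. p x * q x" "m + n" k] by (simp add: mult.assoc)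
qed (auto simp: distrib_right mult.assoc intro!: q fun_subspaceD[OF fun_subspace_homogeneous])

lemma homogeneous_xsq: "(xsq :: real^'n::finite \<Rightarrow> complex) \<in> homogeneous_polys 2"
proof -
  have "(\<lambda>x. of_real (x $ k) * of_real (x $ k)) \<in> homogeneous_polys 2" for k :: 'n
    using homogeneous_coordinate_mult[OF homogeneous_coordinate_mult[OF homogeneous_const[of 1], of k], of k]
    by (simp add: numeral_2_eq_2)
  then have "(\<lambda>x :: real^'n. \<Sum>k\<in>UNIV. of_real (x $ k) * of_real (x $ k)) \<in> homogeneous_polys 2"
    by (intro fun_subspace_sum fun_subspace_homogeneous)
  then show ?thesis by (simp add: xsq_sum[abs_def])
qed

lemma homogeneous_xsq_power_mult:
  assumes "p \<in> homogeneous_polys m"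
  shows "(\<lambda>x. xsq x ^ j * p x) \<in> homogeneous_polys (m + 2 * j)"
proof (induction j)
  case (Suc j)
  show ?case using homogeneous_mult[OF homogeneous_xsq Suc.IH] by (simp add: mult.assoc)
qed (use assms in simp)

section \<open>Projection onto harmonic polynomials\<close>

text \<open>
  The mixed term \<open>2 \<nabla>|x|\<^sup>2 \<cdot> \<nabla>g\<close> is \<open>4 E g = 4 d g\<close>.
\<close>

lemma laplacian_xsq_mult:
  fixes g :: "real^'n::finite \<Rightarrow> complex"
  assumes g: "g \<in> homogeneous_polys d"
  shows "laplacian (\<lambda>x. xsq x * g x) x = of_nat (2 * CARD('n) + 4 * d) * g x + xsq x * laplacian g x"
proof -
  have "has_partial k (\<lambda>x. 2 * of_real (x $ k)) (\<lambda>x. 2)" for k :: 'n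
    using has_partial_cmult[OF has_partial_coordinate, of k 2 k] by simp
  then have z: "has_partial2 (xsq :: real^'n \<Rightarrow> complex) (\<lambda>k x. 2 * of_real (x $ k)) (\<lambda>k x. 2)"
    by (simp add: has_partial2_def has_partial_xsq)
  have "(\<Sum>k\<in>UNIV. 2 * of_real (x $ k) * partial k g x) = 2 * euler g x"
    by (simp add: euler_def sum_distrib_left mult.assoc)
  then show ?thesis
    unfolding laplacian_mult[OF z homogeneous_partial2[OF g]] laplacian_eq[OF z]
    by (simp add: euler_homogeneous[OF g] algebra_simps)
qed

lemma laplacian_xsq_power_mult:
  fixes g :: "real^'n::finite \<Rightarrow> complex"
  assumes g: "g \<in> homogeneous_polys d"
  shows "laplacian (\<lambda>x. xsq x ^ j * g x) x =
    of_real (2 * real j * (real CARD('n) + 2 * real d + 2 * real j - 2)) * xsq x ^ (j - 1) * g x + xsq x ^ j * laplacian g x"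
proof (induction j)
  case (Suc j)
  let ?N = "real CARD('n)"
  have "xsq x * (of_real (2 * real j * (?N + 2 * real d + 2 * real j - 2)) * xsq x ^ (j - 1) * g x)
      = of_real (2 * real j * (?N + 2 * real d + 2 * real j - 2)) * xsq x ^ j * g x"
    by (cases j) auto
  moreover have "laplacian (\<lambda>x. xsq x ^ Suc j * g x) x =
      of_nat (2 * CARD('n) + 4 * (d + 2 * j)) * (xsq x ^ j * g x) + xsq x * laplacian (\<lambda>x. xsq x ^ j * g x) x"
    using laplacian_xsq_mult[OF homogeneous_xsq_power_mult[OF g], of j x] by (simp add: mult.assoc)
  ultimately have "laplacian (\<lambda>x. xsq x ^ Suc j * g x) x =
      (of_nat (2 * CARD('n) + 4 * (d + 2 * j)) + of_real (2 * real j * (?N + 2 * real d + 2 * real j - 2))) * (xsq x ^ j * g x)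
      + xsq x ^ Suc j * laplacian g x"
    unfolding Suc.IH by (simp only: distrib_left distrib_right) (simp add: mult.assoc)
  also have "of_nat (2 * CARD('n) + 4 * (d + 2 * j)) + complex_of_real (2 * real j * (?N + 2 * real d + 2 * real j - 2))
      = of_real (2 * real (Suc j) * (?N + 2 * real d + 2 * real (Suc j) - 2))"
    by (simp add: algebra_simps)
  finally show ?case by (simp add: mult.assoc)
qed simp

text \<open>
  Solves \<open>2j (N + 2m - 2j - 2) c\<^sub>j = - c\<^bsub>j-1\<^esub>\<close>, \<open>c\<^sub>0 = 1\<close>. The factor on the left is positive for
  \<open>1 \<le> j \<le> m/2\<close> and \<open>N \<ge> 1\<close>.
\<close>

fun harmonic_coeff :: "nat \<Rightarrow> nat \<Rightarrow> nat \<Rightarrow> real" where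
  "harmonic_coeff N m 0 = 1"
| "harmonic_coeff N m (Suc j) =
     - harmonic_coeff N m j / (2 * real (Suc j) * (real N + 2 * real m - 2 * real (Suc j) - 2))"

definition harmonic_projection :: "nat \<Rightarrow> (real^'n::finite \<Rightarrow> complex) \<Rightarrow> real^'n \<Rightarrow> complex" where
  "harmonic_projection m q =
     (\<lambda>x. \<Sum>j\<le>m div 2. of_real (harmonic_coeff CARD('n) m j) * (xsq x ^ j * (laplacian ^^ j) q x))"

lemma laplacian_funpow_homogeneous:
  assumes "q \<in> homogeneous_polys m"
  shows "(laplacian ^^ j) q \<in> homogeneous_polys (m - 2 * j)" and "2 * j > m \<Longrightarrow> (laplacian ^^ j) q = (\<lambda>x. 0)"
proof -
  show h: "(laplacian ^^ j) q \<in> homogeneous_polys (m - 2 * j)" for j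
  proof (induction j)
    case (Suc j)
    from laplacian_homogeneous(1)[OF Suc.IH] show ?case by (simp add: diff_diff_left)
  qed (use assms in simp)
  assume j: "2 * j > m"
  then obtain i where i: "j = Suc i" by (cases j) auto
  have "m - 2 * i < 2" using j i by simp
  from laplacian_homogeneous(2)[OF h this] show "(laplacian ^^ j) q = (\<lambda>x. 0)" by (simp add: i)
qed

lemma laplacian_sum_homogeneous:
  assumes "\<And>i. i \<in> I \<Longrightarrow> p i \<in> homogeneous_polys m"
  shows "laplacian (\<lambda>x. \<Sum>i\<in>I. c i * p i x) x = (\<Sum>i\<in>I. c i * laplacian (p i) x)"
  using assms
proof (induction I rule: infinite_finite_induct)
  case (insert i I)
  have *: "(\<lambda>x. \<Sum>i\<in>I. c i * p i x) \<in> homogeneous_polys m" "p i \<in> homogeneous_polys m"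
    using insert.prems by (auto intro!: fun_subspace_sum fun_subspaceD fun_subspace_homogeneous)
  have "laplacian (\<lambda>x. c i * p i x + (\<Sum>i\<in>I. c i * p i x)) x = c i * laplacian (p i) x + laplacian (\<lambda>x. \<Sum>i\<in>I. c i * p i x) x"
    using laplacian_add[OF has_partial2_cmult[OF homogeneous_partial2[OF *(2)]] homogeneous_partial2[OF *(1)]]
      laplacian_cmult[OF homogeneous_partial2[OF *(2)]] by simp
  then show ?case using insert by simp
qed (auto simp: laplacian_def partial_eq[OF has_partial_const])

text \<open>
  \<open>\<Delta>(|x|\<^bsup>2j\<^esup> \<Delta>\<^sup>j q)\<close> is a combination of \<open>|x|\<^bsup>2j-2\<^esup> \<Delta>\<^sup>j q\<close> and \<open>|x|\<^bsup>2j\<^esup> \<Delta>\<^bsup>j+1\<^esup> q\<close>. The recursion for the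
  coefficients cancels these terms between neighbouring summands, and the last one is zero because
  \<open>\<Delta>\<^bsup>j+1\<^esup> q = 0\<close> for \<open>2j + 2 > m\<close>.
\<close>

lemma harmonic_projection_harmonic:
  fixes q :: "real^'n::finite \<Rightarrow> complex"
  assumes q: "q \<in> homogeneous_polys m"
  shows "harmonic_projection m q \<in> harmonic_polys m"
proof -
  let ?N = "real CARD('n)" and ?c = "harmonic_coeff CARD('n) m" and ?J = "m div 2"
  let ?L = "\<lambda>j. (laplacian ^^ j) q"
  have hom: "(\<lambda>x. xsq x ^ j * ?L j x) \<in> homogeneous_polys m" if "j \<le> ?J" for j
    using homogeneous_xsq_power_mult[OF laplacian_funpow_homogeneous(1)[OF q], of j j] that by simp
  have "laplacian (harmonic_projection m q) x = 0" for x
  proof -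
    have "laplacian (harmonic_projection m q) x = (\<Sum>j\<le>?J. of_real (?c j) * laplacian (\<lambda>x. xsq x ^ j * ?L j x) x)"
      unfolding harmonic_projection_def using hom by (intro laplacian_sum_homogeneous) auto
    also have "\<dots> = (\<Sum>j\<le>?J. of_real (?c j * (2 * real j * (?N + 2 * real m - 2 * real j - 2))) * (xsq x ^ (j - 1) * ?L j x)
         + of_real (?c j) * (xsq x ^ j * ?L (Suc j) x))"
    proof (intro sum.cong refl)
      fix j assume "j \<in> {..?J}"
      then have "?N + 2 * real (m - 2 * j) + 2 * real j - 2 = ?N + 2 * real m - 2 * real j - 2"
        by (simp add: of_nat_diff)
      then show "of_real (?c j) * laplacian (\<lambda>x. xsq x ^ j * ?L j x) x =
          of_real (?c j * (2 * real j * (?N + 2 * real m - 2 * real j - 2))) * (xsq x ^ (j - 1) * ?L j x)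
         + of_real (?c j) * (xsq x ^ j * ?L (Suc j) x)"
        unfolding laplacian_xsq_power_mult[OF laplacian_funpow_homogeneous(1)[OF q]] by (simp add: algebra_simps)
    qed
    also have "\<dots> = (\<Sum>j<?J. of_real (?c (Suc j) * (2 * real (Suc j) * (?N + 2 * real m - 2 * real (Suc j) - 2))) * (xsq x ^ j * ?L (Suc j) x))
        + (\<Sum>j\<le>?J. of_real (?c j) * (xsq x ^ j * ?L (Suc j) x))"
      unfolding sum.distrib by (subst sum.atMost_shift) simp
    also have "(\<Sum>j\<le>?J. of_real (?c j) * (xsq x ^ j * ?L (Suc j) x)) = (\<Sum>j<?J. of_real (?c j) * (xsq x ^ j * ?L (Suc j) x))"
      using laplacian_funpow_homogeneous(2)[OF q, of "Suc ?J"]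
      by (simp flip: lessThan_Suc_atMost del: funpow.simps)
    also have "(\<Sum>j<?J. of_real (?c (Suc j) * (2 * real (Suc j) * (?N + 2 * real m - 2 * real (Suc j) - 2))) * (xsq x ^ j * ?L (Suc j) x))
        = (\<Sum>j<?J. - (of_real (?c j) * (xsq x ^ j * ?L (Suc j) x)))"
    proof (intro sum.cong refl)
      fix j assume "j \<in> {..<?J}"
      then have "2 * Suc j \<le> m" "CARD('n) > 0" by (auto simp: less_eq_div_iff_mult_less_eq Suc_le_eq)
      then have "2 * real (Suc j) \<le> real m" "?N \<ge> 1" by linarith+
      moreover from this have "real m \<ge> 2" by (simp add: algebra_simps)
      ultimately have "2 * real (Suc j) * (?N + 2 * real m - 2 * real (Suc j) - 2) > 0"
        by (intro mult_pos_pos) linarith+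
      then have "?c (Suc j) * (2 * real (Suc j) * (?N + 2 * real m - 2 * real (Suc j) - 2)) = - ?c j"
        using nonzero_eq_divide_eq harmonic_coeff.simps(2) by (metis less_irrefl)
      then show "of_real (?c (Suc j) * (2 * real (Suc j) * (?N + 2 * real m - 2 * real (Suc j) - 2))) * (xsq x ^ j * ?L (Suc j) x)
          = - (of_real (?c j) * (xsq x ^ j * ?L (Suc j) x))" by (simp only: of_real_minus) simp
    qed
    finally show ?thesis by (simp add: sum_negf)
  qed
  moreover have "harmonic_projection m q \<in> homogeneous_polys m"
    unfolding harmonic_projection_def
    by (intro fun_subspace_sum fun_subspace_homogeneous fun_subspaceD hom) auto
  ultimately show ?thesis by (simp add: harmonic_polys_def)
qed

text \<open>
  The summand of index \<open>0\<close> in the projection is \<open>q\<close>, and all others have a factor \<open>|x|\<^sup>2\<close>. Iterated,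
  this writes every polynomial as a sum of powers of \<open>|x|\<^sup>2\<close> times harmonic polynomials.
\<close>

lemma harmonic_projection_decomposition:
  fixes q :: "real^'n::finite \<Rightarrow> complex"
  assumes q: "q \<in> homogeneous_polys m"
  shows "\<exists>r. (\<forall>x. q x = harmonic_projection m q x + xsq x * r x) \<and>
    (m \<ge> 2 \<longrightarrow> r \<in> homogeneous_polys (m - 2)) \<and> (m < 2 \<longrightarrow> r = (\<lambda>x. 0))"
proof -
  let ?c = "harmonic_coeff CARD('n) m"
  define r :: "real^'n \<Rightarrow> complex" where
    "r = (\<lambda>x. \<Sum>j<m div 2. (- of_real (?c (Suc j))) * (xsq x ^ j * (laplacian ^^ Suc j) q x))"
  have "q x = harmonic_projection m q x + xsq x * r x" for x
  proof -
    have "harmonic_projection m q x = q x + (\<Sum>j<m div 2. of_real (?c (Suc j)) * (xsq x ^ Suc j * (laplacian ^^ Suc j) q x))"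
      unfolding harmonic_projection_def by (subst sum.atMost_shift) simp
    moreover have "xsq x * r x = - (\<Sum>j<m div 2. of_real (?c (Suc j)) * (xsq x ^ Suc j * (laplacian ^^ Suc j) q x))"
      unfolding r_def sum_distrib_left sum_negf[symmetric] by (intro sum.cong) auto
    ultimately show ?thesis by simp
  qed
  moreover have "r \<in> homogeneous_polys (m - 2)" if "m \<ge> 2"
  proof -
    have "(\<lambda>x. xsq x ^ j * (laplacian ^^ Suc j) q x) \<in> homogeneous_polys (m - 2)" if "j < m div 2" for j
    proof -
      have "m - 2 * Suc j + 2 * j = m - 2" using that by presburger
      then show ?thesis
        using homogeneous_xsq_power_mult[OF laplacian_funpow_homogeneous(1)[OF q, of "Suc j"], of j] by simp
    qed
    then show ?thesis unfolding r_def
      by (intro fun_subspace_sum fun_subspace_homogeneous fun_subspaceD(2)) auto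
  qed
  moreover have "r = (\<lambda>x. 0)" if "m < 2" using that by (simp add: r_def)
  ultimately show ?thesis by (intro exI[of _ r] conjI allI impI)
qed

section \<open>Polar coordinates for homogeneous functions\<close>

lemma nn_integral_lborel_scale:
  fixes g :: "'a::euclidean_space \<Rightarrow> ennreal"
  assumes [measurable]: "g \<in> borel_measurable borel" and r: "r > 0"
  shows "(\<integral>\<^sup>+x. g x \<partial>lborel) = ennreal (r ^ DIM('a)) * (\<integral>\<^sup>+x. g (r *\<^sub>R x) \<partial>lborel)"
proof -
  have "(\<integral>\<^sup>+x. g x \<partial>lborel) = (\<integral>\<^sup>+x. g x \<partial>density (distr lborel borel (\<lambda>x::'a. 0 + r *\<^sub>R x)) (\<lambda>_. ennreal (\<bar>r\<bar> ^ DIM('a))))"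
    using r lborel_affine[of r "0::'a"] by simp
  also have "\<dots> = ennreal (r ^ DIM('a)) * (\<integral>\<^sup>+x. g (r *\<^sub>R x) \<partial>lborel)"
    using r by (simp add: nn_integral_density nn_integral_distr nn_integral_cmult)
  finally show ?thesis .
qed

text \<open>
  In the variable \<open>t = |x|\<^sup>2\<close>, a homogeneous function of degree \<open>d\<close> times Lebesgue measure on \<open>\<real>\<^sup>N\<close>
  becomes a multiple of this density with \<open>k = (d + N)/2\<close>.
\<close>

definition radial_density :: "real \<Rightarrow> real \<Rightarrow> real" where
  "radial_density k t = indicator {0<..} t * t powr (k - 1)"

lemma radial_density_measurable [measurable]: "radial_density k \<in> borel_measurable borel"
  unfolding radial_density_def by measurable

lemma radial_density_nonneg [simp]: "0 \<le> radial_density k t"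
  by (simp add: radial_density_def)

lemma nn_integral_radial_density_atMost:
  assumes k: "k > 0" and t: "t > 0"
  shows "(\<integral>\<^sup>+s. ennreal (radial_density k s) * indicator {..t} s \<partial>lborel) = ennreal (t powr k / k)"
proof -
  have "((\<lambda>x. x powr (k - 1)) has_integral (t powr k / k)) {0..t}"
    using has_integral_powr_from_0[of "k - 1" t] k t by simp
  then have "(\<integral>\<^sup>+s. ennreal (s powr (k - 1)) * indicator {0..t} s \<partial>lborel) = ennreal (t powr k / k)"
    by (intro nn_integral_has_integral_lebesgue') auto
  moreover have "(\<integral>\<^sup>+s. ennreal (s powr (k - 1)) * indicator {0..t} s \<partial>lborel)
      = (\<integral>\<^sup>+s. ennreal (radial_density k s) * indicator {..t} s \<partial>lborel)"
    by (intro nn_integral_cong) (auto simp: radial_density_def indicator_def)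
  ultimately show ?thesis by simp
qed

text \<open>
  Both measures are compared on half-lines, where scaling determines
  \<open>\<integral>\<^bsub>|x|\<^sup>2 \<le> t\<^esub> h = t\<^bsup>(d+N)/2\<^esup> \<integral>\<^bsub>|x| \<le> 1\<^esub> h\<close>.
\<close>

lemma distr_norm_sq_homogeneous:
  fixes h :: "real^'n::finite \<Rightarrow> real"
  assumes cont: "continuous_on UNIV h" and nonneg: "\<And>x. 0 \<le> h x"
    and hom: "\<And>r x. r > 0 \<Longrightarrow> h (r *\<^sub>R x) = r ^ d * h x"
  defines "k \<equiv> (real d + real CARD('n)) / 2"
  shows "\<exists>C\<ge>0. distr (density lborel (\<lambda>x. ennreal (h x))) borel (\<lambda>x. (norm x)\<^sup>2)
    = density lborel (\<lambda>t. ennreal (C * radial_density k t))"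
proof -
  have [measurable]: "h \<in> borel_measurable borel" using cont by (rule borel_measurable_continuous_onI)
  have k: "k > 0" unfolding k_def by (simp add: add_nonneg_pos)
  define I where "I = (\<integral>\<^sup>+x. ennreal (h x) * indicator (cball 0 1) x \<partial>lborel)"
  have "I < \<infinity>"
  proof -
    have "compact (h ` cball 0 1)"
      by (intro compact_continuous_image continuous_on_subset[OF cont]) auto
    then obtain B where B: "\<And>x. x \<in> cball 0 1 \<Longrightarrow> norm (h x) \<le> B"
      using compact_imp_bounded[of "h ` cball 0 1"] unfolding bounded_iff by (metis imageI)
    have hB: "h x \<le> B" if "norm x \<le> 1" for x using B[of x] that by simp
    have "I \<le> (\<integral>\<^sup>+x. ennreal B * indicator (cball 0 1) x \<partial>(lborel :: (real^'n) measure))"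
      unfolding I_def using hB by (intro nn_integral_mono) (auto simp: indicator_def intro!: ennreal_leI split: if_splits)
    also have "\<dots> = ennreal B * emeasure lborel (cball 0 1 :: (real^'n) set)"
      by (subst nn_integral_cmult_indicator) auto
    also have "\<dots> < \<infinity>"
      using emeasure_lborel_cball_finite[of "0 :: real^'n" 1] by (simp add: ennreal_mult_less_top less_top)
    finally show ?thesis .
  qed
  then obtain c where c: "I = ennreal c" "c \<ge> 0" by (cases I) auto
  let ?\<mu> = "distr (density lborel (\<lambda>x. ennreal (h x))) borel (\<lambda>x. (norm x)\<^sup>2)"
  let ?\<nu> = "density lborel (\<lambda>t. ennreal (c * k * radial_density k t))"
  have eqI: "(\<integral>\<^sup>+x. ennreal (h x) * indicator {x. (norm x)\<^sup>2 \<le> t} x \<partial>lborel) = ennreal (c * t powr k)" if t: "t > 0" for t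
  proof -
    define r where "r = sqrt t"
    have r: "r > 0" "t = r\<^sup>2" using t by (auto simp: r_def)
    have "(\<integral>\<^sup>+x. ennreal (h x) * indicator {x. (norm x)\<^sup>2 \<le> t} x \<partial>lborel)
        = ennreal (r ^ CARD('n)) * (\<integral>\<^sup>+x. ennreal (h (r *\<^sub>R x)) * indicator {x. (norm x)\<^sup>2 \<le> t} (r *\<^sub>R x) \<partial>(lborel :: (real^'n) measure))"
      by (subst nn_integral_lborel_scale[OF _ r(1)]) auto
    also have "(\<integral>\<^sup>+x. ennreal (h (r *\<^sub>R x)) * indicator {x. (norm x)\<^sup>2 \<le> t} (r *\<^sub>R x) \<partial>(lborel :: (real^'n) measure))
        = (\<integral>\<^sup>+x. ennreal (r ^ d) * (ennreal (h x) * indicator (cball 0 1) x) \<partial>lborel)"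
    proof (intro nn_integral_cong)
      fix x :: "real^'n"
      have "(norm (r *\<^sub>R x))\<^sup>2 \<le> t \<longleftrightarrow> norm x \<le> 1"
        using r by (simp add: power_mult_distrib abs_square_le_1 mult_le_cancel_left2)
      then show "ennreal (h (r *\<^sub>R x)) * indicator {x. (norm x)\<^sup>2 \<le> t} (r *\<^sub>R x)
          = ennreal (r ^ d) * (ennreal (h x) * indicator (cball 0 1) x)"
        using r nonneg by (auto simp: hom ennreal_mult indicator_def)
    qed
    also have "\<dots> = ennreal (r ^ d) * I" unfolding I_def
    proof (rule nn_integral_cmult)
      have [measurable]: "cball 0 1 \<in> sets (borel :: (real^'n) measure)" by simp
      show "(\<lambda>x. ennreal (h x) * indicator (cball 0 1) x) \<in> borel_measurable lborel" by measurable
    qed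
    also have "ennreal (r ^ CARD('n)) * (ennreal (r ^ d) * I) = ennreal (c * r ^ (d + CARD('n)))"
      using r c by (simp add: ennreal_mult power_add mult_ac)
    also have "r ^ (d + CARD('n)) = t powr k"
    proof -
      have "real (d + CARD('n)) = 2 * k" by (simp add: k_def)
      then have "r ^ (d + CARD('n)) = r powr (2 * k)" using r powr_realpow[of r "d + CARD('n)"] by simp
      also have "\<dots> = t powr k" using r by (simp add: powr_powr[symmetric] powr_numeral)
      finally show ?thesis .
    qed
    finally show ?thesis .
  qed
  have "?\<mu> = ?\<nu>"
  proof (rule measure_eqI_generator_eq[where E = "range (\<lambda>a::real. {..a})" and \<Omega> = UNIV and A = "\<lambda>i. {..real i + 1}"])
    show "Int_stable (range (\<lambda>a::real. {..a}))" by (auto simp: Int_stable_def)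
    have "emeasure ?\<mu> {..a} = emeasure ?\<nu> {..a}" for a
    proof -
      have m: "emeasure ?\<mu> {..a} = (\<integral>\<^sup>+x. ennreal (h x) * indicator {x. (norm x)\<^sup>2 \<le> a} x \<partial>lborel)"
        by (simp add: emeasure_distr emeasure_density vimage_def)
      have n: "emeasure ?\<nu> {..a} = ennreal (c * k) * (\<integral>\<^sup>+s. ennreal (radial_density k s) * indicator {..a} s \<partial>lborel)"
        using c k by (simp add: emeasure_density ennreal_mult mult.assoc nn_integral_cmult)
      show ?thesis
      proof (cases "a > 0")
        case True
        then show ?thesis
          unfolding m n eqI[OF True] nn_integral_radial_density_atMost[OF k True]
          using c k by (simp flip: ennreal_mult)
      next
        case False
        have "AE x in (lborel :: (real^'n) measure). x \<noteq> 0" by (rule AE_lborel_singleton)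
        then have "(\<integral>\<^sup>+x. ennreal (h x) * indicator {x. (norm x)\<^sup>2 \<le> a} x \<partial>lborel) = (\<integral>\<^sup>+x. 0 \<partial>(lborel :: (real^'n) measure))"
        proof (intro nn_integral_cong_AE, eventually_elim)
          case (elim x)
          then have "(norm x)\<^sup>2 > 0" by simp
          then have "\<not> (norm x)\<^sup>2 \<le> a" using False by linarith
          then show ?case by (simp add: indicator_def)
        qed
        moreover have "(\<integral>\<^sup>+s. ennreal (radial_density k s) * indicator {..a} s \<partial>lborel) = (\<integral>\<^sup>+s. 0 \<partial>(lborel :: real measure))"
          using False by (intro nn_integral_cong) (auto simp: radial_density_def indicator_def)
        ultimately show ?thesis unfolding m n by simp
      qed
    qed
    then show "\<And>X. X \<in> range (\<lambda>a::real. {..a}) \<Longrightarrow> emeasure ?\<mu> X = emeasure ?\<nu> X" by blast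
    show "sets ?\<mu> = sigma_sets UNIV (range (\<lambda>a::real. {..a}))" "sets ?\<nu> = sigma_sets UNIV (range (\<lambda>a::real. {..a}))"
      using arg_cong[OF borel_eq_atMost[where 'a = real], of sets] by auto
    show "(\<Union>i. {..real i + 1}) = UNIV"
    proof -
      have "\<exists>i. x \<le> real i + 1" for x using real_arch_simple[of x] by (meson add_increasing2 order_trans zero_le_one)
      then show ?thesis by auto
    qed
    show "emeasure ?\<mu> {..real i + 1} \<noteq> \<infinity>" for i
      using eqI[of "real i + 1"] by (simp add: emeasure_distr emeasure_density vimage_def)
  qed auto
  then show ?thesis using c k by (intro exI[of _ "c * k"]) simp
qed

text \<open>
  Integration of \<open>h\<close> against radial functions in polar coordinates; \<open>C\<close> is the angular integral
  of \<open>h\<close>, up to normalization.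
\<close>

definition radial_factor :: "(real^'n::finite \<Rightarrow> complex) \<Rightarrow> real \<Rightarrow> complex \<Rightarrow> bool" where
  "radial_factor h k C \<longleftrightarrow> (\<forall>G. G \<in> borel_measurable borel \<longrightarrow>
     integrable lborel (\<lambda>t. of_real (radial_density k t) * G t) \<longrightarrow>
     integrable lborel (\<lambda>x. h x * G ((norm x)\<^sup>2)) \<and>
     (\<integral>x. h x * G ((norm x)\<^sup>2) \<partial>lborel) = C * (\<integral>t. of_real (radial_density k t) * G t \<partial>lborel))"

lemma radial_factor_add:
  "radial_factor f k A \<Longrightarrow> radial_factor g k B \<Longrightarrow> radial_factor (\<lambda>x. f x + g x) k (A + B)"
  unfolding radial_factor_def distrib_right by (simp add: Bochner_Integration.integral_add)

lemma radial_factor_cmult: "radial_factor f k A \<Longrightarrow> radial_factor (\<lambda>x. c * f x) k (c * A)"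
  unfolding radial_factor_def mult.assoc by simp

lemma radial_factor_nonneg:
  fixes h :: "real^'n::finite \<Rightarrow> real"
  assumes cont: "continuous_on UNIV h" and nonneg: "\<And>x. 0 \<le> h x"
    and hom: "\<And>r x. r > 0 \<Longrightarrow> h (r *\<^sub>R x) = r ^ d * h x"
  shows "\<exists>C. radial_factor (\<lambda>x. of_real (h x)) ((real d + real CARD('n)) / 2) C"
proof -
  define k where "k = (real d + real CARD('n)) / 2"
  have [measurable]: "h \<in> borel_measurable borel" using cont by (rule borel_measurable_continuous_onI)
  obtain C where C: "C \<ge> 0" and eq: "distr (density lborel (\<lambda>x. ennreal (h x))) borel (\<lambda>x. (norm x)\<^sup>2)
    = density lborel (\<lambda>t. ennreal (C * radial_density k t))"
    using distr_norm_sq_homogeneous[OF cont nonneg hom] unfolding k_def by blast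
  have "radial_factor (\<lambda>x. of_real (h x)) k (of_real C)"
    unfolding radial_factor_def
  proof (intro allI impI)
    fix G :: "real \<Rightarrow> complex" assume [measurable]: "G \<in> borel_measurable borel"
      and G: "integrable lborel (\<lambda>t. of_real (radial_density k t) * G t)"
    have cG: "(C * radial_density k t) *\<^sub>R G t = of_real C * (of_real (radial_density k t) * G t)" for t
      by (simp add: scaleR_conv_of_real)
    have "integrable (density lborel (\<lambda>t. ennreal (C * radial_density k t))) G"
      using G C by (subst integrable_density) (auto simp: cG)
    then have "integrable (density lborel (\<lambda>x. ennreal (h x))) (\<lambda>x. G ((norm x)\<^sup>2))"
      unfolding eq[symmetric] by (subst (asm) integrable_distr_eq) auto
    then have 1: "integrable lborel (\<lambda>x. of_real (h x) * G ((norm x)\<^sup>2))"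
      using nonneg by (subst (asm) integrable_density) (auto simp: scaleR_conv_of_real)
    have "(\<integral>x. of_real (h x) * G ((norm x)\<^sup>2) \<partial>lborel) = (\<integral>x. G ((norm x)\<^sup>2) \<partial>density lborel (\<lambda>x. ennreal (h x)))"
      using nonneg by (subst integral_density) (auto simp: scaleR_conv_of_real)
    also have "\<dots> = (\<integral>t. G t \<partial>density lborel (\<lambda>t. ennreal (C * radial_density k t)))"
      unfolding eq[symmetric] by (subst integral_distr) auto
    also have "\<dots> = of_real C * (\<integral>t. of_real (radial_density k t) * G t \<partial>lborel)"
      using C by (subst integral_density) (auto simp: cG)
    finally show "integrable lborel (\<lambda>x. of_real (h x) * G ((norm x)\<^sup>2)) \<and>
     (\<integral>x. of_real (h x) * G ((norm x)\<^sup>2) \<partial>lborel) = of_real C * (\<integral>t. of_real (radial_density k t) * G t \<partial>lborel)"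
      using 1 by blast
  qed
  then show ?thesis unfolding k_def by blast
qed

text \<open>
  The positive and negative parts of the real and imaginary parts are nonnegative and homogeneous.
\<close>

lemma radial_factor_homogeneous:
  fixes p :: "real^'n::finite \<Rightarrow> complex"
  assumes p: "p \<in> homogeneous_polys d"
  shows "\<exists>C. radial_factor p ((real d + real CARD('n)) / 2) C"
proof -
  have cont: "continuous_on UNIV p" by (rule homogeneous_continuous[OF p])
  have hom: "p (r *\<^sub>R x) = of_real (r ^ d) * p x" for r x by (rule homogeneous_scaleR[OF p])
  have part: "\<exists>C. radial_factor (\<lambda>x. of_real (max 0 (u (p x)))) ((real d + real CARD('n)) / 2) C"
    if u: "continuous_on UNIV u" "\<And>a z. u (of_real a * z) = a * u z" for u :: "complex \<Rightarrow> real"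
  proof (rule radial_factor_nonneg)
    show "continuous_on UNIV (\<lambda>x. max 0 (u (p x)))"
      by (intro continuous_intros continuous_on_compose2[OF u(1) cont]) auto
    show "max 0 (u (p (r *\<^sub>R x))) = r ^ d * max 0 (u (p x))" if "r > 0" for r x
      using that unfolding hom u(2) by (simp add: max_mult_distrib_left)
  qed simp
  have "continuous_on UNIV Re" "continuous_on UNIV Im"
    by (rule linear_continuous_on[OF bounded_linear_Re], rule linear_continuous_on[OF bounded_linear_Im])
  note cont_parts = this continuous_on_minus[OF this(1)] continuous_on_minus[OF this(2)]
  obtain A B C D where parts:
    "radial_factor (\<lambda>x. of_real (max 0 (Re (p x)))) ((real d + real CARD('n)) / 2) A"
    "radial_factor (\<lambda>x. of_real (max 0 (- Re (p x)))) ((real d + real CARD('n)) / 2) B"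
    "radial_factor (\<lambda>x. of_real (max 0 (Im (p x)))) ((real d + real CARD('n)) / 2) C"
    "radial_factor (\<lambda>x. of_real (max 0 (- Im (p x)))) ((real d + real CARD('n)) / 2) D"
    using part[of Re] part[of "\<lambda>z. - Re z"] part[of Im] part[of "\<lambda>z. - Im z"]
    using cont_parts by auto
  have "p x = (of_real (max 0 (Re (p x))) + (-1) * of_real (max 0 (- Re (p x)))) +
      \<i> * (of_real (max 0 (Im (p x))) + (-1) * of_real (max 0 (- Im (p x))))" for x
    by (simp add: complex_eq_iff max_def)
  then have "p = (\<lambda>x. (of_real (max 0 (Re (p x))) + (-1) * of_real (max 0 (- Re (p x)))) +
      \<i> * (of_real (max 0 (Im (p x))) + (-1) * of_real (max 0 (- Im (p x)))))"
    by (rule ext)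
  with radial_factor_add[OF radial_factor_add[OF parts(1) radial_factor_cmult[OF parts(2), of "-1"]]
      radial_factor_cmult[OF radial_factor_add[OF parts(3) radial_factor_cmult[OF parts(4), of "-1"]], of \<i>]]
  show ?thesis by metis
qed

lemma integrable_Gamma_density:
  assumes a: "a > 0" and s: "s > (0::real)"
  shows "integrable lborel (\<lambda>t. radial_density a t * exp (- (s * t)))"
proof -
  have "(\<lambda>t. complex_of_real t powr (of_real a - 1) / of_real (exp (s * t))) absolutely_integrable_on {0<..}"
    using absolutely_integrable_Gamma_integral[of "of_real a" s] a s by simp
  then have "integrable lebesgue (\<lambda>t. indicator {0<..} t *\<^sub>R (complex_of_real t powr (of_real a - 1) / of_real (exp (s * t))))"
    by (simp add: set_integrable_def)
  then have "integrable lebesgue (\<lambda>t. norm (indicator {0<..} t *\<^sub>R (complex_of_real t powr (of_real a - 1) / of_real (exp (s * t)))))"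
    by (rule integrable_norm)
  also have "(\<lambda>t. norm (indicator {0<..} t *\<^sub>R (complex_of_real t powr (of_real a - 1) / of_real (exp (s * t)))))
     = (\<lambda>t. radial_density a t * exp (- (s * t)))"
  proof
    fix t
    have "complex_of_real t powr (of_real a - 1) = of_real (t powr (a - 1))" if "t > 0"
      using that powr_of_real[of t "a - 1"] by simp
    then show "norm (indicator {0<..} t *\<^sub>R (complex_of_real t powr (of_real a - 1) / of_real (exp (s * t))))
      = radial_density a t * exp (- (s * t))"
      by (auto simp: radial_density_def indicator_def norm_divide exp_minus field_simps)
  qed
  finally show ?thesis by (subst (asm) integrable_completion) simp_all
qed

lemma integral_Gamma_density:
  assumes a: "a > (0::real)"
  shows "(\<integral>t. radial_density a t * exp (- t) \<partial>lborel) = Gamma a"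
proof -
  have "(\<integral>\<^sup>+t. ennreal (radial_density a t * exp (- t)) \<partial>lborel) = ennreal (Gamma a)"
    unfolding Gamma_conv_nn_integral_real[OF a]
    by (intro nn_integral_cong) (auto simp: radial_density_def indicator_def exp_minus divide_inverse)
  then show ?thesis
    using a by (intro integral_eq_nn_integral[THEN trans]) (auto simp: Gamma_real_pos less_imp_le)
qed

section \<open>Laguerre polynomials\<close>

text \<open>
  \<open>\<integral> q(t) t\<^bsup>a-1\<^esup> e\<^bsup>-t\<^esup> dt\<close> over the positive half-line.
\<close>

definition gamma_functional :: "real \<Rightarrow> complex poly \<Rightarrow> complex" where
  "gamma_functional a q = (\<integral>t. of_real (radial_density a t) * (of_real (exp (- t)) * poly q (of_real t)) \<partial>lborel)"

lemma radial_density_times: "radial_density a t * t = radial_density (a + 1) t"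
  by (auto simp: radial_density_def indicator_def powr_add powr_diff)

lemma radial_density_powr: "radial_density a t * t powr b = radial_density (a + b) t"
  by (auto simp: radial_density_def indicator_def powr_add[symmetric] algebra_simps)

lemma integrable_gamma_poly:
  "a > 0 \<Longrightarrow> s > 0 \<Longrightarrow> integrable lborel (\<lambda>t. of_real (radial_density a t) * (of_real (exp (- (s * t))) * poly q (complex_of_real t)))"
proof (induction q arbitrary: a)
  case (pCons c q)
  have i: "integrable lborel (\<lambda>t. c * of_real (radial_density a t * exp (- (s * t))))"
    using integrable_Gamma_density[OF pCons.prems] by (intro integrable_mult_right integrable_of_real)
  have eq: "of_real (radial_density a t) * (of_real (exp (- (s * t))) * poly (pCons c q) (complex_of_real t))
     = c * of_real (radial_density a t * exp (- (s * t))) + of_real (radial_density (a + 1) t) * (of_real (exp (- (s * t))) * poly q (complex_of_real t))" for t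
    unfolding radial_density_times[symmetric] by (simp add: algebra_simps)
  show ?case unfolding eq using pCons.prems pCons.IH[of "a + 1"] i by (intro Bochner_Integration.integrable_add) auto
qed simp

lemma gamma_functional_add:
  assumes "a > 0" shows "gamma_functional a (p + q) = gamma_functional a p + gamma_functional a q"
proof -
  have "integrable lborel (\<lambda>t. of_real (radial_density a t) * (of_real (exp (- t)) * poly q (complex_of_real t)))" for q
    using integrable_gamma_poly[OF assms, of 1 q] by simp
  then show ?thesis unfolding gamma_functional_def by (simp add: distrib_left)
qed

lemma gamma_functional_smult: "gamma_functional a (smult c p) = c * gamma_functional a p"
proof -
  have "of_real (radial_density a t) * (of_real (exp (- t)) * poly (smult c p) (complex_of_real t))
     = c * (of_real (radial_density a t) * (of_real (exp (- t)) * poly p (complex_of_real t)))" for t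
    by simp
  then show ?thesis unfolding gamma_functional_def by (simp only: integral_mult_right_zero)
qed

lemma gamma_functional_minus: "gamma_functional a (- p) = - gamma_functional a p"
  using gamma_functional_smult[of a "-1" p] by simp

lemma gamma_functional_diff:
  "a > 0 \<Longrightarrow> gamma_functional a (p - q) = gamma_functional a p - gamma_functional a q"
  using gamma_functional_add[of a p "- q"] gamma_functional_minus[of a q] by simp

lemma gamma_functional_const: "a > 0 \<Longrightarrow> gamma_functional a [:c:] = c * of_real (Gamma a)"
proof -
  assume a: "a > 0"
  have "of_real (radial_density a t) * (of_real (exp (- t)) * poly [:c:] (complex_of_real t))
      = c * of_real (radial_density a t * exp (- t))" for t by simp
  then show ?thesis
    unfolding gamma_functional_def using integral_Gamma_density[OF a]
    by (simp only: integral_mult_right_zero integral_complex_of_real)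
qed

lemma gamma_functional_shift: "gamma_functional a (pCons 0 q) = gamma_functional (a + 1) q"
  unfolding gamma_functional_def radial_density_times[symmetric]
  by (intro Bochner_Integration.integral_cong) (simp_all add: algebra_simps)

text \<open>
  Integration by parts against \<open>t\<^bsup>a-1\<^esup> e\<^bsup>-t\<^esup>\<close>. By induction on \<open>q\<close> for all \<open>a\<close> at once: a factor \<open>t\<close> is
  absorbed by passing to \<open>a + 1\<close>, and for constant \<open>q\<close> the identity is \<open>\<Gamma>(a + 1) = a \<Gamma>(a)\<close>.
\<close>

lemma gamma_functional_parts:
  "a > 0 \<Longrightarrow> gamma_functional a (pCons 0 (pderiv q)) = gamma_functional a ([:- of_real a, 1:] * q)"
proof (induction q arbitrary: a)
  case 0
  show ?case by (simp add: pderiv_0)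
next
  case (pCons c q)
  have a: "a > 0" "a + 1 > 0" using pCons.prems by auto
  have "gamma_functional a (pCons 0 (pderiv (pCons c q))) = gamma_functional (a + 1) q + gamma_functional (a + 1) (pCons 0 (pderiv q))"
    by (simp add: gamma_functional_shift pderiv_pCons gamma_functional_add a)
  also have "\<dots> = gamma_functional (a + 1) (q + [:- of_real (a + 1), 1:] * q)"
    unfolding pCons.IH[OF a(2)] gamma_functional_add[OF a(2)] ..
  also have "q + [:- of_real (a + 1), 1:] * q = [:- of_real a, 1:] * q"
  proof -
    have "[:- of_real (a + 1), 1:] = [:- of_real a, 1:] - (1 :: complex poly)" by (simp add: one_pCons)
    then show ?thesis by (simp only: left_diff_distrib mult_1_left) simp
  qed
  also have "gamma_functional (a + 1) ([:- of_real a, 1:] * q) = gamma_functional a ([:- of_real a, 1:] * pCons 0 q)"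
    by (simp add: gamma_functional_shift[symmetric])
  also have "\<dots> = gamma_functional a ([:- of_real a, 1:] * pCons 0 q) + gamma_functional a ([:- of_real a, 1:] * [:c:])"
  proof -
    have "[:- of_real a, 1:] * [:c:] = [:- (of_real a * c):] + pCons 0 [:c:]" by simp
    then have "gamma_functional a ([:- of_real a, 1:] * [:c:]) = - (of_real a * c) * of_real (Gamma a) + c * of_real (Gamma (a + 1))"
      by (simp only: gamma_functional_add[OF a(1)] gamma_functional_shift gamma_functional_const[OF a(1)] gamma_functional_const[OF a(2)])
    also have "\<dots> = 0"
    proof -
      have "Gamma (a + 1) = a * Gamma a" using Gamma_plus1[of a] a nonpos_Ints_nonpos[of a] by force
      then show ?thesis by (simp only: of_real_mult) (simp add: algebra_simps)
    qed
    finally show ?thesis by simp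
  qed
  also have "\<dots> = gamma_functional a ([:- of_real a, 1:] * pCons c q)"
  proof -
    have "[:- of_real a, 1:] * pCons c q = [:- of_real a, 1:] * pCons 0 q + [:- of_real a, 1:] * [:c:]"
      unfolding distrib_left[symmetric] by simp
    then show ?thesis by (simp only: gamma_functional_add[OF a(1)])
  qed
  finally show ?case .
qed

text \<open>
  The Laguerre differential operator \<open>t q'' + (a - t) q'\<close> for the parameter \<open>a - 1\<close>.
\<close>

definition laguerre_operator :: "real \<Rightarrow> complex poly \<Rightarrow> complex poly" where
  "laguerre_operator a q = pCons 0 (pderiv (pderiv q)) - [:- of_real a, 1:] * pderiv q"

text \<open>
  Integration by parts, applied to \<open>q' r\<close>, turns the left-hand side into the integral of
  \<open>- t q' r'\<close>.
\<close>

lemma laguerre_operator_symmetric: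
  assumes a: "a > 0"
  shows "gamma_functional a (laguerre_operator a q * r) = gamma_functional a (q * laguerre_operator a r)"
proof -
  have "gamma_functional a (laguerre_operator a q * r) = - gamma_functional a (pCons 0 (pderiv q * pderiv r))" for q r
  proof -
    have "laguerre_operator a q * r = pCons 0 (pderiv (pderiv q * r)) - [:- of_real a, 1:] * (pderiv q * r) - pCons 0 (pderiv q * pderiv r)"
      by (simp add: laguerre_operator_def pderiv_mult algebra_simps)
    then show ?thesis
      using gamma_functional_parts[OF a, of "pderiv q * r"] by (simp add: gamma_functional_diff a)
  qed
  from this[of q r] this[of r q] show ?thesis by (simp add: mult.commute)
qed

definition laguerre_poly :: "real \<Rightarrow> nat \<Rightarrow> complex poly" where
  "laguerre_poly \<nu> l = (\<Sum>k\<le>l. monom (of_real ((-1) ^ k * Gamma (\<nu> + real l + 1) / (Gamma (\<nu> + real k + 1) * fact (l - k) * fact k))) k)"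

lemma poly_laguerre_poly: "poly (laguerre_poly \<nu> l) (of_real t) = of_real (laguerre \<nu> l t)"
  unfolding laguerre_poly_def laguerre_def
  by (auto simp: poly_sum poly_monom atLeast0AtMost intro!: sum.cong)

lemma coeff_laguerre_poly:
  "coeff (laguerre_poly \<nu> l) k = (if k \<le> l then of_real ((-1) ^ k * Gamma (\<nu> + real l + 1) / (Gamma (\<nu> + real k + 1) * fact (l - k) * fact k)) else 0)"
  unfolding laguerre_poly_def by (simp add: coeff_sum coeff_monom sum.delta)

text \<open>
  The Laguerre differential equation, read off coefficientwise.
\<close>

lemma coeff_laguerre_poly_Suc:
  assumes \<nu>: "\<nu> > -1"
  shows "of_nat (Suc k) * (of_nat k + of_real (\<nu> + 1)) * coeff (laguerre_poly \<nu> l) (Suc k) = - (of_nat l - of_nat k) * coeff (laguerre_poly \<nu> l) k"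
proof (cases "k < l")
  case True
  have pos: "\<nu> + real k + 1 > 0" using \<nu> by simp
  then have G: "Gamma (\<nu> + real k + 1 + 1) = (\<nu> + real k + 1) * Gamma (\<nu> + real k + 1)"
    using Gamma_plus1[of "\<nu> + real k + 1"] nonpos_Ints_nonpos[of "\<nu> + real k + 1"] by force
  have g0: "Gamma (\<nu> + real k + 1) \<noteq> 0" using Gamma_real_pos[OF pos] by simp
  have f: "fact (l - k) = (real l - real k) * fact (l - Suc k)"
    using True fact_reduce[of "l - k", where 'a = real] by (simp add: of_nat_diff)
  have lk: "real l - real k > 0" using True by simp
  have "real (Suc k) * (real k + (\<nu> + 1)) * ((-1) ^ Suc k * Gamma (\<nu> + real l + 1) / (Gamma (\<nu> + real (Suc k) + 1) * fact (l - Suc k) * fact (Suc k)))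
      = - (real l - real k) * ((-1) ^ k * Gamma (\<nu> + real l + 1) / (Gamma (\<nu> + real k + 1) * fact (l - k) * fact k))"
  proof -
    have 1: "Gamma (\<nu> + real (Suc k) + 1) = (\<nu> + real k + 1) * Gamma (\<nu> + real k + 1)" using G by (simp add: algebra_simps)
    have 2: "(fact (Suc k) :: real) = real (Suc k) * fact k" by simp
    define A where "A = \<nu> + real k + 1"
    define B where "B = real (Suc k)"
    define L where "L = real l - real k"
    have nz: "A \<noteq> 0" "B \<noteq> 0" "L \<noteq> 0" "fact k \<noteq> (0::real)" "fact (l - Suc k) \<noteq> (0::real)" "Gamma A \<noteq> 0"
      using pos lk g0 by (auto simp: A_def B_def L_def)
    have "B * A * (- ((-1) ^ k) * Gamma (\<nu> + real l + 1) / (A * Gamma A * fact (l - Suc k) * (B * fact k)))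
       = - L * ((-1) ^ k * Gamma (\<nu> + real l + 1) / (Gamma A * (L * fact (l - Suc k)) * fact k))"
      using nz by (simp add: divide_simps)
    then show ?thesis unfolding 1 2 f A_def B_def L_def by (simp add: algebra_simps)
  qed
  from arg_cong[OF this, of complex_of_real] show ?thesis
    using True by (simp add: coeff_laguerre_poly del: of_nat_Suc fact_Suc power_Suc)
qed (auto simp: coeff_laguerre_poly)

lemma laguerre_operator_laguerre_poly:
  assumes \<nu>: "\<nu> > -1"
  shows "laguerre_operator (\<nu> + 1) (laguerre_poly \<nu> l) = smult (- of_nat l) (laguerre_poly \<nu> l)"
proof (rule poly_eqI)
  fix k
  let ?c = "coeff (laguerre_poly \<nu> l)"
  have "coeff (laguerre_operator (\<nu> + 1) (laguerre_poly \<nu> l)) k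
      = of_nat (Suc k) * (of_nat k + of_real (\<nu> + 1)) * ?c (Suc k) - of_nat k * ?c k"
    by (cases k) (simp_all add: laguerre_operator_def coeff_pderiv algebra_simps)
  also have "\<dots> = - of_nat l * ?c k"
    unfolding coeff_laguerre_poly_Suc[OF \<nu>] by (simp add: algebra_simps)
  finally show "coeff (laguerre_operator (\<nu> + 1) (laguerre_poly \<nu> l)) k = coeff (smult (- of_nat l) (laguerre_poly \<nu> l)) k"
    by simp
qed

lemma degree_laguerre_poly:
  assumes "\<nu> > -1"
  shows "degree (laguerre_poly \<nu> l) = l" and "coeff (laguerre_poly \<nu> l) l \<noteq> 0"
proof -
  have "Gamma (\<nu> + real l + 1) > 0" using assms by (intro Gamma_real_pos) simp
  then show c: "coeff (laguerre_poly \<nu> l) l \<noteq> 0" by (simp add: coeff_laguerre_poly)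
  show "degree (laguerre_poly \<nu> l) = l"
    by (rule antisym[OF degree_le le_degree[OF c]]) (simp add: coeff_laguerre_poly)
qed

text \<open>
  The degrees of the Laguerre polynomials are \<open>0, 1, 2, \<dots>\<close>, so leading terms can be removed
  successively.
\<close>

lemma laguerre_poly_span:
  assumes \<nu>: "\<nu> > -1"
    and add: "\<And>p q. P p \<Longrightarrow> P q \<Longrightarrow> P (p + q)" and smult: "\<And>c p. P p \<Longrightarrow> P (smult c p)"
    and lag: "\<And>l. P (laguerre_poly \<nu> l)"
  shows "P q"
proof (induction "degree q" arbitrary: q rule: less_induct)
  case less
  define l where "l = degree q"
  define c where "c = coeff q l / coeff (laguerre_poly \<nu> l) l"
  let ?r = "q - smult c (laguerre_poly \<nu> l)"
  have top: "coeff ?r l = 0" using degree_laguerre_poly[OF \<nu>, of l] by (simp add: c_def)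
  have dr: "degree ?r \<le> l"
    using degree_laguerre_poly[OF \<nu>, of l] by (intro degree_diff_le) (auto simp: l_def intro: order_trans[OF degree_smult_le])
  have "P ?r"
  proof (cases "?r = 0")
    case True
    then show ?thesis using smult[OF lag, of 0 0] by simp
  next
    case False
    have "degree ?r \<noteq> l" using top False leading_coeff_0_iff by metis
    then show ?thesis using dr by (intro less) (simp add: l_def)
  qed
  from add[OF this smult[OF lag, of c l]] show ?case by simp
qed

section \<open>Gaussian integrals in the weighted space\<close>

lemma norm_powr_sq: "norm x powr (2 * b) = ((norm x)\<^sup>2) powr b"
  by (cases "x = 0") (simp_all add: powr_powr[symmetric] powr_numeral)

lemma integrable_weighted_iff:
  fixes f :: "real^'n::finite \<Rightarrow> complex"
  assumes "f \<in> borel_measurable borel"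
  shows "integrable (weighted_measure b) f \<longleftrightarrow> integrable lborel (\<lambda>x. of_real (((norm x)\<^sup>2) powr b) * f x)"
  unfolding weighted_measure_def using assms
  by (subst integrable_density) (auto simp: norm_powr_sq scaleR_conv_of_real)

lemma integral_weighted:
  fixes f :: "real^'n::finite \<Rightarrow> complex"
  assumes "f \<in> borel_measurable borel"
  shows "(\<integral>x. f x \<partial>weighted_measure b) = (\<integral>x. of_real (((norm x)\<^sup>2) powr b) * f x \<partial>lborel)"
  unfolding weighted_measure_def using assms
  by (subst integral_density) (auto simp: norm_powr_sq scaleR_conv_of_real)

lemma sets_weighted_measure [simp, measurable_cong]: "sets (weighted_measure b) = sets borel"
  by (simp add: weighted_measure_def)

lemma space_weighted_measure [simp]: "space (weighted_measure b) = UNIV"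
  by (simp add: weighted_measure_def)

lemma xsq_measurable [measurable]: "xsq \<in> borel_measurable borel"
  unfolding xsq_def by measurable

lemma gauss_measurable [measurable]: "gauss \<in> borel_measurable borel"
  unfolding gauss_def by measurable

lemma poly_xsq_measurable [measurable]: "(\<lambda>x. poly q (xsq x)) \<in> borel_measurable borel"
  by (induction q) simp_all

lemma homogeneous_measurable: "p \<in> homogeneous_polys m \<Longrightarrow> p \<in> borel_measurable borel"
  by (rule borel_measurable_continuous_onI[OF homogeneous_continuous])

text \<open>
  The weight \<open>|x|\<^bsup>2b\<^esup>\<close> is radial and enters only the one-dimensional integral. As \<open>C\<close> is common to all
  \<open>b\<close>, whether it vanishes can be decided at \<open>b = 0\<close>.
\<close>

lemma weighted_gaussian_integral:
  fixes p :: "real^'n::finite \<Rightarrow> complex"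
  assumes p: "p \<in> homogeneous_polys d"
  obtains C where
    "\<And>b s q. b + (real d + real CARD('n)) / 2 > 0 \<Longrightarrow> s > 0 \<Longrightarrow>
       integrable (weighted_measure b) (\<lambda>x. p x * (of_real (exp (- (s * (norm x)\<^sup>2))) * poly q (xsq x)))"
    and "\<And>b q. b + (real d + real CARD('n)) / 2 > 0 \<Longrightarrow>
       (\<integral>x. p x * (of_real (exp (- (norm x)\<^sup>2)) * poly q (xsq x)) \<partial>weighted_measure b)
         = C * gamma_functional (b + (real d + real CARD('n)) / 2) q"
proof -
  define k where "k = (real d + real CARD('n)) / 2"
  obtain C where C: "radial_factor p k C" unfolding k_def using radial_factor_homogeneous[OF p] by blast
  then have C1: "\<And>G :: real \<Rightarrow> complex. G \<in> borel_measurable borel \<Longrightarrow> integrable lborel (\<lambda>t. of_real (radial_density k t) * G t) \<Longrightarrow>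
     integrable lborel (\<lambda>x. p x * G ((norm x)\<^sup>2))"
   and C2: "\<And>G :: real \<Rightarrow> complex. G \<in> borel_measurable borel \<Longrightarrow> integrable lborel (\<lambda>t. of_real (radial_density k t) * G t) \<Longrightarrow>
     (\<integral>x. p x * G ((norm x)\<^sup>2) \<partial>lborel) = C * (\<integral>t. of_real (radial_density k t) * G t \<partial>lborel)"
    unfolding radial_factor_def by blast+
  note [measurable] = homogeneous_measurable[OF p]
  have pm: "(\<lambda>t. poly q (complex_of_real t)) \<in> borel_measurable borel" for q
    by (induction q) simp_all
  define G where "G b s q t = complex_of_real (t powr b) * (of_real (exp (- (s * t))) * poly q (of_real t))" for b s q t
  have [measurable]: "G b s q \<in> borel_measurable borel" for b s q
    unfolding G_def using pm[of q] by measurable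
  have kG: "of_real (radial_density k t) * G b s q t
      = of_real (radial_density (b + k) t) * (of_real (exp (- (s * t))) * poly q (of_real t))" for b s q t
    using radial_density_powr[of k t b] by (simp add: G_def add.commute flip: mult.assoc of_real_mult)
  have xG: "of_real (((norm x)\<^sup>2) powr b) * (p x * (of_real (exp (- (s * (norm x)\<^sup>2))) * poly q (xsq x)))
     = p x * G b s q ((norm x)\<^sup>2)" for b s q x
    by (simp add: G_def xsq_def)
  have int: "integrable lborel (\<lambda>t. of_real (radial_density k t) * G b s q t)" if "b + k > 0" "s > 0" for b s q
    unfolding kG using that by (rule integrable_gamma_poly)
  show ?thesis
  proof (rule that[of C]; fold k_def)
    fix b s q assume "b + k > 0" "(s::real) > 0"
    then show "integrable (weighted_measure b) (\<lambda>x. p x * (of_real (exp (- (s * (norm x)\<^sup>2))) * poly q (xsq x)))"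
      by (subst integrable_weighted_iff) (auto simp only: xG intro!: C1 int, measurable)
  next
    fix b q assume b: "b + k > 0"
    have "(\<integral>x. p x * (of_real (exp (- (1 * (norm x)\<^sup>2))) * poly q (xsq x)) \<partial>weighted_measure b)
        = (\<integral>x. p x * G b 1 q ((norm x)\<^sup>2) \<partial>lborel)"
      by (subst integral_weighted) (simp_all only: xG, measurable)
    also have "\<dots> = C * gamma_functional (b + k) q"
      using C2[OF _ int[OF b zero_less_one, of q]] unfolding kG gamma_functional_def by simp
    finally show "(\<integral>x. p x * (of_real (exp (- (norm x)\<^sup>2)) * poly q (xsq x)) \<partial>weighted_measure b)
         = C * gamma_functional (b + k) q" by simp
  qed
qed

section \<open>Orthogonality of harmonic polynomials\<close>

lemma has_partial_line:
  assumes "has_partial k F F'"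
  shows "((\<lambda>t. F (x + t *\<^sub>R axis k 1)) has_vector_derivative F' (x + t *\<^sub>R axis k 1)) (at t within S)"
proof -
  let ?y = "x + t *\<^sub>R axis k 1"
  have 1: "((\<lambda>u. F (?y + u *\<^sub>R axis k 1)) has_vector_derivative F' ?y) (at (t - t))"
    using assms by (simp add: has_partial_def)
  have 2: "((\<lambda>u. u - t) has_vector_derivative 1) (at t)"
    by (auto intro!: derivative_eq_intros)
  have "((\<lambda>u. F (?y + u *\<^sub>R axis k 1)) \<circ> (\<lambda>u. u - t) has_vector_derivative 1 *\<^sub>R F' ?y) (at t)"
    by (rule vector_diff_chain_at[OF 2 1])
  moreover have "(\<lambda>u. F (?y + u *\<^sub>R axis k 1)) \<circ> (\<lambda>u. u - t) = (\<lambda>u. F (x + u *\<^sub>R axis k 1))"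
    by (simp add: o_def scaleR_diff_left)
  ultimately show ?thesis by (simp add: has_vector_derivative_at_within)
qed

lemma integral_lborel_shift:
  fixes f :: "'a::euclidean_space \<Rightarrow> complex"
  assumes f: "integrable lborel f"
  shows "integrable lborel (\<lambda>x. f (x + a))" and "(\<integral>x. f (x + a) \<partial>lborel) = (\<integral>x. f x \<partial>lborel)"
proof -
  have [measurable]: "f \<in> borel_measurable borel" using f by auto
  have d: "distr lborel borel ((+) a) = lborel" by (rule lborel_distr_plus)
  have "integrable (distr lborel borel ((+) a)) f" using f d by simp
  then show "integrable lborel (\<lambda>x. f (x + a))"
    by (subst (asm) integrable_distr_eq) (auto simp: add.commute)
  have "(\<integral>x. f x \<partial>lborel) = (\<integral>x. f x \<partial>distr lborel borel ((+) a))" using d by simp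
  also have "\<dots> = (\<integral>x. f (x + a) \<partial>lborel)" by (subst integral_distr) (auto simp: add.commute)
  finally show "(\<integral>x. f (x + a) \<partial>lborel) = (\<integral>x. f x \<partial>lborel)" by simp
qed

text \<open>
  Averaging \<open>\<partial>\<^sub>k F\<close> over unit segments in direction \<open>k\<close> leaves its integral unchanged and turns it
  into that of \<open>F(x + e\<^sub>k) - F(x)\<close>, which vanishes by translation invariance.
\<close>

lemma integral_partial_zero:
  fixes F F' :: "real^'n::finite \<Rightarrow> complex"
  assumes der: "has_partial k F F'" and F: "integrable lborel F" and F': "integrable lborel F'"
    and cont: "continuous_on UNIV F'"
  shows "(\<integral>x. F' x \<partial>lborel) = 0"
proof -
  define e :: "real^'n" where "e = axis k 1"
  have [measurable]: "F' \<in> borel_measurable borel" using cont by (rule borel_measurable_continuous_onI)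
  \<comment> \<open>Fubini for this function: integrated over \<open>x\<close> it gives the integral of \<open>F'\<close>, integrated over \<open>t\<close> a difference of \<open>F\<close>.\<close>
  define g where "g t x = indicator {0..1} t *\<^sub>R F' (x + t *\<^sub>R e)" for t :: real and x
  have gm: "case_prod g \<in> borel_measurable (lborel \<Otimes>\<^sub>M lborel)"
    unfolding g_def case_prod_beta by measurable
  have gn: "(\<integral>x. norm (g t x) \<partial>lborel) = indicator {0..1} t * (\<integral>x. norm (F' x) \<partial>lborel)" for t
  proof -
    have "integrable lborel (\<lambda>x. complex_of_real (norm (F' x)))" using F' by (intro integrable_of_real integrable_norm)
    from integral_lborel_shift(2)[OF this, of "t *\<^sub>R e"]
    have "(\<integral>x. norm (F' (x + t *\<^sub>R e)) \<partial>lborel) = (\<integral>x. norm (F' x) \<partial>lborel)" by simp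
    then show ?thesis by (simp add: g_def)
  qed
  have gi: "integrable (lborel \<Otimes>\<^sub>M lborel) (case_prod g)"
  proof (rule lborel_pair.Fubini_integrable[OF gm])
    show "integrable lborel (\<lambda>t. \<integral>x. norm (case_prod g (t, x)) \<partial>lborel)"
      by (simp add: gn) 
    show "AE t in lborel. integrable lborel (\<lambda>x. case_prod g (t, x))"
      using integral_lborel_shift(1)[OF F'] by (simp add: g_def)
  qed
  have FTC: "(\<integral>t. g t x \<partial>lborel) = F (x + e) - F x" for x
  proof -
    have "has_bochner_integral lborel (\<lambda>t. indicator {0..1} t *\<^sub>R F' (x + t *\<^sub>R e)) (F (x + 1 *\<^sub>R e) - F (x + 0 *\<^sub>R e))"
    proof (rule has_bochner_integral_FTC_Icc)
      show "((\<lambda>t. F (x + t *\<^sub>R e)) has_vector_derivative F' (x + t *\<^sub>R e)) (at t within {0..1})" for t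
        unfolding e_def by (rule has_partial_line[OF der])
      show "continuous_on {0..1} (\<lambda>t. F' (x + t *\<^sub>R e))"
        by (intro continuous_on_compose2[OF cont]) (auto intro!: continuous_intros)
    qed simp
    then show ?thesis by (simp add: g_def has_bochner_integral_integral_eq)
  qed
  have "(\<integral>t. (\<integral>x. g t x \<partial>lborel) \<partial>lborel) = (\<integral>x. (\<integral>t. g t x \<partial>lborel) \<partial>lborel)"
    using lborel_pair.Fubini_integral[OF gi] by simp
  also have "\<dots> = 0"
    unfolding FTC using integral_lborel_shift[OF F, of e] F by (simp add: Bochner_Integration.integral_diff)
  also have "(\<integral>t. (\<integral>x. g t x \<partial>lborel) \<partial>lborel) = (\<integral>t. indicator {0..1::real} t *\<^sub>R (\<integral>x. F' x \<partial>lborel) \<partial>lborel)"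
    using integral_lborel_shift(2)[OF F'] by (simp add: g_def)
  also have "\<dots> = (\<integral>x. F' x \<partial>lborel)" by simp
  finally show ?thesis .
qed

lemma weighted_measure_0: "weighted_measure 0 = (lborel :: (real^'n::finite) measure)"
proof -
  have "density lborel (\<lambda>x::real^'n. ennreal (norm x powr (2 * 0))) = density lborel (\<lambda>x. 1)"
  proof (rule density_cong)
    have "AE x in (lborel :: (real^'n) measure). x \<noteq> 0" by (rule AE_lborel_singleton)
    then show "AE x in (lborel :: (real^'n) measure). ennreal (norm x powr (2 * 0)) = 1"
      by eventually_elim simp
  qed auto
  then show ?thesis by (simp add: weighted_measure_def density_1)
qed

lemma gauss_sq: "gauss x * gauss x = of_real (exp (- (norm x)\<^sup>2))"
  by (simp add: gauss_def flip: of_real_mult exp_add)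

lemma integrable_gauss2:
  fixes p :: "real^'n::finite \<Rightarrow> complex"
  assumes "p \<in> homogeneous_polys d"
  shows "integrable lborel (\<lambda>x. p x * (gauss x * gauss x))"
proof (rule weighted_gaussian_integral[OF assms], goal_cases)
  case (1 C)
  from 1(1)[of 0 1 1] show ?case
    by (simp add: weighted_measure_0 gauss_sq add_nonneg_pos)
qed

lemma has_partial_gauss2:
  fixes k :: "'n::finite"
  shows "has_partial k (\<lambda>x. gauss x * gauss x) (\<lambda>x. - 2 * of_real (x $ k) * (gauss x * gauss x))"
  by (rule has_partial_cong[OF has_partial_mult[OF has_partial_gauss has_partial_gauss]]) (simp add: algebra_simps)

lemma gauss_continuous: "continuous_on UNIV gauss"
  unfolding gauss_def by (intro continuous_intros) auto

text \<open>
  The integral of \<open>\<partial>\<^sub>k (\<partial>\<^sub>k p q e\<^bsup>-|x|\<^sup>2\<^esup>)\<close> vanishes. In the sum over \<open>k\<close> the second derivatives add up to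
  \<open>\<Delta>p = 0\<close>, and the derivatives of the Gaussian to \<open>-2 E p = -2 m p\<close>.
\<close>

lemma gaussian_Green:
  fixes p q :: "real^'n::finite \<Rightarrow> complex"
  assumes p: "p \<in> harmonic_polys m" and q: "q \<in> homogeneous_polys n"
  shows "2 * of_nat m * (\<integral>x. p x * q x * (gauss x * gauss x) \<partial>lborel)
     = (\<Sum>k\<in>UNIV. \<integral>x. partial k p x * partial k q x * (gauss x * gauss x) \<partial>lborel)"
proof -
  have p': "p \<in> homogeneous_polys m" using p by (simp add: harmonic_polys_def)
  note dp = homogeneous_partial[OF p'] and dq = homogeneous_partial[OF q]
  have p1: "partial k p \<in> homogeneous_polys (m - 1)" for k using dp by blast
  note dp1 = homogeneous_partial[OF p1]
  let ?g = "\<lambda>x :: real^'n. gauss x * gauss x"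
  define A where "A k x = partial k p x * partial k q x * ?g x" for k x
  define B where "B k x = partial k (partial k p) x * q x * ?g x" for k x
  define D where "D k x = of_real (x $ k) * (partial k p x * q x) * ?g x" for k x
  have A: "integrable lborel (A k)" for k
    unfolding A_def using dp dq by (intro integrable_gauss2[OF homogeneous_mult]) blast+
  have B: "integrable lborel (B k)" for k
    unfolding B_def using dp1 by (intro integrable_gauss2[OF homogeneous_mult[OF _ q]]) blast
  have D: "integrable lborel (D k)" for k
    unfolding D_def using dp by (intro integrable_gauss2[OF homogeneous_coordinate_mult[OF homogeneous_mult[OF _ q]]]) blast
  have zero: "(\<integral>x. A k x + B k x - 2 * D k x \<partial>lborel) = 0" for k
  proof (rule integral_partial_zero[of k "\<lambda>x. partial k p x * q x * ?g x"])
    show "has_partial k (\<lambda>x. partial k p x * q x * ?g x) (\<lambda>x. A k x + B k x - 2 * D k x)"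
    proof (rule has_partial_cong[OF has_partial_mult[OF has_partial_mult has_partial_gauss2]])
      show "has_partial k (partial k p) (partial k (partial k p))" "has_partial k q (partial k q)"
        using dp1 dq by blast+
    qed (simp add: A_def B_def D_def algebra_simps)
    show "integrable lborel (\<lambda>x. partial k p x * q x * ?g x)"
      by (intro integrable_gauss2[OF homogeneous_mult[OF p1 q]])
    show "integrable lborel (\<lambda>x. A k x + B k x - 2 * D k x)" using A B D by auto
    have "continuous_on UNIV p" "continuous_on UNIV q" "continuous_on UNIV (partial k p)"
      "continuous_on UNIV (partial k q)" "continuous_on UNIV (partial k (partial k p))"
      using dp dq dp1 p' q homogeneous_continuous by blast+
    then show "continuous_on UNIV (\<lambda>x. A k x + B k x - 2 * D k x)"
      unfolding A_def B_def D_def by (intro continuous_intros gauss_continuous)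
  qed
  have "(\<integral>x. D k x \<partial>lborel) * 2 = (\<integral>x. A k x \<partial>lborel) + (\<integral>x. B k x \<partial>lborel)" for k
    using zero[of k] A[of k] B[of k] D[of k] by (simp add: algebra_simps)
  then have "(\<Sum>k\<in>UNIV. \<integral>x. D k x \<partial>lborel) * 2 = (\<Sum>k\<in>UNIV. \<integral>x. A k x \<partial>lborel) + (\<Sum>k\<in>UNIV. \<integral>x. B k x \<partial>lborel)"
    by (simp add: sum_distrib_right sum.distrib)
  also have "(\<Sum>k\<in>UNIV. \<integral>x. B k x \<partial>lborel) = (\<integral>x. (\<Sum>k\<in>UNIV. B k x) \<partial>lborel)"
    using B by (subst Bochner_Integration.integral_sum) auto
  also have "(\<lambda>x. \<Sum>k\<in>UNIV. B k x) = (\<lambda>x. laplacian p x * q x * ?g x)"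
    by (simp add: B_def laplacian_def sum_distrib_right)
  also have "\<dots> = (\<lambda>x. 0)" using p by (simp add: harmonic_polys_def)
  also have "(\<Sum>k\<in>UNIV. \<integral>x. D k x \<partial>lborel) = (\<integral>x. (\<Sum>k\<in>UNIV. D k x) \<partial>lborel)"
    using D by (subst Bochner_Integration.integral_sum) auto
  also have "(\<lambda>x. \<Sum>k\<in>UNIV. D k x) = (\<lambda>x. of_nat m * (p x * q x * ?g x))"
  proof
    fix x
    have "(\<Sum>k\<in>UNIV. D k x) = euler p x * (q x * ?g x)"
      by (simp add: D_def euler_def sum_distrib_right mult.assoc)
    then show "(\<Sum>k\<in>UNIV. D k x) = of_nat m * (p x * q x * ?g x)"
      by (simp add: euler_homogeneous[OF p'] mult.assoc)
  qed
  finally show ?thesis by (simp add: A_def mult_ac)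
qed

text \<open>
  The right-hand side of Green's formula is symmetric in \<open>p\<close> and \<open>q\<close>.
\<close>

lemma harmonic_orthogonal:
  fixes p q :: "real^'n::finite \<Rightarrow> complex"
  assumes p: "p \<in> harmonic_polys m" and q: "q \<in> harmonic_polys n" and mn: "m \<noteq> n"
  shows "(\<integral>x. p x * q x * (gauss x * gauss x) \<partial>lborel) = 0"
proof -
  have "2 * of_nat m * (\<integral>x. p x * q x * (gauss x * gauss x) \<partial>lborel)
      = 2 * of_nat n * (\<integral>x. q x * p x * (gauss x * gauss x) \<partial>lborel)"
    using gaussian_Green[of p m q n] gaussian_Green[of q n p m] p q
    by (simp add: harmonic_polys_def mult.commute)
  then have "(2 * of_nat m - 2 * of_nat n) * (\<integral>x. p x * q x * (gauss x * gauss x) \<partial>lborel) = 0"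
    by (simp add: algebra_simps)
  then show ?thesis using mn by simp
qed

section \<open>Inner products of radial functions times harmonics\<close>

lemma radial_gauss_eq: "radial_gauss q x = gauss x * poly q (xsq x)"
  by (simp add: radial_gauss_def gauss_def xsq_def)

lemma radial_gauss_measurable [measurable]: "radial_gauss q \<in> borel_measurable borel"
  unfolding radial_gauss_eq by measurable

lemma radial_gauss_times_measurable:
  "p \<in> homogeneous_polys m \<Longrightarrow> (\<lambda>x. radial_gauss q x * p x) \<in> borel_measurable borel"
  using homogeneous_measurable[of p m] by measurable

lemma harmonic_homogeneous: "p \<in> harmonic_polys m \<Longrightarrow> p \<in> homogeneous_polys m"
  by (simp add: harmonic_polys_def)

lemma radial_gauss_product:
  "(radial_gauss q x * p x) * cnj (radial_gauss q' x * p' x)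
     = (p x * cnj (p' x)) * (of_real (exp (- (norm x)\<^sup>2)) * poly (q * map_poly cnj q') (xsq x))"
proof -
  have "cnj (poly q' (xsq x)) = poly (map_poly cnj q') (xsq x)"
    unfolding poly_cnj by (simp add: xsq_def)
  moreover have "cnj (gauss x) = gauss x" by (simp add: gauss_def)
  ultimately show ?thesis unfolding radial_gauss_eq gauss_sq[symmetric] by simp
qed

lemma radial_gauss_L2:
  fixes p :: "real^'n::finite \<Rightarrow> complex"
  assumes b: "b > - real CARD('n) / 2" and p: "p \<in> homogeneous_polys m"
  shows "(\<lambda>x. radial_gauss q x * p x) \<in> L2 (weighted_measure b)"
proof (rule weighted_gaussian_integral[OF homogeneous_mult[OF p homogeneous_cnj[OF p]]], goal_cases)
  case (1 C)
  let ?f = "\<lambda>x. radial_gauss q x * p x"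
  have "(real (m + m) + real CARD('n)) / 2 \<ge> real CARD('n) / 2" by simp
  then have "b + (real (m + m) + real CARD('n)) / 2 > 0" using b by linarith
  from 1(1)[OF this zero_less_one, of "q * map_poly cnj q"]
  have "integrable (weighted_measure b) (\<lambda>x. ?f x * cnj (?f x))"
    unfolding radial_gauss_product by simp
  then have "integrable (weighted_measure b) (\<lambda>x. Re (complex_of_real ((cmod (?f x))\<^sup>2)))"
    unfolding complex_norm_square by (rule integrable_Re)
  then show ?case using radial_gauss_times_measurable[OF p, of q] by (simp add: L2_def)
qed

lemma harmonic_cnj:
  assumes p: "p \<in> harmonic_polys m"
  shows "(\<lambda>x. cnj (p x)) \<in> harmonic_polys m"
proof -
  have "laplacian (\<lambda>x. cnj (p x)) x = cnj (laplacian p x)" for x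
  proof -
    have "has_partial k (\<lambda>x. cnj (f x)) (\<lambda>x. cnj (f' x))" if "has_partial k f f'" for k and f f' :: "real^'a \<Rightarrow> complex"
      using that unfolding has_partial_def
      by (auto intro!: bounded_linear.has_vector_derivative[OF bounded_linear_cnj])
    then have "has_partial2 (\<lambda>x. cnj (p x)) (\<lambda>k x. cnj (partial k p x)) (\<lambda>k x. cnj (partial k (partial k p) x))"
      using homogeneous_partial2[OF harmonic_homogeneous[OF p]] by (simp add: has_partial2_def)
    then show ?thesis by (subst laplacian_eq) (auto simp: laplacian_def)
  qed
  then show ?thesis using p homogeneous_cnj[OF harmonic_homogeneous[OF p]] by (simp add: harmonic_polys_def)
qed

text \<open>
  The angular constant of \<open>p\<close> and the conjugate of \<open>p'\<close>, times a radial integral. For different degrees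
  the constant is zero, as the case \<open>b = 0\<close> of two pure Gaussians shows.
\<close>

lemma inner_radial_gauss:
  fixes p p' :: "real^'n::finite \<Rightarrow> complex"
  assumes b: "b > - real CARD('n) / 2" and p: "p \<in> harmonic_polys m" and p': "p' \<in> harmonic_polys m'"
  obtains C where "\<And>q q'. inner_L2 (weighted_measure b) (\<lambda>x. radial_gauss q x * p x) (\<lambda>x. radial_gauss q' x * p' x)
     = (if m = m' then C * gamma_functional (b + lambda_Nm CARD('n) m + 1) (q * map_poly cnj q') else 0)"
proof (rule weighted_gaussian_integral[OF homogeneous_mult[OF harmonic_homogeneous[OF p] homogeneous_cnj[OF harmonic_homogeneous[OF p']]]], goal_cases)
  case (1 C)
  let ?k = "(real (m + m') + real CARD('n)) / 2"
  have "?k \<ge> real CARD('n) / 2" by simp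
  then have bk: "b + ?k > 0" using b by linarith
  have eq: "inner_L2 (weighted_measure b) (\<lambda>x. radial_gauss q x * p x) (\<lambda>x. radial_gauss q' x * p' x)
     = C * gamma_functional (b + ?k) (q * map_poly cnj q')" for q q'
    unfolding inner_L2_def radial_gauss_product by (rule 1(3)[OF bk])
  have C0: "C = 0" if "m \<noteq> m'"
  proof -
    have k0: "0 + ?k > 0" by (simp add: add_nonneg_pos)
    have "0 = C * gamma_functional (0 + ?k) 1"
      using 1(3)[OF k0, of 1] harmonic_orthogonal[OF p harmonic_cnj[OF p'] that] by (simp add: weighted_measure_0 gauss_sq)
    also have "\<dots> = C * of_real (Gamma ?k)"
      using gamma_functional_const[of ?k 1] k0 by (simp add: one_pCons)
    finally have "0 = C * of_real (Gamma ?k)" .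
    moreover have "Gamma ?k > 0" using k0 by (intro Gamma_real_pos) simp
    then have "Gamma ?k \<noteq> 0" by linarith
    ultimately show "C = 0" by (metis mult_eq_0_iff of_real_eq_0_iff)
  qed
  show thesis
  proof (rule 1(1)[of C])
    fix q q'
    show "inner_L2 (weighted_measure b) (\<lambda>x. radial_gauss q x * p x) (\<lambda>x. radial_gauss q' x * p' x)
      = (if m = m' then C * gamma_functional (b + lambda_Nm CARD('n) m + 1) (q * map_poly cnj q') else 0)"
    proof (cases "m = m'")
      case True
      then have k: "b + ?k = b + lambda_Nm CARD('n) m + 1" by (simp add: lambda_Nm_def field_simps)
      show ?thesis unfolding eq k using True by (simp only: if_True refl)
    next
      case False
      then show ?thesis unfolding eq using C0 by simp
    qed
  qed
qed

section \<open>The oscillator on radial functions times harmonics\<close>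

text \<open>
  The derivative of \<open>e\<^bsup>-t/2\<^esup> q(t)\<close> with respect to \<open>t\<close>, up to the factor \<open>e\<^bsup>-t/2\<^esup>\<close>.
\<close>

definition radial_derivative :: "complex poly \<Rightarrow> complex poly" where
  "radial_derivative q = pderiv q - smult (1/2) q"

lemma has_partial_radial_gauss:
  fixes k :: "'n::finite"
  shows "has_partial k (radial_gauss q) (\<lambda>x. 2 * of_real (x $ k) * radial_gauss (radial_derivative q) x)"
  unfolding radial_gauss_eq[abs_def]
  by (rule has_partial_cong[OF has_partial_mult[OF has_partial_gauss has_partial_poly]])
     (simp add: radial_derivative_def algebra_simps)

lemma has_partial2_radial_gauss:
  "has_partial2 (radial_gauss q :: real^'n::finite \<Rightarrow> complex)
     (\<lambda>k x. 2 * of_real (x $ k) * radial_gauss (radial_derivative q) x)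
     (\<lambda>k x. 2 * radial_gauss (radial_derivative q) x
        + 4 * (of_real (x $ k) * of_real (x $ k)) * radial_gauss (radial_derivative (radial_derivative q)) x)"
  unfolding has_partial2_def
proof (intro allI conjI)
  fix k :: 'n
  show "has_partial k (radial_gauss q) (\<lambda>x. 2 * of_real (x $ k) * radial_gauss (radial_derivative q) x)"
    by (rule has_partial_radial_gauss)
  have "has_partial k (\<lambda>x. 2 * of_real (x $ k)) (\<lambda>x. 2)"
    using has_partial_cmult[OF has_partial_coordinate, of k 2 k] by simp
  from has_partial_mult[OF this has_partial_radial_gauss[of k "radial_derivative q"]]
  show "has_partial k (\<lambda>x. 2 * of_real (x $ k) * radial_gauss (radial_derivative q) x)
     (\<lambda>x. 2 * radial_gauss (radial_derivative q) x
        + 4 * (of_real (x $ k) * of_real (x $ k)) * radial_gauss (radial_derivative (radial_derivative q)) x)"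
    by (rule has_partial_cong) (simp add: algebra_simps)
qed

lemma euler_radial_gauss: "euler (radial_gauss q) x = 2 * xsq x * radial_gauss (radial_derivative q) x"
proof -
  have "euler (radial_gauss q) x = (\<Sum>k\<in>UNIV. of_real (x $ k) * of_real (x $ k) * (2 * radial_gauss (radial_derivative q) x))"
    unfolding euler_def partial_eq[OF has_partial_radial_gauss] by (simp add: algebra_simps)
  then show ?thesis unfolding sum_distrib_right[symmetric] xsq_sum[symmetric] by simp
qed

text \<open>
  \<open>4 t G'' + 4 a G' - t G\<close> for \<open>G = e\<^bsup>-t/2\<^esup> q\<close>, up to the factor \<open>e\<^bsup>-t/2\<^esup>\<close>.
\<close>

definition oscillator_poly :: "real \<Rightarrow> complex poly \<Rightarrow> complex poly" where
  "oscillator_poly a q = smult 4 (laguerre_operator a q) - smult (2 * of_real a) q"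

lemma radial_gauss_add: "radial_gauss (p + q) x = radial_gauss p x + radial_gauss q x"
  by (simp add: radial_gauss_eq distrib_left)

lemma radial_gauss_smult: "radial_gauss (smult c p) x = c * radial_gauss p x"
  by (simp add: radial_gauss_eq)

text \<open>
  With \<open>G\<close> as a function of \<open>t = |x|\<^sup>2\<close>, \<open>\<Delta>G = 4 t G'' + 2 N G'\<close>, and \<open>2 \<nabla>G \<cdot> \<nabla>p = 4 m G' p\<close>. The term with
  \<open>\<R>\<close> is \<open>(2b/t) 2 t G' p = 4 b G' p\<close>: the singularity cancels, and the coefficients of \<open>G'\<close> add up to
  \<open>2N + 4m + 4b = 4a\<close>.
\<close>

lemma oscillator_radial_gauss:
  fixes p :: "real^'n::finite \<Rightarrow> complex"
  assumes p: "p \<in> harmonic_polys m" and x: "x \<noteq> 0"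
  shows "laplacian (\<lambda>x. radial_gauss q x * p x) x + of_real (2 * b / (norm x)\<^sup>2) * (euler (radial_gauss q) x * p x)
       - of_real ((norm x)\<^sup>2) * (radial_gauss q x * p x)
     = radial_gauss (oscillator_poly (b + lambda_Nm CARD('n) m + 1) q) x * p x"
proof -
  note p' = harmonic_homogeneous[OF p]
  let ?d = "radial_derivative q" and ?dd = "radial_derivative (radial_derivative q)"
  let ?N = "of_nat CARD('n) :: complex"
  have xs: "xsq x \<noteq> 0" using x by (simp add: xsq_def)
  have "laplacian (radial_gauss q) x = (\<Sum>k\<in>(UNIV :: 'n set). 2 * radial_gauss ?d x) + (\<Sum>k\<in>UNIV. of_real (x $ k) * of_real (x $ k) * (4 * radial_gauss ?dd x))"
    unfolding laplacian_eq[OF has_partial2_radial_gauss] by (simp add: sum.distrib algebra_simps)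
  then have lap: "laplacian (radial_gauss q) x = 2 * ?N * radial_gauss ?d x + 4 * xsq x * radial_gauss ?dd x"
    unfolding sum_distrib_right[symmetric] xsq_sum[symmetric] by simp
  have "(\<Sum>k\<in>UNIV. 2 * of_real (x $ k) * radial_gauss ?d x * partial k p x) = 2 * radial_gauss ?d x * euler p x"
    by (simp add: euler_def sum_distrib_left algebra_simps)
  then have L: "laplacian (\<lambda>x. radial_gauss q x * p x) x
      = (2 * ?N * radial_gauss ?d x + 4 * xsq x * radial_gauss ?dd x + 4 * of_nat m * radial_gauss ?d x) * p x"
    unfolding laplacian_mult[OF has_partial2_radial_gauss homogeneous_partial2[OF p']] lap
    using p by (simp add: euler_homogeneous[OF p'] harmonic_polys_def algebra_simps)
  have R: "of_real (2 * b / (norm x)\<^sup>2) * (euler (radial_gauss q) x * p x) = 4 * of_real b * radial_gauss ?d x * p x"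
    using x unfolding euler_radial_gauss by (simp add: xsq_def field_simps)
  have o: "radial_gauss (oscillator_poly a q) x
      = 4 * of_real a * radial_gauss ?d x + 4 * xsq x * radial_gauss ?dd x - xsq x * radial_gauss q x" for a
    unfolding radial_gauss_eq
    by (simp add: oscillator_poly_def laguerre_operator_def radial_derivative_def pderiv_diff pderiv_smult algebra_simps)
  have a: "4 * complex_of_real (b + lambda_Nm CARD('n) m + 1) = 2 * ?N + 4 * of_nat m + 4 * of_real b"
    by (simp add: lambda_Nm_def field_simps)
  show ?thesis
    unfolding L R o a by (simp add: xsq_def algebra_simps)
qed

lemma Phi_eq:
  fixes p :: "real^'n::finite \<Rightarrow> complex"
  shows "Phi b l m p = (\<lambda>x. radial_gauss (laguerre_poly (b + lambda_Nm CARD('n) m) l) x * p x)"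
  by (simp add: Phi_def radial_gauss_def poly_laguerre_poly del: of_real_power)

lemma Phi_L2:
  fixes p :: "real^'n::finite \<Rightarrow> complex"
  assumes "b > - real CARD('n) / 2" "p \<in> harmonic_polys m"
  shows "Phi b l m p \<in> L2 (weighted_measure b)"
  unfolding Phi_eq using assms by (intro radial_gauss_L2 harmonic_homogeneous)

definition oscillator_eigenvalue :: "real \<Rightarrow> nat \<Rightarrow> nat \<Rightarrow> nat \<Rightarrow> real" where
  "oscillator_eigenvalue b N l m = - (4 * real l + 2 * real m + real N + 2 * b)"

lemma lambda_gt:
  assumes "b > - real CARD('n::finite) / 2"
  shows "b + lambda_Nm CARD('n) m > -1"
  using assms by (simp add: lambda_Nm_def field_simps)

lemma oscillator_poly_laguerre:
  assumes "b > - real CARD('n::finite) / 2"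
  shows "oscillator_poly (b + lambda_Nm CARD('n) m + 1) (laguerre_poly (b + lambda_Nm CARD('n) m) l)
     = smult (of_real (oscillator_eigenvalue b CARD('n) l m)) (laguerre_poly (b + lambda_Nm CARD('n) m) l)"
proof -
  have "4 * (- of_nat l) - 2 * complex_of_real (b + lambda_Nm CARD('n) m + 1) = of_real (oscillator_eigenvalue b CARD('n) l m)"
    by (simp add: oscillator_eigenvalue_def lambda_Nm_def field_simps)
  then show ?thesis
    unfolding oscillator_poly_def laguerre_operator_laguerre_poly[OF lambda_gt[OF assms]]
    by (simp only: smult_smult smult_diff_left[symmetric])
qed

lemma cnj_laguerre_poly: "map_poly cnj (laguerre_poly \<nu> l) = laguerre_poly \<nu> l"
  by (intro poly_eqI) (simp add: coeff_map_poly coeff_laguerre_poly)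

lemma oscillator_poly_symmetric:
  assumes a: "a > 0"
  shows "gamma_functional a (oscillator_poly a q * r) = gamma_functional a (q * oscillator_poly a r)"
  using laguerre_operator_symmetric[OF a, of q r]
  by (simp add: oscillator_poly_def left_diff_distrib right_diff_distrib gamma_functional_diff[OF a] gamma_functional_smult)

lemma inner_oscillator_Phi:
  fixes p p' :: "real^'n::finite \<Rightarrow> complex"
  assumes b: "b > - real CARD('n) / 2" and p: "p \<in> harmonic_polys m" and p': "p' \<in> harmonic_polys m'"
  shows "inner_L2 (weighted_measure b) (\<lambda>x. radial_gauss (oscillator_poly (b + lambda_Nm CARD('n) m + 1) q) x * p x) (Phi b l m' p')
    = of_real (oscillator_eigenvalue b CARD('n) l m') * inner_L2 (weighted_measure b) (\<lambda>x. radial_gauss q x * p x) (Phi b l m' p')"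
proof (rule inner_radial_gauss[OF b p p'], goal_cases)
  case (1 C)
  have a: "b + lambda_Nm CARD('n) m + 1 > 0" using lambda_gt[OF b, of m] by simp
  show ?case
    unfolding Phi_eq 1 cnj_laguerre_poly
    using oscillator_poly_symmetric[OF a, of q] oscillator_poly_laguerre[OF b, of m l]
    by (auto simp: gamma_functional_smult)
qed

lemma AE_weighted_nonzero: "AE x in (weighted_measure b :: (real^'n::finite) measure). x \<noteq> 0"
proof -
  have "AE x in (lborel :: (real^'n) measure). x \<noteq> 0" by (rule AE_lborel_singleton)
  then show ?thesis unfolding weighted_measure_def
    by (subst AE_density) (auto elim: eventually_mono)
qed

text \<open>
  Eigenfunctions of a symmetric operator for different eigenvalues.
\<close>

lemma Phi_orthogonal:
  fixes p p' :: "real^'n::finite \<Rightarrow> complex"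
  assumes b: "b > - real CARD('n) / 2" and p: "p \<in> harmonic_polys m" and p': "p' \<in> harmonic_polys m'"
    and ne: "oscillator_eigenvalue b CARD('n) l m \<noteq> oscillator_eigenvalue b CARD('n) l' m'"
  shows "inner_L2 (weighted_measure b) (Phi b l m p) (Phi b l' m' p') = 0"
proof -
  have "of_real (oscillator_eigenvalue b CARD('n) l m) * inner_L2 (weighted_measure b) (Phi b l m p) (Phi b l' m' p')
      = of_real (oscillator_eigenvalue b CARD('n) l' m') * inner_L2 (weighted_measure b) (Phi b l m p) (Phi b l' m' p')"
    using inner_oscillator_Phi[OF b p p', of "laguerre_poly (b + lambda_Nm CARD('n) m) l" l']
    unfolding oscillator_poly_laguerre[OF b] radial_gauss_smult Phi_eq[of b l m p, symmetric] mult.assoc inner_L2_mult_left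
    by (simp add: Phi_eq[of b l m p])
  then show ?thesis using ne by simp
qed

section \<open>The graph of the oscillator\<close>

definition oscillator :: "real \<Rightarrow> (real^'n::finite \<Rightarrow> complex) \<Rightarrow> (real^'n \<Rightarrow> complex) \<Rightarrow> real^'n \<Rightarrow> complex" where
  "oscillator b u v = (\<lambda>x. laplacian u x + of_real (2 * b / (norm x)\<^sup>2) * v x - of_real ((norm x)\<^sup>2) * u x)"

lemma oscillator_graph_alt:
  "(oscillator_graph b :: (real^'n::finite) op_graph) = 
    {(u, oscillator b u v) |u v. u \<in> W_alg b \<and> (u, v) \<in> R_graph}"
proof (intro equalityI subsetI)
  fix w :: "(real^'n \<Rightarrow> complex) \<times> (real^'n \<Rightarrow> complex)"
  assume "w \<in> oscillator_graph b"
  then obtain u h where w: "w = (u, \<lambda>x. h x - of_real ((norm x)\<^sup>2) * u x)" "(u, h) \<in> H_graph b"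
    unfolding oscillator_graph_def by blast
  then obtain v where "h = (\<lambda>x. laplacian u x + of_real (2 * b / (norm x)\<^sup>2) * v x)" "u \<in> W_alg b" "(u, v) \<in> R_graph"
    unfolding H_graph_def by blast
  then show "w \<in> {(u, oscillator b u v) |u v. u \<in> W_alg b \<and> (u, v) \<in> R_graph}"
    unfolding w(1) oscillator_def by blast
next
  fix w :: "(real^'n \<Rightarrow> complex) \<times> (real^'n \<Rightarrow> complex)"
  assume "w \<in> {(u, oscillator b u v) |u v. u \<in> W_alg b \<and> (u, v) \<in> R_graph}"
  then obtain u v where w: "w = (u, oscillator b u v)" "u \<in> W_alg b" "(u, v) \<in> R_graph" by blast
  then have "(u, \<lambda>x. laplacian u x + of_real (2 * b / (norm x)\<^sup>2) * v x) \<in> H_graph b"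
    unfolding H_graph_def by blast
  then show "w \<in> oscillator_graph b"
    unfolding oscillator_graph_def w(1) oscillator_def mem_Collect_eq
    by (intro exI[of _ u] exI[of _ "\<lambda>x. laplacian u x + of_real (2 * b / (norm x)\<^sup>2) * v x"] conjI refl)
qed

lemma module_fun: "module (\<lambda>c (u :: 'a \<Rightarrow> complex) x. c * u x)"
  by unfold_locales (auto simp: fun_eq_iff algebra_simps)

lemma module_fun_pair: "module (\<lambda>c (u :: 'a \<Rightarrow> complex, v :: 'a \<Rightarrow> complex). (\<lambda>x. c * u x, \<lambda>x. c * v x))"
  by unfold_locales (auto simp: fun_eq_iff algebra_simps)

lemma W_alg_add: "u \<in> W_alg b \<Longrightarrow> v \<in> W_alg b \<Longrightarrow> (\<lambda>x. u x + v x) \<in> W_alg b"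
  unfolding W_alg_def using module.span_add[OF module_fun, of u _ v] by (simp add: plus_fun_def)

lemma W_alg_scale: "u \<in> W_alg b \<Longrightarrow> (\<lambda>x. c * u x) \<in> W_alg b"
  unfolding W_alg_def using module.span_scale[OF module_fun] by blast

lemma Phi_W_alg: "p \<in> harmonic_polys m \<Longrightarrow> Phi b l m p \<in> W_alg b"
  unfolding W_alg_def by (intro module.span_base[OF module_fun]) blast

lemma R_graph_add: "(u, v) \<in> R_graph \<Longrightarrow> (u', v') \<in> R_graph \<Longrightarrow> (\<lambda>x. u x + u' x, \<lambda>x. v x + v' x) \<in> R_graph"
  unfolding R_graph_def using module.span_add[OF module_fun_pair, of "(u, v)" _ "(u', v')"] by (simp add: plus_fun_def)

lemma R_graph_scale: "(u, v) \<in> R_graph \<Longrightarrow> (\<lambda>x. c * u x, \<lambda>x. c * v x) \<in> R_graph"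
  unfolding R_graph_def using module.span_scale[OF module_fun_pair, of "(u, v)" _ c] by simp

lemma R_graph_base: "p \<in> harmonic_polys m \<Longrightarrow> (\<lambda>x. radial_gauss q x * p x, \<lambda>x. euler (radial_gauss q) x * p x) \<in> R_graph"
  unfolding R_graph_def by (intro module.span_base[OF module_fun_pair]) blast

lemma R_graph_induct [consumes 1, case_names base zero add scale]:
  assumes uv: "(u, v) \<in> R_graph"
    and base: "\<And>q p m. p \<in> harmonic_polys m \<Longrightarrow> P (\<lambda>x. radial_gauss q x * p x) (\<lambda>x. euler (radial_gauss q) x * p x)"
    and zero: "P (\<lambda>x. 0) (\<lambda>x. 0)"
    and add: "\<And>u v u' v'. P u v \<Longrightarrow> P u' v' \<Longrightarrow> P (\<lambda>x. u x + u' x) (\<lambda>x. v x + v' x)"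
    and scale: "\<And>c u v. P u v \<Longrightarrow> P (\<lambda>x. c * u x) (\<lambda>x. c * v x)"
  shows "P u v"
proof -
  have "case (u, v) of (u, v) \<Rightarrow> P u v"
    using uv unfolding R_graph_def
  proof (rule module.span_induct[OF module_fun_pair])
    show "module.subspace (\<lambda>c (u, v). (\<lambda>x. c * u x, \<lambda>x. c * v x)) {x. case x of (u, v) \<Rightarrow> P u v}"
      unfolding module.subspace_def[OF module_fun_pair]
      using zero add scale by (auto simp: zero_prod_def zero_fun_def plus_fun_def)
  qed (use base in auto)
  then show ?thesis by simp
qed

lemma oscillator_add:
  assumes "has_partial2 u u1 u2" "has_partial2 w w1 w2"
  shows "oscillator b (\<lambda>x. u x + w x) (\<lambda>x. v x + z x) = (\<lambda>x. oscillator b u v x + oscillator b w z x)"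
  unfolding oscillator_def using laplacian_add[OF assms] by (simp add: fun_eq_iff algebra_simps add_divide_distrib)

lemma oscillator_scale:
  assumes "has_partial2 u u1 u2"
  shows "oscillator b (\<lambda>x. c * u x) (\<lambda>x. c * v x) = (\<lambda>x. c * oscillator b u v x)"
  unfolding oscillator_def using laplacian_cmult[OF assms] by (simp add: fun_eq_iff algebra_simps)

text \<open>
  An element of the span may have several representations by generators, so that \<open>\<R> u\<close> is not a
  priori determined by \<open>u\<close>. The symmetry against the \<open>\<Phi>\<close> is therefore proved for pairs \<open>(u, v)\<close>: it
  passes from generators to linear combinations, and as the \<open>\<Phi>\<close> are complete it
  determines \<open>oscillator b u v\<close> almost everywhere.
\<close>

lemma R_graph_oscillator:
  fixes u v :: "real^'n::finite \<Rightarrow> complex"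
  assumes uv: "(u, v) \<in> R_graph" and b: "b > - real CARD('n) / 2"
  shows "(\<exists>u1 u2. has_partial2 u u1 u2) \<and> u \<in> L2 (weighted_measure b) \<and> oscillator b u v \<in> L2 (weighted_measure b) \<and>
    (\<forall>l m p. p \<in> harmonic_polys m \<longrightarrow> inner_L2 (weighted_measure b) (oscillator b u v) (Phi b l m p)
       = of_real (oscillator_eigenvalue b CARD('n) l m) * inner_L2 (weighted_measure b) u (Phi b l m p))"
  using uv
proof (induction rule: R_graph_induct)
  case (base q p m)
  let ?u = "\<lambda>x. radial_gauss q x * p x"
  let ?o = "oscillator b ?u (\<lambda>x. euler (radial_gauss q) x * p x)"
  let ?w = "\<lambda>x. radial_gauss (oscillator_poly (b + lambda_Nm CARD('n) m + 1) q) x * p x"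
  have p: "p \<in> homogeneous_polys m" using base by (rule harmonic_homogeneous)
  have ow: "?o x = ?w x" if "x \<noteq> 0" for x
    unfolding oscillator_def using that by (rule oscillator_radial_gauss[OF base])
  have "?o = (\<lambda>x. if x = 0 then ?o 0 else ?w x)" using ow by (auto simp: fun_eq_iff)
  moreover have "(\<lambda>x. if x = 0 then ?o 0 else ?w x) \<in> borel_measurable borel"
    using radial_gauss_times_measurable[OF p] by (intro measurable_If) auto
  ultimately have om: "?o \<in> borel_measurable borel" by metis
  have ae: "AE x in weighted_measure b. ?w x = ?o x"
    using AE_weighted_nonzero by eventually_elim (simp add: ow)
  have w: "?w \<in> L2 (weighted_measure b)" by (rule radial_gauss_L2[OF b p])
  have u: "?u \<in> L2 (weighted_measure b)" by (rule radial_gauss_L2[OF b p])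
  have o: "?o \<in> L2 (weighted_measure b)"
    using w ae by (rule L2_cong_AE) (use om in \<open>simp add: measurable_cong_sets[OF sets_weighted_measure refl]\<close>)
  show ?case
  proof (intro conjI allI impI u o)
    show "\<exists>u1 u2. has_partial2 ?u u1 u2"
      using has_partial2_mult[OF has_partial2_radial_gauss homogeneous_partial2[OF p]] by blast
    fix l m' and p' :: "real^'n \<Rightarrow> complex" assume p': "p' \<in> harmonic_polys m'"
    have "inner_L2 (weighted_measure b) ?o (Phi b l m' p') = inner_L2 (weighted_measure b) ?w (Phi b l m' p')"
      using ae o w Phi_L2[OF b p'] by (intro inner_L2_cong_AE) auto
    then show "inner_L2 (weighted_measure b) ?o (Phi b l m' p')
       = of_real (oscillator_eigenvalue b CARD('n) l m') * inner_L2 (weighted_measure b) ?u (Phi b l m' p')"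
      using inner_oscillator_Phi[OF b base p'] by simp
  qed
next
  case zero
  have h: "has_partial2 (\<lambda>x :: real^'n. 0) (\<lambda>k x. 0) (\<lambda>k x. 0)" by (simp add: has_partial2_def has_partial_const)
  have "oscillator b (\<lambda>x :: real^'n. 0) (\<lambda>x. 0) = (\<lambda>x. 0)" by (simp add: oscillator_def laplacian_eq[OF h])
  then show ?case using h L2_zero by auto
next
  case (add u v u' v')
  then obtain u1 u2 w1 w2 where h: "has_partial2 u u1 u2" "has_partial2 u' w1 w2" by blast
  show ?case unfolding oscillator_add[OF h]
    using add has_partial2_add[OF h] Phi_L2[OF b]
    by (auto simp: inner_L2_add_left algebra_simps intro: L2_add)
next
  case (scale c u v)
  then obtain u1 u2 where h: "has_partial2 u u1 u2" by blast
  show ?case unfolding oscillator_scale[OF h]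
    using scale has_partial2_cmult[OF h] Phi_L2[OF b]
    by (auto simp: inner_L2_mult_left intro: L2_mult_left)
qed

text \<open>
  The equation is asked off the origin only, because \<open>2b/|x|\<^sup>2\<close> has the default value \<open>0\<close> at the
  origin.
\<close>

definition oscillator_eigenspace :: "real \<Rightarrow> real \<Rightarrow> (real^'n::finite \<Rightarrow> complex) set" where
  "oscillator_eigenspace b \<mu> = {u. \<exists>h. (u, h) \<in> oscillator_graph b \<and> (\<forall>x. x \<noteq> 0 \<longrightarrow> h x = of_real \<mu> * u x)}"

lemma oscillator_graph_add:
  fixes u h :: "real^'n::finite \<Rightarrow> complex"
  assumes b: "b > - real CARD('n) / 2" and uh: "(u, h) \<in> oscillator_graph b" "(u', h') \<in> oscillator_graph b"
  shows "(\<lambda>x. u x + u' x, \<lambda>x. h x + h' x) \<in> oscillator_graph b"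
proof -
  from uh obtain v v' where v: "h = oscillator b u v" "u \<in> W_alg b" "(u, v) \<in> R_graph"
    and v': "h' = oscillator b u' v'" "u' \<in> W_alg b" "(u', v') \<in> R_graph"
    unfolding oscillator_graph_alt by blast
  obtain u1 u2 w1 w2 where "has_partial2 u u1 u2" "has_partial2 u' w1 w2"
    using R_graph_oscillator[OF v(3) b] R_graph_oscillator[OF v'(3) b] by blast
  from oscillator_add[OF this, of b v v'] show ?thesis
    using W_alg_add[OF v(2) v'(2)] R_graph_add[OF v(3) v'(3)] unfolding v(1) v'(1) oscillator_graph_alt by force
qed

lemma oscillator_graph_scale:
  fixes u h :: "real^'n::finite \<Rightarrow> complex"
  assumes b: "b > - real CARD('n) / 2" and uh: "(u, h) \<in> oscillator_graph b"
  shows "(\<lambda>x. c * u x, \<lambda>x. c * h x) \<in> oscillator_graph b"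
proof -
  from uh obtain v where v: "h = oscillator b u v" "u \<in> W_alg b" "(u, v) \<in> R_graph"
    unfolding oscillator_graph_alt by blast
  obtain u1 u2 where "has_partial2 u u1 u2"
    using R_graph_oscillator[OF v(3) b] by blast
  from oscillator_scale[OF this, of b c v] show ?thesis
    using W_alg_scale[OF v(2)] R_graph_scale[OF v(3)] unfolding v(1) oscillator_graph_alt by force
qed

lemma Phi_oscillator_eigenspace:
  fixes p :: "real^'n::finite \<Rightarrow> complex"
  assumes b: "b > - real CARD('n) / 2" and p: "p \<in> harmonic_polys m"
  shows "Phi b l m p \<in> oscillator_eigenspace b (oscillator_eigenvalue b CARD('n) l m)"
proof -
  let ?q = "laguerre_poly (b + lambda_Nm CARD('n) m) l"
  let ?v = "\<lambda>x. euler (radial_gauss ?q) x * p x"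
  have "(Phi b l m p, oscillator b (Phi b l m p) ?v) \<in> oscillator_graph b"
    using Phi_W_alg[OF p, of b l] R_graph_base[OF p, of ?q] unfolding oscillator_graph_alt Phi_eq by blast
  moreover have "oscillator b (Phi b l m p) ?v x = of_real (oscillator_eigenvalue b CARD('n) l m) * Phi b l m p x" if "x \<noteq> 0" for x
    unfolding Phi_eq oscillator_def oscillator_radial_gauss[OF p that] oscillator_poly_laguerre[OF b]
    by (simp add: radial_gauss_smult)
  ultimately show ?thesis unfolding oscillator_eigenspace_def by blast
qed

lemma fun_subspace_oscillator_eigenspace:
  assumes b: "b > - real CARD('n::finite) / 2"
  shows "fun_subspace (oscillator_eigenspace b \<mu> :: (real^'n \<Rightarrow> complex) set)"
proof -
  have "(\<lambda>x::real^'n. 0) \<in> harmonic_polys 0"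
    using fun_subspace_homogeneous[of 0, where 'a = 'n]
    by (simp add: harmonic_polys_def fun_subspace_def laplacian_def partial_eq[OF has_partial_const])
  from Phi_oscillator_eigenspace[OF b this, of 0]
  obtain h :: "real^'n \<Rightarrow> complex" where h: "((\<lambda>x. 0), h) \<in> oscillator_graph b" "\<And>x. x \<noteq> 0 \<Longrightarrow> h x = 0"
    unfolding oscillator_eigenspace_def by (auto simp: Phi_def)
  show ?thesis
    unfolding fun_subspace_def
  proof (intro conjI ballI allI)
    show "(\<lambda>x. 0) \<in> (oscillator_eigenspace b \<mu> :: (real^'n \<Rightarrow> complex) set)"
      using h unfolding oscillator_eigenspace_def by auto
  next
    fix f g :: "real^'n \<Rightarrow> complex" assume "f \<in> oscillator_eigenspace b \<mu>" "g \<in> oscillator_eigenspace b \<mu>"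
    then obtain h k where "(f, h) \<in> oscillator_graph b" "\<forall>x. x \<noteq> 0 \<longrightarrow> h x = of_real \<mu> * f x"
      "(g, k) \<in> oscillator_graph b" "\<forall>x. x \<noteq> 0 \<longrightarrow> k x = of_real \<mu> * g x"
      unfolding oscillator_eigenspace_def by blast
    then show "(\<lambda>x. f x + g x) \<in> oscillator_eigenspace b \<mu>"
      unfolding oscillator_eigenspace_def using oscillator_graph_add[OF b, of f h g k]
      by (auto intro!: exI[of _ "\<lambda>x. h x + k x"] simp: distrib_left)
  next
    fix c and f :: "real^'n \<Rightarrow> complex" assume "f \<in> oscillator_eigenspace b \<mu>"
    then obtain h where "(f, h) \<in> oscillator_graph b" "\<forall>x. x \<noteq> 0 \<longrightarrow> h x = of_real \<mu> * f x"
      unfolding oscillator_eigenspace_def by blast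
    then show "(\<lambda>x. c * f x) \<in> oscillator_eigenspace b \<mu>"
      unfolding oscillator_eigenspace_def using oscillator_graph_scale[OF b, of f h c]
      by (auto intro!: exI[of _ "\<lambda>x. c * h x"])
  qed
qed

section \<open>Completeness\<close>

definition gaussian :: "real \<Rightarrow> real^'n::finite \<Rightarrow> complex" where
  "gaussian s x = of_real (exp (- (s * (norm x)\<^sup>2)))"

lemma gaussian_mult: "gaussian s x * gaussian t x = gaussian (s + t) x"
  by (simp add: gaussian_def distrib_right flip: of_real_mult exp_add)

lemma gaussian_measurable [measurable]: "gaussian s \<in> borel_measurable borel"
  unfolding gaussian_def by measurable

lemma gauss_eq_gaussian: "gauss x = gaussian (1/2) x"
  by (simp add: gauss_def gaussian_def)

lemma gaussian_L2:
  fixes p :: "real^'n::finite \<Rightarrow> complex"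
  assumes b: "b > - real CARD('n) / 2" and p: "p \<in> homogeneous_polys m" and s: "s > 0"
  shows "(\<lambda>x. gaussian s x * p x) \<in> L2 (weighted_measure b)"
proof (rule weighted_gaussian_integral[OF homogeneous_mult[OF p homogeneous_cnj[OF p]]], goal_cases)
  case (1 C)
  let ?f = "\<lambda>x. gaussian s x * p x"
  note [measurable] = homogeneous_measurable[OF p]
  have "(real (m + m) + real CARD('n)) / 2 \<ge> real CARD('n) / 2" by simp
  then have "b + (real (m + m) + real CARD('n)) / 2 > 0" using b by linarith
  from 1(1)[OF this, of "s + s" 1] s
  have i: "integrable (weighted_measure b) (\<lambda>x. p x * cnj (p x) * gaussian (s + s) x)"
    by (simp add: gaussian_def)
  have "p x * cnj (p x) * gaussian (s + s) x = ?f x * cnj (?f x)" for x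
    unfolding gaussian_mult[symmetric] by (simp add: gaussian_def)
  with i have "integrable (weighted_measure b) (\<lambda>x. ?f x * cnj (?f x))" by (simp only:)
  then have "integrable (weighted_measure b) (\<lambda>x. Re (complex_of_real ((cmod (?f x))\<^sup>2)))"
    unfolding complex_norm_square by (rule integrable_Re)
  then show ?case by (simp add: L2_def)
qed

lemma L2_mult_integrable: "f \<in> L2 M \<Longrightarrow> g \<in> L2 M \<Longrightarrow> integrable M (\<lambda>x. f x * g x)"
  using L2_product_integrable[of f M "\<lambda>x. cnj (g x)"] L2_cnj[of g M] by simp

text \<open>
  Induction on the degree: a monomial is its harmonic projection plus \<open>|x|\<^sup>2 r\<close>. Against the first
  part, all radial factors \<open>q\<close> are spanned by Laguerre polynomials; in the second, \<open>|x|\<^sup>2\<close> is absorbed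
  into \<open>q\<close> and \<open>r\<close> has smaller degree.
\<close>

lemma orthogonal_radial_gauss:
  fixes f :: "real^'n::finite \<Rightarrow> complex"
  assumes b: "b > - real CARD('n) / 2" and f: "f \<in> L2 (weighted_measure b)"
    and orth: "\<And>l \<alpha>. inner_L2 (weighted_measure b) f
       (Phi b l (\<Sum>i\<in>UNIV. \<alpha> i) (harmonic_projection (\<Sum>i\<in>UNIV. \<alpha> i) (monomial \<alpha>))) = 0"
  shows "p \<in> homogeneous_polys m \<Longrightarrow> inner_L2 (weighted_measure b) f (\<lambda>x. radial_gauss q x * p x) = 0"
proof (induction m arbitrary: p q rule: less_induct)
  case (less m)
  let ?M = "weighted_measure b :: (real^'n) measure"
  let ?S = "{p \<in> homogeneous_polys m. \<forall>q. inner_L2 ?M f (\<lambda>x. radial_gauss q x * p x) = 0}"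
  have "p \<in> ?S"
  proof (rule homogeneous_poly_in_subspace[OF less.prems])
    have eq: "radial_gauss q x * (g x + h x) = radial_gauss q x * g x + radial_gauss q x * h x"
      "radial_gauss q x * (c * g x) = c * (radial_gauss q x * g x)" for q c x and g h :: "real^'n \<Rightarrow> complex"
      by (auto simp: algebra_simps)
    have L: "(\<lambda>x. radial_gauss q x * p x) \<in> L2 ?M" if "p \<in> homogeneous_polys m" for q and p :: "real^'n \<Rightarrow> complex"
      using that by (rule radial_gauss_L2[OF b])
    show "fun_subspace ?S"
      using fun_subspace_homogeneous[of m, where 'a = 'n]
      unfolding fun_subspace_def mem_Collect_eq eq
      by (auto simp: inner_L2_add_right inner_L2_mult_right f L)
  next
    fix \<alpha> :: "'n \<Rightarrow> nat" assume \<alpha>: "(\<Sum>i\<in>UNIV. \<alpha> i) = m"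
    have mono: "monomial \<alpha> \<in> homogeneous_polys m" using monomial_homogeneous[of \<alpha>] \<alpha> by simp
    define h where "h = harmonic_projection m (monomial \<alpha>)"
    have h: "h \<in> harmonic_polys m" unfolding h_def by (rule harmonic_projection_harmonic[OF mono])
    have ortho_h: "inner_L2 ?M f (\<lambda>x. radial_gauss q x * h x) = 0" for q
    proof (rule laguerre_poly_span[OF lambda_gt[OF b, of m]])
      show "inner_L2 ?M f (\<lambda>x. radial_gauss (laguerre_poly (b + lambda_Nm CARD('n) m) l) x * h x) = 0" for l
        using orth[where \<alpha> = \<alpha> and l = l] unfolding \<alpha> Phi_eq h_def .
    next
      fix p q assume "inner_L2 ?M f (\<lambda>x. radial_gauss p x * h x) = 0" "inner_L2 ?M f (\<lambda>x. radial_gauss q x * h x) = 0"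
      then show "inner_L2 ?M f (\<lambda>x. radial_gauss (p + q) x * h x) = 0"
        using radial_gauss_L2[OF b harmonic_homogeneous[OF h]] f
        by (simp add: radial_gauss_add distrib_right inner_L2_add_right)
    next
      fix c p assume "inner_L2 ?M f (\<lambda>x. radial_gauss p x * h x) = 0"
      then show "inner_L2 ?M f (\<lambda>x. radial_gauss (smult c p) x * h x) = 0"
        by (simp add: radial_gauss_smult mult.assoc inner_L2_mult_right)
    qed
    show "monomial \<alpha> \<in> ?S"
    proof (intro CollectI conjI mono allI)
      fix q
      from harmonic_projection_decomposition[OF mono, folded h_def]
      obtain r where "(\<forall>x. monomial \<alpha> x = h x + xsq x * r x) \<and>
        (m \<ge> 2 \<longrightarrow> r \<in> homogeneous_polys (m - 2)) \<and> (m < 2 \<longrightarrow> r = (\<lambda>x. 0))" ..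
      then have r: "\<And>x. monomial \<alpha> x = h x + xsq x * r x"
        "m \<ge> 2 \<Longrightarrow> r \<in> homogeneous_polys (m - 2)" "m < 2 \<Longrightarrow> r = (\<lambda>x. 0)"
        by blast+
      have eq: "radial_gauss q x * monomial \<alpha> x = radial_gauss q x * h x + radial_gauss (pCons 0 q) x * r x" for x
        unfolding r(1)[of x] by (simp add: radial_gauss_eq distrib_left mult_ac)
      have hL: "(\<lambda>x. radial_gauss q x * h x) \<in> L2 ?M" by (rule radial_gauss_L2[OF b harmonic_homogeneous[OF h]])
      show "inner_L2 ?M f (\<lambda>x. radial_gauss q x * monomial \<alpha> x) = 0"
      proof (cases "m \<ge> 2")
        case True
        then have "inner_L2 ?M f (\<lambda>x. radial_gauss (pCons 0 q) x * r x) = 0" using r(2) by (intro less.IH) auto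
        moreover have "(\<lambda>x. radial_gauss (pCons 0 q) x * r x) \<in> L2 ?M" using r(2)[OF True] by (rule radial_gauss_L2[OF b])
        ultimately show ?thesis unfolding eq using ortho_h[of q] f hL by (simp add: inner_L2_add_right)
      next
        case False
        then show ?thesis unfolding eq using r(3) ortho_h[of q] by simp
      qed
    qed
  qed
  then show ?case by simp
qed

text \<open>
  Integrate the power series of \<open>e\<^bsup>-|x|\<^sup>2/4\<^esup>\<close> term by term. Its partial sums are bounded by \<open>e\<^bsup>|x|\<^sup>2/4\<^esup>\<close>,
  which the Gaussian factor already present, of exponent \<open>s \<ge> 1/2\<close>, makes integrable.
\<close>

lemma gaussian_moment_step:
  fixes f :: "real^'n::finite \<Rightarrow> complex"
  assumes b: "b > - real CARD('n) / 2" and f: "f \<in> L2 (weighted_measure b)" and s: "s \<ge> 1/2"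
    and zero: "\<And>m p. p \<in> homogeneous_polys m \<Longrightarrow> (\<integral>x. f x * (gaussian s x * p x) \<partial>weighted_measure b) = 0"
    and p: "p \<in> homogeneous_polys m"
  shows "(\<integral>x. f x * (gaussian (s + 1/4) x * p x) \<partial>weighted_measure b) = 0"
proof -
  let ?M = "weighted_measure b :: (real^'n) measure"
  note [measurable] = homogeneous_measurable[OF p]
  have fm[measurable]: "f \<in> borel_measurable borel" using L2_measurable[OF f] by (simp add: measurable_cong_sets[OF sets_weighted_measure refl])
  define T where "T n x = (\<Sum>k<n. of_real ((-1/4) ^ k / fact k) * xsq x ^ k)" for n and x :: "real^'n"
  have [measurable]: "T n \<in> borel_measurable borel" for n unfolding T_def by measurable
  have eqT: "f x * (gaussian s x * p x) * T n x = (\<Sum>k<n. of_real ((-1/4) ^ k / fact k) * (f x * (gaussian s x * (xsq x ^ k * p x))))" for n x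
    unfolding T_def by (simp add: sum_distrib_left algebra_simps)
  have Tz: "(\<integral>x. f x * (gaussian s x * p x) * T n x \<partial>?M) = 0" for n
  proof -
    have hp: "(\<lambda>x. xsq x ^ k * p x) \<in> homogeneous_polys (m + 2 * k)" for k by (rule homogeneous_xsq_power_mult[OF p])
    have i: "integrable ?M (\<lambda>x. f x * (gaussian s x * (xsq x ^ k * p x)))" for k
      using f gaussian_L2[OF b hp] s by (intro L2_mult_integrable) auto
    have "(\<integral>x. f x * (gaussian s x * p x) * T n x \<partial>?M) = (\<Sum>k<n. of_real ((-1/4) ^ k / fact k) * (\<integral>x. f x * (gaussian s x * (xsq x ^ k * p x)) \<partial>?M))"
      unfolding eqT using i by (subst Bochner_Integration.integral_sum) auto
    then show ?thesis using zero[OF hp] by simp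
  qed
  have lim: "(\<lambda>n. f x * (gaussian s x * p x) * T n x) \<longlonglongrightarrow> f x * (gaussian (s + 1/4) x * p x)" for x
  proof -
    have "(\<lambda>k. ((- (norm x)\<^sup>2 / 4) ^ k /\<^sub>R fact k)) sums exp (- (norm x)\<^sup>2 / 4)" by (rule exp_converges)
    then have "(\<lambda>k. complex_of_real ((- (norm x)\<^sup>2 / 4) ^ k /\<^sub>R fact k)) sums of_real (exp (- (norm x)\<^sup>2 / 4))"
      by (rule sums_of_real)
    moreover have "complex_of_real ((- (norm x)\<^sup>2 / 4) ^ k /\<^sub>R fact k) = of_real ((-1/4) ^ k / fact k) * xsq x ^ k" for k
    proof -
      have "- (norm x)\<^sup>2 / 4 = (-1/4) * (norm x)\<^sup>2" by simp
      then have "(- (norm x)\<^sup>2 / 4) ^ k = (-1/4) ^ k * ((norm x)\<^sup>2) ^ k"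
        using power_mult_distrib[of "-1/4" "(norm x)\<^sup>2" k] by metis
      then have "(- (norm x)\<^sup>2 / 4) ^ k /\<^sub>R fact k = ((-1/4) ^ k / fact k) * ((norm x)\<^sup>2) ^ k"
        by (simp only: real_scaleR_def divide_inverse mult_ac)
      then show ?thesis by (simp only: xsq_def of_real_mult of_real_power)
    qed
    moreover have "complex_of_real (exp (- (norm x)\<^sup>2 / 4)) = gaussian (1/4) x" by (simp add: gaussian_def)
    ultimately have "(\<lambda>n. T n x) \<longlonglongrightarrow> gaussian (1/4) x" by (simp add: T_def sums_def)
    then have "(\<lambda>n. f x * (gaussian s x * p x) * T n x) \<longlonglongrightarrow> f x * (gaussian s x * p x) * gaussian (1/4) x"
      by (intro tendsto_intros)
    then show ?thesis unfolding gaussian_mult[symmetric] by (simp add: mult_ac)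
  qed
  have T_bound: "cmod (T n x) \<le> exp ((norm x)\<^sup>2 / 4)" for n x
  proof -
    have "cmod (T n x) \<le> (\<Sum>k<n. cmod (of_real ((-1/4) ^ k / fact k) * xsq x ^ k))"
      unfolding T_def by (rule norm_sum)
    also have "\<dots> = (\<Sum>k<n. ((norm x)\<^sup>2 / 4) ^ k /\<^sub>R fact k)"
    proof (intro sum.cong refl)
      fix k
      have "\<bar>(-1/4::real) ^ k / fact k\<bar> = (1/4) ^ k / fact k" by (simp add: power_abs)
      then have 1: "cmod (complex_of_real ((-1/4) ^ k / fact k)) = (1/4) ^ k / fact k"
        by (simp only: norm_of_real)
      have 2: "cmod (xsq x ^ k) = ((norm x)\<^sup>2) ^ k"
        by (simp only: norm_power xsq_def norm_of_real abs_power2)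
      have "(norm x)\<^sup>2 / 4 = (1/4) * (norm x)\<^sup>2" by simp
      then have 3: "((norm x)\<^sup>2 / 4) ^ k = (1/4) ^ k * ((norm x)\<^sup>2) ^ k"
        using power_mult_distrib[of "1/4" "(norm x)\<^sup>2" k] by metis
      show "cmod (of_real ((-1/4) ^ k / fact k) * xsq x ^ k) = ((norm x)\<^sup>2 / 4) ^ k /\<^sub>R fact k"
        unfolding norm_mult 1 2 3 real_scaleR_def by (simp only: divide_inverse mult_ac)
    qed
    also have "\<dots> \<le> (\<Sum>k. ((norm x)\<^sup>2 / 4) ^ k /\<^sub>R fact k)"
      by (rule sum_le_suminf[OF summable_exp_generic]) auto
    finally show ?thesis by (simp add: exp_def)
  qed
  have "(\<lambda>n. \<integral>x. f x * (gaussian s x * p x) * T n x \<partial>?M) \<longlonglongrightarrow> (\<integral>x. f x * (gaussian (s + 1/4) x * p x) \<partial>?M)"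
  proof (rule integral_dominated_convergence[where w = "\<lambda>x. cmod (f x * (gaussian (s - 1/4) x * p x))"])
    show "integrable ?M (\<lambda>x. cmod (f x * (gaussian (s - 1/4) x * p x)))"
      using f gaussian_L2[OF b p] s by (intro integrable_norm L2_mult_integrable) auto
    show "AE x in ?M. norm (f x * (gaussian s x * p x) * T n x) \<le> cmod (f x * (gaussian (s - 1/4) x * p x))" for n
    proof (rule AE_I2)
      fix x
      have "cmod (gaussian s x) * cmod (T n x) \<le> cmod (gaussian s x) * exp ((norm x)\<^sup>2 / 4)"
        by (intro mult_left_mono T_bound) simp
      also have "\<dots> = cmod (gaussian (s - 1/4) x)"
        by (simp add: gaussian_def algebra_simps flip: exp_add)
      finally have "cmod (f x) * cmod (p x) * (cmod (gaussian s x) * cmod (T n x)) \<le> cmod (f x) * cmod (p x) * cmod (gaussian (s - 1/4) x)"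
        by (intro mult_left_mono) auto
      then show "norm (f x * (gaussian s x * p x) * T n x) \<le> cmod (f x * (gaussian (s - 1/4) x * p x))"
        by (simp add: norm_mult mult_ac)
    qed
    show "AE x in ?M. (\<lambda>n. f x * (gaussian s x * p x) * T n x) \<longlonglongrightarrow> f x * (gaussian (s + 1/4) x * p x)"
      using lim by simp
  qed measurable
  then show ?thesis by (simp add: Tz LIMSEQ_const_iff)
qed

lemma gaussian_moments:
  fixes f :: "real^'n::finite \<Rightarrow> complex"
  assumes b: "b > - real CARD('n) / 2" and f: "f \<in> L2 (weighted_measure b)"
    and zero: "\<And>m p. p \<in> homogeneous_polys m \<Longrightarrow> (\<integral>x. f x * (gaussian (1/2) x * p x) \<partial>weighted_measure b) = 0"
  shows "p \<in> homogeneous_polys m \<Longrightarrow> (\<integral>x. f x * (gaussian (1/2 + real n / 4) x * p x) \<partial>weighted_measure b) = 0"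
proof (induction n arbitrary: p m)
  case (Suc n)
  have "(\<integral>x. f x * (gaussian (1/2 + real n / 4 + 1/4) x * p x) \<partial>weighted_measure b) = 0"
    by (rule gaussian_moment_step[OF b f _ Suc.IH Suc.prems]) auto
  moreover have "1/2 + real n / 4 + 1/4 = 1/2 + real (Suc n) / 4" by (simp add: field_simps)
  ultimately show ?case by (simp only:)
qed (use zero in simp)

text \<open>
  Scalar factors are absorbed into \<open>p\<close>, so this is the span of the functions \<open>e\<^bsup>-k|x|\<^sup>2\<^esup> p(x)\<close> with
  \<open>k \<ge> 1\<close>.
\<close>

inductive_set gaussian_algebra :: "(real^'n::finite \<Rightarrow> complex) set" where
  base: "p \<in> homogeneous_polys m \<Longrightarrow> (\<lambda>x. gaussian (real (Suc k)) x * p x) \<in> gaussian_algebra"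
| add: "f \<in> gaussian_algebra \<Longrightarrow> g \<in> gaussian_algebra \<Longrightarrow> (\<lambda>x. f x + g x) \<in> gaussian_algebra"

lemma gaussian_algebra_zero: "(\<lambda>x. 0) \<in> gaussian_algebra"
  using gaussian_algebra.base[OF homogeneous_const[of 0]] by simp

lemma gaussian_algebra_cmult: "f \<in> gaussian_algebra \<Longrightarrow> (\<lambda>x. c * f x) \<in> gaussian_algebra"
proof (induction rule: gaussian_algebra.induct)
  case (base p m k)
  have "(\<lambda>x. c * p x) \<in> homogeneous_polys m" by (rule fun_subspaceD(2)[OF fun_subspace_homogeneous base])
  from gaussian_algebra.base[OF this, of k] show ?case by (simp add: mult_ac)
next
  case (add f g)
  from gaussian_algebra.add[OF add.IH] show ?case by (simp add: distrib_left)
qed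

lemma gaussian_algebra_sum: "(\<And>i. i \<in> I \<Longrightarrow> f i \<in> gaussian_algebra) \<Longrightarrow> (\<lambda>x. \<Sum>i\<in>I. f i x) \<in> gaussian_algebra"
  by (induction I rule: infinite_finite_induct) (auto intro: gaussian_algebra_zero gaussian_algebra.add)

lemma gaussian_algebra_mult:
  assumes "f \<in> gaussian_algebra" "g \<in> gaussian_algebra"
  shows "(\<lambda>x. f x * g x) \<in> gaussian_algebra"
  using assms(1)
proof (induction rule: gaussian_algebra.induct)
  case (base p m k)
  note p = base
  from assms(2) show ?case
  proof (induction rule: gaussian_algebra.induct)
    case (base q n j)
    have "(\<lambda>x. gaussian (real (Suc (k + Suc j))) x * (p x * q x)) \<in> gaussian_algebra"
      by (rule gaussian_algebra.base[OF homogeneous_mult[OF p base]])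
    moreover have "gaussian (real (Suc (k + Suc j))) x * (p x * q x) = (gaussian (real (Suc k)) x * p x) * (gaussian (real (Suc j)) x * q x)" for x
    proof -
      have "gaussian (real (Suc (k + Suc j))) x = gaussian (real (Suc k)) x * gaussian (real (Suc j)) x"
        unfolding gaussian_mult by (rule arg_cong2[where f = gaussian]) auto
      then show ?thesis by (simp only: mult_ac)
    qed
    ultimately show ?case by (simp only:)
  next
    case (add g h)
    from gaussian_algebra.add[OF add.IH] show ?case by (simp add: distrib_left)
  qed
next
  case (add f h)
  from gaussian_algebra.add[OF add.IH] show ?case by (simp add: distrib_right)
qed

text \<open>
  Injective with bounded image, and the origin corresponds to the point at infinity.
\<close>

definition compactify :: "real^'n::finite \<Rightarrow> real \<times> (real^'n)" where
  "compactify x = (exp (- (norm x)\<^sup>2), exp (- (norm x)\<^sup>2) *\<^sub>R x)"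

text \<open>
  A monomial of degree \<open>k \<ge> 1\<close> in the coordinates \<open>e\<^bsup>-|x|\<^sup>2\<^esup>\<close> and \<open>e\<^bsup>-|x|\<^sup>2\<^esup> x\<^sub>i\<close> is \<open>e\<^bsup>-k|x|\<^sup>2\<^esup>\<close> times a monomial
  in \<open>x\<close>; the constant term is the value at the origin.
\<close>

lemma polynomial_compactify:
  fixes g :: "real \<times> (real^'n::finite) \<Rightarrow> real"
  assumes "real_polynomial_function g"
  shows "\<exists>v\<in>gaussian_algebra. \<forall>x. of_real (g (compactify x)) = of_real (g 0) + v x"
  using assms
proof (induction rule: real_polynomial_function.induct)
  case (linear f)
  interpret bounded_linear f by fact
  define v :: "real^'n \<Rightarrow> complex" where
    "v = (\<lambda>x. gaussian (real (Suc 0)) x * of_real (f (1, 0)) + (\<Sum>i\<in>UNIV. gaussian (real (Suc 0)) x * (of_real (x $ i) * of_real (f (0, axis i 1)))))"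
  have "v \<in> gaussian_algebra"
    unfolding v_def
    by (intro gaussian_algebra.add gaussian_algebra_sum gaussian_algebra.base[OF homogeneous_const]
        gaussian_algebra.base[OF homogeneous_coordinate_mult[OF homogeneous_const]])
  moreover have "of_real (f (compactify x)) = of_real (f 0) + v x" for x
  proof -
    have "(1::real, x) = (1, 0) + (\<Sum>i\<in>UNIV. x $ i *\<^sub>R (0, axis i 1))"
    proof -
      have "(\<Sum>i\<in>UNIV. x $ i *\<^sub>R (0::real, axis i 1 :: real^'n)) = (0, \<Sum>i\<in>UNIV. x $ i *\<^sub>R axis i 1)"
        by (simp add: prod_eq_iff fst_sum snd_sum)
      also have "(\<Sum>i\<in>UNIV. x $ i *\<^sub>R axis i 1) = x"
        using basis_expansion[of x] by (simp add: scalar_mult_eq_scaleR)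
      finally show ?thesis by simp
    qed
    then have "f (1, x) = f (1, 0) + (\<Sum>i\<in>UNIV. x $ i * f (0, axis i 1))"
      by (simp add: add sum scaleR del: scaleR_Pair)
    moreover have "f (compactify x) = exp (- (norm x)\<^sup>2) * f (1, x)"
      using scaleR[of "exp (- (norm x)\<^sup>2)" "(1, x)"] by (simp add: compactify_def)
    ultimately show ?thesis
      by (simp add: v_def gaussian_def zero distrib_left sum_distrib_left)
  qed
  ultimately show ?case by blast
next
  case (const c)
  then show ?case using gaussian_algebra_zero by force
next
  case (add f g)
  then obtain v w where v: "v \<in> gaussian_algebra" "\<forall>x. of_real (f (compactify x)) = of_real (f 0) + v x"
    and w: "w \<in> gaussian_algebra" "\<forall>x. of_real (g (compactify x)) = of_real (g 0) + w x" by blast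
  show ?case by (intro bexI[OF _ gaussian_algebra.add[OF v(1) w(1)]]) (simp add: v(2) w(2))
next
  case (mult f g)
  then obtain v w where v: "v \<in> gaussian_algebra" "\<forall>x. of_real (f (compactify x)) = of_real (f 0) + v x"
    and w: "w \<in> gaussian_algebra" "\<forall>x. of_real (g (compactify x)) = of_real (g 0) + w x" by blast
  have "(\<lambda>x. (of_real (f 0) * w x + of_real (g 0) * v x) + v x * w x) \<in> gaussian_algebra"
    using v w by (intro gaussian_algebra.add gaussian_algebra_cmult gaussian_algebra_mult)
  then show ?case by (intro bexI[rotated]) (auto simp: v(2) w(2) algebra_simps)
qed

lemma norm_compactify_le: "norm (compactify x) \<le> 2"
proof -
  let ?r = "norm x"
  have "?r \<le> 1 + ?r\<^sup>2"
    using sum_squares_bound[of ?r 1] norm_ge_zero[of x] by (simp, linarith)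
  also have "\<dots> \<le> exp (?r\<^sup>2)" by (rule exp_ge_add_one_self)
  finally have "exp (- ?r\<^sup>2) * ?r \<le> exp (- ?r\<^sup>2) * exp (?r\<^sup>2)" by (intro mult_left_mono) auto
  then have 1: "exp (- ?r\<^sup>2) * ?r \<le> 1" by (simp flip: exp_add)
  have 2: "exp (- ?r\<^sup>2) \<le> 1" by simp
  have "norm (compactify x) \<le> exp (- ?r\<^sup>2) + exp (- ?r\<^sup>2) * ?r"
    using norm_Pair_le[of "exp (- ?r\<^sup>2)" "exp (- ?r\<^sup>2) *\<^sub>R x"] by (simp add: compactify_def)
  then show ?thesis using 1 2 by linarith
qed

lemma gaussian_algebra_moment:
  fixes f :: "real^'n::finite \<Rightarrow> complex"
  assumes b: "b > - real CARD('n) / 2" and f: "f \<in> L2 (weighted_measure b)"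
    and zero: "\<And>m p. p \<in> homogeneous_polys m \<Longrightarrow> (\<integral>x. f x * (gaussian (1/2) x * p x) \<partial>weighted_measure b) = 0"
    and v: "v \<in> gaussian_algebra"
  shows "integrable (weighted_measure b) (\<lambda>x. f x * gaussian (1/2) x * v x) \<and>
     (\<integral>x. f x * gaussian (1/2) x * v x \<partial>weighted_measure b) = 0"
  using v
proof (induction rule: gaussian_algebra.induct)
  case (base p m k)
  have k: "real (4 * Suc k) / 4 = real (Suc k)" by simp
  have eq: "f x * gaussian (1/2) x * (gaussian (real (Suc k)) x * p x) = f x * (gaussian (1/2 + real (4 * Suc k) / 4) x * p x)" for x
    unfolding k gaussian_mult[symmetric] by (simp only: mult.assoc)
  have "integrable (weighted_measure b) (\<lambda>x. f x * (gaussian (1/2 + real (4 * Suc k) / 4) x * p x))"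
    using f gaussian_L2[OF b base] by (intro L2_mult_integrable) (auto simp: add_pos_nonneg)
  moreover have "(\<integral>x. f x * (gaussian (1/2 + real (4 * Suc k) / 4) x * p x) \<partial>weighted_measure b) = 0"
    by (rule gaussian_moments[OF b f _ base]) (rule zero)
  ultimately show ?case unfolding eq by (rule conjI)
next
  case (add v w)
  then show ?case unfolding distrib_left by (simp add: Bochner_Integration.integral_add)
qed

text \<open>
  Stone-Weierstrass on a ball containing the image of \<^const>\<open>compactify\<close>.
\<close>

lemma compactify_test_function:
  fixes f :: "real^'n::finite \<Rightarrow> complex" and \<phi> :: "real \<times> (real^'n) \<Rightarrow> real"
  assumes b: "b > - real CARD('n) / 2" and f: "f \<in> L2 (weighted_measure b)"
    and zero: "\<And>m p. p \<in> homogeneous_polys m \<Longrightarrow> (\<integral>x. f x * (gaussian (1/2) x * p x) \<partial>weighted_measure b) = 0"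
    and \<phi>: "continuous_on UNIV \<phi>" and \<phi>0: "\<phi> 0 = 0"
  shows "(\<integral>x. f x * gaussian (1/2) x * of_real (\<phi> (compactify x)) \<partial>weighted_measure b) = 0"
proof -
  let ?M = "weighted_measure b :: (real^'n) measure"
  define h where "h x = f x * gaussian (1/2) x" for x
  have h: "integrable ?M h"
    using L2_mult_integrable[OF f gaussian_L2[OF b homogeneous_const[of 1], of "1/2"]] by (simp add: h_def[abs_def])
  have [measurable]: "h \<in> borel_measurable borel"
    using borel_measurable_integrable[OF h] by (simp add: measurable_cong_sets[OF sets_weighted_measure refl])
  have [measurable]: "compactify \<in> borel_measurable (borel :: (real^'n) measure)"
    unfolding compactify_def by (intro borel_measurable_continuous_onI continuous_intros)
  have [measurable]: "\<phi> \<in> borel_measurable borel" using \<phi> by (rule borel_measurable_continuous_onI)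
  define I where "I = (\<integral>x. cmod (h x) \<partial>?M)"
  have I0: "I \<ge> 0" by (simp add: I_def)
  have "cmod (\<integral>x. h x * of_real (\<phi> (compactify x)) \<partial>?M) \<le> 2 * e * I" if e: "e > 0" for e
  proof -
    obtain g where g: "real_polynomial_function g" and close: "\<And>y. y \<in> cball 0 2 \<Longrightarrow> \<bar>\<phi> y - g y\<bar> < e"
      using Stone_Weierstrass_real_polynomial_function[of "cball (0 :: real \<times> (real^'n)) 2" \<phi> e] e
        continuous_on_subset[OF \<phi>, of "cball 0 2"] by auto
    obtain v where v: "v \<in> gaussian_algebra" and gv: "\<And>x. of_real (g (compactify x)) = complex_of_real (g 0) + v x"
      using polynomial_compactify[OF g] by blast
    have hv: "integrable ?M (\<lambda>x. h x * v x)" "(\<integral>x. h x * v x \<partial>?M) = 0"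
      using gaussian_algebra_moment[OF b f zero v] by (auto simp: h_def)
    have g0: "\<bar>g 0\<bar> < e" using close[of 0] \<phi>0 by simp
    define d where "d x = \<phi> (compactify x) - g (compactify x) + g 0" for x
    have dle: "\<bar>d x\<bar> \<le> 2 * e" for x
      using close[of "compactify x"] norm_compactify_le[of x] g0 unfolding d_def by simp
    have eq: "h x * of_real (\<phi> (compactify x)) = h x * of_real (d x) + h x * v x" for x
    proof -
      have "complex_of_real (\<phi> (compactify x)) = of_real (d x) + (of_real (g (compactify x)) - of_real (g 0))"
        by (simp add: d_def)
      then show ?thesis unfolding gv by (simp add: distrib_left)
    qed
    have [measurable]: "d \<in> borel_measurable borel"
    proof -
      have [measurable]: "g \<in> borel_measurable borel"
        using g by (intro borel_measurable_continuous_onI) (simp add: continuous_on_polymonial_function real_polynomial_function_eq)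
      show ?thesis unfolding d_def by measurable
    qed
    have "cmod (h x * of_real (d x)) \<le> 2 * e * cmod (h x)" for x
      using mult_left_mono[OF dle[of x], of "cmod (h x)"] by (simp add: norm_mult mult_ac)
    note bd = this
    have hd: "integrable ?M (\<lambda>x. h x * of_real (d x))"
    proof (rule Bochner_Integration.integrable_bound)
      show "integrable ?M (\<lambda>x. 2 * e * cmod (h x))" using h by auto
      show "AE x in ?M. norm (h x * of_real (d x)) \<le> norm (2 * e * cmod (h x))"
        using bd e by (intro AE_I2) (simp add: abs_mult)
    qed measurable
    have "cmod (\<integral>x. h x * of_real (\<phi> (compactify x)) \<partial>?M) = cmod (\<integral>x. h x * of_real (d x) \<partial>?M)"
      unfolding eq using hd hv by (subst Bochner_Integration.integral_add) auto
    also have "\<dots> \<le> (\<integral>x. cmod (h x * of_real (d x)) \<partial>?M)" by (rule integral_norm_bound)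
    also have "\<dots> \<le> (\<integral>x. 2 * e * cmod (h x) \<partial>?M)"
      using hd h bd by (intro integral_mono) auto
    also have "\<dots> = 2 * e * I" by (simp add: I_def)
    finally show ?thesis .
  qed
  note small = this
  have "cmod (\<integral>x. h x * of_real (\<phi> (compactify x)) \<partial>?M) \<le> 0 + e" if e: "e > 0" for e
  proof -
    have "cmod (\<integral>x. h x * of_real (\<phi> (compactify x)) \<partial>?M) \<le> 2 * (e / (2 * (I + 1))) * I"
      using I0 e by (intro small) simp
    also have "\<dots> \<le> e"
      using I0 e by (simp add: field_simps)
    finally show ?thesis by simp
  qed
  then have "cmod (\<integral>x. h x * of_real (\<phi> (compactify x)) \<partial>?M) \<le> 0" by (rule field_le_epsilon)
  then show ?thesis by (simp add: h_def)
qed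

text \<open>
  For \<open>\<delta> > 0\<close> the function \<open>(s, y) \<mapsto> max 0 (s - \<delta>) \<psi>(y / max s \<delta>)\<close> is continuous, vanishes at the
  origin and pulls back to \<open>max 0 (e\<^bsup>-|x|\<^sup>2\<^esup> - \<delta>) \<psi>(x)\<close>. Let \<open>\<delta>\<close> tend to \<open>0\<close>.
\<close>

lemma continuous_test_function:
  fixes f :: "real^'n::finite \<Rightarrow> complex" and \<psi> :: "real^'n \<Rightarrow> real"
  assumes b: "b > - real CARD('n) / 2" and f: "f \<in> L2 (weighted_measure b)"
    and zero: "\<And>m p. p \<in> homogeneous_polys m \<Longrightarrow> (\<integral>x. f x * (gaussian (1/2) x * p x) \<partial>weighted_measure b) = 0"
    and \<psi>: "continuous_on UNIV \<psi>" and bounded: "\<And>x. \<bar>\<psi> x\<bar> \<le> 1"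
  shows "(\<integral>x. f x * gaussian (3/2) x * of_real (\<psi> x) \<partial>weighted_measure b) = 0"
proof -
  let ?M = "weighted_measure b :: (real^'n) measure"
  define h where "h x = f x * gaussian (1/2) x" for x
  have h: "integrable ?M h"
    using L2_mult_integrable[OF f gaussian_L2[OF b homogeneous_const[of 1], of "1/2"]] by (simp add: h_def[abs_def])
  have [measurable]: "h \<in> borel_measurable borel"
    using borel_measurable_integrable[OF h] by (simp add: measurable_cong_sets[OF sets_weighted_measure refl])
  have [measurable]: "\<psi> \<in> borel_measurable borel" using \<psi> by (rule borel_measurable_continuous_onI)
  define E where "E x = exp (- (norm x)\<^sup>2)" for x :: "real^'n"
  have [measurable]: "E \<in> borel_measurable borel" unfolding E_def by measurable
  define c where "c n x = max 0 (E x - inverse (real (Suc n)))" for n x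
  have [measurable]: "c n \<in> borel_measurable borel" for n unfolding c_def by measurable
  have z: "(\<integral>x. h x * of_real (c n x * \<psi> x) \<partial>?M) = 0" for n
  proof -
    define \<delta> where "\<delta> = inverse (real (Suc n))"
    have \<delta>: "\<delta> > 0" by (simp add: \<delta>_def)
    have c\<delta>: "c n x = max 0 (E x - \<delta>)" for x by (simp only: c_def \<delta>_def)
    define \<phi> where "\<phi> y = max 0 (fst y - \<delta>) * \<psi> (snd y /\<^sub>R max (fst y) \<delta>)" for y :: "real \<times> (real^'n)"
    have "(\<integral>x. f x * gaussian (1/2) x * of_real (\<phi> (compactify x)) \<partial>?M) = 0"
    proof (rule compactify_test_function[OF b f zero])
      have "max (fst y) \<delta> \<noteq> 0" for y :: "real \<times> (real^'n)" using \<delta> by auto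
      then show "continuous_on UNIV \<phi>"
        unfolding \<phi>_def by (intro continuous_intros continuous_on_compose2[OF \<psi>]) auto
      show "\<phi> 0 = 0" using \<delta> by (simp add: \<phi>_def)
    qed
    moreover have "\<phi> (compactify x) = c n x * \<psi> x" for x
    proof (cases "E x > \<delta>")
      case True
      then have "E x \<noteq> 0" using \<delta> by simp
      with True show ?thesis by (simp add: \<phi>_def compactify_def c\<delta> E_def[symmetric])
    qed (simp add: \<phi>_def compactify_def c\<delta> E_def[symmetric])
    ultimately show ?thesis by (simp add: h_def)
  qed
  have "(\<lambda>n. \<integral>x. h x * of_real (c n x * \<psi> x) \<partial>?M) \<longlonglongrightarrow> (\<integral>x. h x * of_real (E x * \<psi> x) \<partial>?M)"
  proof (rule integral_dominated_convergence[where w = "\<lambda>x. cmod (h x)"])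
    show "integrable ?M (\<lambda>x. cmod (h x))" using h by simp
    show "AE x in ?M. (\<lambda>n. h x * of_real (c n x * \<psi> x)) \<longlonglongrightarrow> h x * of_real (E x * \<psi> x)"
    proof (rule AE_I2)
      fix x
      have "(\<lambda>n. max 0 (E x - inverse (real (Suc n)))) \<longlonglongrightarrow> max 0 (E x - 0)"
        by (intro tendsto_intros LIMSEQ_inverse_real_of_nat)
      then have "(\<lambda>n. c n x) \<longlonglongrightarrow> E x" by (simp add: c_def E_def)
      then show "(\<lambda>n. h x * of_real (c n x * \<psi> x)) \<longlonglongrightarrow> h x * of_real (E x * \<psi> x)"
        by (intro tendsto_intros)
    qed
    show "AE x in ?M. norm (h x * of_real (c n x * \<psi> x)) \<le> cmod (h x)" for n
    proof (rule AE_I2)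
      fix x
      have "E x \<le> 1" "inverse (real (Suc n)) > 0" by (simp_all add: E_def)
      then have "\<bar>c n x\<bar> \<le> 1" unfolding c_def by linarith
      then have "\<bar>c n x\<bar> * \<bar>\<psi> x\<bar> \<le> 1 * 1" by (intro mult_mono bounded) auto
      then show "norm (h x * of_real (c n x * \<psi> x)) \<le> cmod (h x)"
        using mult_left_mono[of "\<bar>c n x\<bar> * \<bar>\<psi> x\<bar>" 1 "cmod (h x)"] by (simp add: norm_mult abs_mult)
    qed
  qed measurable
  then have "(\<integral>x. h x * of_real (E x * \<psi> x) \<partial>?M) = 0" unfolding z LIMSEQ_const_iff by (rule sym)
  moreover have "h x * of_real (E x * \<psi> x) = f x * gaussian (3/2) x * of_real (\<psi> x)" for x
  proof -
    have "gaussian (3/2) x = gaussian (1/2) x * gaussian 1 x" by (simp add: gaussian_mult)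
    moreover have "gaussian 1 x = of_real (E x)" by (simp add: gaussian_def E_def)
    ultimately show ?thesis by (simp add: h_def)
  qed
  ultimately show ?thesis by (simp only:)
qed

lemma AE_zero_of_set_integrals:
  fixes k :: "'a \<Rightarrow> real"
  assumes k: "integrable M k" and zero: "\<And>A. A \<in> sets M \<Longrightarrow> (\<integral>x. indicator A x * k x \<partial>M) = 0"
  shows "AE x in M. k x = 0"
proof -
  have [measurable]: "k \<in> borel_measurable M" using k by auto
  define A where "A = {x \<in> space M. k x > 0}"
  define B where "B = {x \<in> space M. k x < 0}"
  have AB: "A \<in> sets M" "B \<in> sets M" unfolding A_def B_def by measurable
  have i: "integrable M (\<lambda>x. indicator C x * k x)" if "C \<in> sets M" for C
    using integrable_mult_indicator[OF that k] by simp
  have "AE x in M. indicator A x * k x = 0"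
    using integral_nonneg_eq_0_iff_AE[OF i[OF AB(1)]] zero[OF AB(1)]
    by (auto simp: A_def indicator_def)
  moreover have "AE x in M. - (indicator B x * k x) = 0"
  proof -
    have "AE x in M. 0 \<le> - (indicator B x * k x)" by (auto simp: B_def indicator_def)
    then show ?thesis
      using integral_nonneg_eq_0_iff_AE[of M "\<lambda>x. - (indicator B x * k x)"] i[OF AB(2)] zero[OF AB(2)] by simp
  qed
  ultimately show ?thesis
    using AE_space by eventually_elim (auto simp: A_def B_def indicator_def split: if_splits)
qed

text \<open>
  Indicators of open sets are limits of continuous functions, and the open sets are a generator of the
  Borel sets that is closed under intersections.
\<close>

lemma zero_of_continuous_test:
  fixes K :: "'a::metric_space \<Rightarrow> complex"
  assumes sets[simp, measurable_cong]: "sets M = sets borel" and K: "integrable M K"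
    and test: "\<And>\<psi>. continuous_on UNIV \<psi> \<Longrightarrow> (\<And>x. \<bar>\<psi> x\<bar> \<le> 1) \<Longrightarrow> (\<integral>x. K x * of_real (\<psi> x) \<partial>M) = 0"
  shows "AE x in M. K x = 0"
proof -
  have sp: "space M = UNIV" using sets_eq_imp_space_eq[OF sets] by simp
  have KU: "(\<integral>x. K x \<partial>M) = 0" using test[of "\<lambda>_. 1"] by simp
  have Kset: "set_integrable M A K" if "A \<in> sets M" for A
    unfolding set_integrable_def using that K by (intro integrable_mult_indicator)
  have [measurable]: "K \<in> borel_measurable M" using K by auto
  have opn: "set_lebesgue_integral M U K = 0" if U: "open U" for U
  proof (cases "U = UNIV")
    case True
    then show ?thesis using KU by (simp add: set_lebesgue_integral_def)
  next
    case False
    then have ne: "- U \<noteq> {}" by auto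
    have cl: "closed (- U)" using U by (simp add: closed_Compl)
    \<comment> \<open>Continuous functions increasing to the indicator of \<open>U\<close>.\<close>
    define \<psi> where "\<psi> n x = min 1 (real n * infdist x (- U))" for n x
    have cont: "continuous_on UNIV (\<psi> n)" for n unfolding \<psi>_def by (intro continuous_intros)
    have \<psi>01: "0 \<le> \<psi> n x" "\<psi> n x \<le> 1" for n x by (auto simp: \<psi>_def infdist_nonneg)
    have "(\<lambda>n. \<integral>x. K x * of_real (\<psi> n x) \<partial>M) \<longlonglongrightarrow> (\<integral>x. indicator U x *\<^sub>R K x \<partial>M)"
    proof (rule integral_dominated_convergence[where w = "\<lambda>x. cmod (K x)"])
      show "integrable M (\<lambda>x. cmod (K x))" using K by simp
      have "(\<lambda>n. \<psi> n x) \<longlonglongrightarrow> indicator U x" for x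
      proof (cases "x \<in> U")
        case True
        then have pos: "infdist x (- U) > 0" using cl ne by (simp add: infdist_pos_not_in_closed)
        obtain N where N: "real N * infdist x (- U) > 1" using reals_Archimedean3[OF pos] by blast
        have "\<forall>\<^sub>F n in sequentially. \<psi> n x = indicator U x"
          using eventually_ge_at_top[of N]
        proof eventually_elim
          case (elim n)
          then have "real N * infdist x (- U) \<le> real n * infdist x (- U)" using pos by (intro mult_right_mono) auto
          then show ?case using N True by (simp add: \<psi>_def)
        qed
        then show ?thesis by (rule tendsto_eventually)
      qed (simp add: \<psi>_def)
      then have "(\<lambda>n. K x * of_real (\<psi> n x)) \<longlonglongrightarrow> K x * of_real (indicator U x)" for x
        by (intro tendsto_intros)
      then show "AE x in M. (\<lambda>n. K x * of_real (\<psi> n x)) \<longlonglongrightarrow> indicator U x *\<^sub>R K x"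
        by (simp add: scaleR_conv_of_real mult.commute)
      show "AE x in M. norm (K x * of_real (\<psi> n x)) \<le> cmod (K x)" for n
        using \<psi>01 by (intro AE_I2) (simp add: norm_mult mult_left_le)
      show "(\<lambda>x. K x * of_real (\<psi> n x)) \<in> borel_measurable M" for n
      proof -
        have [measurable]: "\<psi> n \<in> borel_measurable borel" using cont by (rule borel_measurable_continuous_onI)
        show ?thesis by measurable
      qed
      show "(\<lambda>x. indicator U x *\<^sub>R K x) \<in> borel_measurable M"
        using Kset[of U] U by (auto simp: set_integrable_def dest: borel_measurable_integrable)
    qed
    moreover have "(\<integral>x. K x * of_real (\<psi> n x) \<partial>M) = 0" for n
      using \<psi>01 by (intro test cont) simp
    ultimately show ?thesis by (simp add: LIMSEQ_const_iff set_lebesgue_integral_def)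
  qed
  have all: "set_lebesgue_integral M A K = 0" if "A \<in> sigma_sets UNIV {S :: 'a set. open S}" for A
    using that
  proof (induction rule: sigma_sets_induct_disjoint[rotated 2, consumes 1, case_names basic empty compl union int sub])
    case (basic A)
    then show ?case using opn by simp
  next
    case empty
    show ?case by (simp add: set_lebesgue_integral_def)
  next
    case (compl A)
    then have A: "A \<in> sets M" by (simp add: borel_def)
    have "set_lebesgue_integral M (UNIV - A) K = (\<integral>x. K x - indicator A x *\<^sub>R K x \<partial>M)"
      unfolding set_lebesgue_integral_def by (intro Bochner_Integration.integral_cong) (auto simp: indicator_def)
    also have "\<dots> = 0"
      using Kset[OF A] K KU compl by (simp add: set_integrable_def set_lebesgue_integral_def)
    finally show ?case .
  next
    case (union A)
    then have "A i \<in> sets M" for i by (auto simp: borel_def)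
    moreover from this have "(\<Union>i. A i) \<in> sets M" by auto
    ultimately show ?case using union Kset
      by (subst lebesgue_integral_countable_add) (auto simp: disjoint_family_on_def)
  next
    case int
    show ?case by (auto simp: Int_stable_def)
  qed auto
  have all': "(\<integral>x. indicator A x *\<^sub>R K x \<partial>M) = 0" if "A \<in> sets M" for A
    using all[of A] that by (simp add: borel_def set_lebesgue_integral_def)
  have "AE x in M. Re (K x) = 0"
  proof (rule AE_zero_of_set_integrals)
    fix A assume A: "A \<in> sets M"
    have "(\<integral>x. Re (indicator A x *\<^sub>R K x) \<partial>M) = Re (\<integral>x. indicator A x *\<^sub>R K x \<partial>M)"
      using integrable_mult_indicator[OF A K] by (rule integral_Re)
    then show "(\<integral>x. indicator A x * Re (K x) \<partial>M) = 0" using all'[OF A] by simp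
  qed (use K in auto)
  moreover have "AE x in M. Im (K x) = 0"
  proof (rule AE_zero_of_set_integrals)
    fix A assume A: "A \<in> sets M"
    have "(\<integral>x. Im (indicator A x *\<^sub>R K x) \<partial>M) = Im (\<integral>x. indicator A x *\<^sub>R K x \<partial>M)"
      using integrable_mult_indicator[OF A K] by (rule integral_Im)
    then show "(\<integral>x. indicator A x * Im (K x) \<partial>M) = 0" using all'[OF A] by simp
  qed (use K in auto)
  ultimately show ?thesis by eventually_elim (simp add: complex_eq_iff)
qed

lemma Phi_complete:
  fixes f :: "real^'n::finite \<Rightarrow> complex"
  assumes b: "b > - real CARD('n) / 2" and f: "f \<in> L2 (weighted_measure b)"
    and orth: "\<And>l \<alpha>. inner_L2 (weighted_measure b) f
       (Phi b l (\<Sum>i\<in>UNIV. \<alpha> i) (harmonic_projection (\<Sum>i\<in>UNIV. \<alpha> i) (monomial \<alpha>))) = 0"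
  shows "AE x in weighted_measure b. f x = 0"
proof -
  let ?M = "weighted_measure b :: (real^'n) measure"
  have zero: "(\<integral>x. f x * (gaussian (1/2) x * p x) \<partial>?M) = 0" if p: "p \<in> homogeneous_polys m" for m p
  proof -
    have "inner_L2 ?M f (\<lambda>x. radial_gauss 1 x * cnj (p x)) = 0"
      by (rule orthogonal_radial_gauss[OF b f orth homogeneous_cnj[OF p]])
    then show ?thesis
      by (simp add: inner_L2_def radial_gauss_eq gauss_eq_gaussian gaussian_def)
  qed
  have K: "integrable ?M (\<lambda>x. f x * gaussian (3/2) x)"
    using L2_mult_integrable[OF f gaussian_L2[OF b homogeneous_const[of 1], of "3/2"]] by simp
  have "AE x in ?M. f x * gaussian (3/2) x = 0"
    by (rule zero_of_continuous_test[OF sets_weighted_measure K]) (rule continuous_test_function[OF b f zero])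
  then show ?thesis by eventually_elim (simp add: gaussian_def)
qed

section \<open>The closure of the oscillator\<close>

text \<open>
  Countably many of the \<open>\<Phi>\<close> suffice for completeness if \<open>p\<close> runs through the harmonic projections of
  monomials.
\<close>

definition spanning_Phi :: "real \<Rightarrow> nat \<times> ('n \<Rightarrow> nat) \<Rightarrow> real^'n::finite \<Rightarrow> complex" where
  "spanning_Phi b = (\<lambda>(l, \<alpha>). Phi b l (\<Sum>i\<in>UNIV. \<alpha> i) (harmonic_projection (\<Sum>i\<in>UNIV. \<alpha> i) (monomial \<alpha>)))"

definition spanning_eigenvalue :: "real \<Rightarrow> nat \<times> ('n::finite \<Rightarrow> nat) \<Rightarrow> real" where
  "spanning_eigenvalue b = (\<lambda>(l, \<alpha>). oscillator_eigenvalue b CARD('n) l (\<Sum>i\<in>UNIV. \<alpha> i))"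

definition eigenvector :: "real \<Rightarrow> nat \<Rightarrow> real^'n::finite \<Rightarrow> complex" where
  "eigenvector b = gram_schmidt (weighted_measure b) (\<lambda>j. spanning_Phi b (from_nat j))"

text \<open>
  The type argument carries the dimension.
\<close>

definition eigenvalue :: "'n::finite itself \<Rightarrow> real \<Rightarrow> nat \<Rightarrow> real" where
  "eigenvalue _ b j = spanning_eigenvalue b (from_nat j :: nat \<times> ('n \<Rightarrow> nat))"

lemma spanning_Phi_cases:
  obtains l m and p :: "real^'n::finite \<Rightarrow> complex" where "p \<in> harmonic_polys m" "spanning_Phi b i = Phi b l m p"
    "spanning_eigenvalue b i = oscillator_eigenvalue b CARD('n) l m"
proof -
  obtain l \<alpha> where i: "i = (l, \<alpha>)" by (cases i)
  show ?thesis
    by (rule that[OF harmonic_projection_harmonic[OF monomial_homogeneous[of \<alpha>]]])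
      (auto simp: i spanning_Phi_def spanning_eigenvalue_def)
qed

lemma spanning_Phi_L2:
  assumes b: "b > - real CARD('n::finite) / 2"
  shows "(spanning_Phi b i :: real^'n \<Rightarrow> complex) \<in> L2 (weighted_measure b)"
  using Phi_L2[OF b] by (cases rule: spanning_Phi_cases[of b i]) auto

text \<open>
  The eigenvectors inherit linear properties of the \<open>\<Phi>\<close> with the same eigenvalue.
\<close>

lemma eigenvector_in_subspace:
  fixes S :: "(real^'n::finite \<Rightarrow> complex) set"
  assumes b: "b > - real CARD('n) / 2" and S: "fun_subspace S"
    and Phi: "\<And>l m p. p \<in> harmonic_polys m \<Longrightarrow> oscillator_eigenvalue b CARD('n) l m = eigenvalue TYPE('n) b j \<Longrightarrow> Phi b l m p \<in> S"
  shows "eigenvector b j \<in> S"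
  unfolding eigenvector_def
proof (rule gram_schmidt_in_subspace[where \<mu> = "eigenvalue TYPE('n) b", OF _ _ S])
  show "(spanning_Phi b (from_nat i) :: real^'n \<Rightarrow> complex) \<in> L2 (weighted_measure b)" for i by (rule spanning_Phi_L2[OF b])
next
  fix i k assume ne: "eigenvalue TYPE('n) b i \<noteq> eigenvalue TYPE('n) b k"
  obtain l m and p :: "real^'n \<Rightarrow> complex" where 1: "p \<in> harmonic_polys m" "spanning_Phi b (from_nat i) = Phi b l m p"
    "spanning_eigenvalue b (from_nat i :: nat \<times> ('n \<Rightarrow> nat)) = oscillator_eigenvalue b CARD('n) l m"
    by (rule spanning_Phi_cases)
  obtain l' m' and p' :: "real^'n \<Rightarrow> complex" where 2: "p' \<in> harmonic_polys m'" "spanning_Phi b (from_nat k) = Phi b l' m' p'"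
    "spanning_eigenvalue b (from_nat k :: nat \<times> ('n \<Rightarrow> nat)) = oscillator_eigenvalue b CARD('n) l' m'"
    by (rule spanning_Phi_cases)
  show "inner_L2 (weighted_measure b) (spanning_Phi b (from_nat i) :: real^'n \<Rightarrow> complex) (spanning_Phi b (from_nat k)) = 0"
    unfolding 1(2) 2(2) using ne by (intro Phi_orthogonal[OF b 1(1) 2(1)]) (simp add: eigenvalue_def 1(3) 2(3))
next
  fix i assume eq: "eigenvalue TYPE('n) b i = eigenvalue TYPE('n) b j"
  obtain l m and p :: "real^'n \<Rightarrow> complex" where 1: "p \<in> harmonic_polys m" "spanning_Phi b (from_nat i) = Phi b l m p"
    "spanning_eigenvalue b (from_nat i :: nat \<times> ('n \<Rightarrow> nat)) = oscillator_eigenvalue b CARD('n) l m"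
    by (rule spanning_Phi_cases)
  show "spanning_Phi b (from_nat i) \<in> S"
    unfolding 1(2) using 1(3) eq by (intro Phi 1(1)) (simp add: eigenvalue_def)
qed

lemma complete_eigenvectors:
  assumes b: "b > - real CARD('n::finite) / 2"
  shows "complete_orthosystem (weighted_measure b) (eigenvector b :: nat \<Rightarrow> real^'n \<Rightarrow> complex)"
  unfolding eigenvector_def
proof (rule complete_orthosystem_gram_schmidt)
  show "(spanning_Phi b (from_nat j) :: real^'n \<Rightarrow> complex) \<in> L2 (weighted_measure b)" for j by (rule spanning_Phi_L2[OF b])
  fix f :: "real^'n \<Rightarrow> complex"
  assume f: "f \<in> L2 (weighted_measure b)"
    and o: "\<And>j. inner_L2 (weighted_measure b) f (spanning_Phi b (from_nat j)) = 0"
  show "AE x in weighted_measure b. f x = 0"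
  proof (rule Phi_complete[OF b f])
    fix l and \<alpha> :: "'n \<Rightarrow> nat"
    show "inner_L2 (weighted_measure b) f (Phi b l (\<Sum>i\<in>UNIV. \<alpha> i) (harmonic_projection (\<Sum>i\<in>UNIV. \<alpha> i) (monomial \<alpha>))) = 0"
      using o[of "to_nat (l, \<alpha>)"] by (simp add: spanning_Phi_def)
  qed
qed

lemma inner_Phi_eigenvector:
  fixes p :: "real^'n::finite \<Rightarrow> complex"
  assumes b: "b > - real CARD('n) / 2" and p: "p \<in> harmonic_polys m"
    and ne: "oscillator_eigenvalue b CARD('n) l m \<noteq> eigenvalue TYPE('n) b j"
  shows "inner_L2 (weighted_measure b) (Phi b l m p) (eigenvector b j) = 0"
proof -
  have "eigenvector b j \<in> {u \<in> L2 (weighted_measure b). inner_L2 (weighted_measure b) u (Phi b l m p) = 0}"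
    using Phi_L2[OF b] Phi_orthogonal[OF b _ p] ne p
    by (intro eigenvector_in_subspace[OF b] fun_subspace_L2_orth) auto
  then show ?thesis using inner_L2_commute[of "weighted_measure b" "Phi b l m p"] by simp
qed

text \<open>
  The symmetry relations against eigenvectors persist in the limit, so the closure is contained in the
  diagonal operator. Conversely, the partial sums of the eigenvector expansion of \<open>f\<close> lie in the
  algebraic domain, and their images are the partial sums for \<open>g\<close>.
\<close>

lemma oscillator_graph_closure:
  assumes b: "b > - real CARD('n::finite) / 2"
  shows "graph_closure (weighted_measure b) (oscillator_graph b :: (real^'n) op_graph) =
    complete_orthosystem.diagonal_operator (weighted_measure b) (eigenvector b) (\<lambda>j. of_real (eigenvalue TYPE('n) b j))"
proof -
  let ?M = "weighted_measure b :: (real^'n) measure" and ?\<mu> = "eigenvalue TYPE('n) b"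
  interpret E: complete_orthosystem ?M "eigenvector b" by (rule complete_eigenvectors[OF b])
  show ?thesis
  proof (intro equalityI subrelI)
    fix f g assume "(f, g) \<in> graph_closure ?M (oscillator_graph b)"
    then obtain u w where f: "f \<in> L2 ?M" and g: "g \<in> L2 ?M" and uw: "\<And>n. (u n, w n) \<in> oscillator_graph b"
      and lim: "tendsto_L2 ?M u f" "tendsto_L2 ?M w g"
      unfolding graph_closure_def by blast
    have "u n \<in> L2 ?M \<and> w n \<in> L2 ?M \<and> inner_L2 ?M (w n) (eigenvector b j) = of_real (?\<mu> j) * inner_L2 ?M (u n) (eigenvector b j)" for n j
    proof -
      obtain v where v: "w n = oscillator b (u n) v" "(u n, v) \<in> R_graph"
        using uw[of n] unfolding oscillator_graph_alt by blast
      note R = R_graph_oscillator[OF v(2) b, folded v(1)]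
      have uL: "u n \<in> L2 ?M" and wL: "w n \<in> L2 ?M" using R by auto
      let ?S = "{\<phi> \<in> L2 ?M. inner_L2 ?M (w n) \<phi> = of_real (?\<mu> j) * inner_L2 ?M (u n) \<phi>}"
      have "eigenvector b j \<in> ?S"
      proof (rule eigenvector_in_subspace[OF b])
        show "fun_subspace ?S"
          unfolding fun_subspace_def
          by (auto simp: L2_zero L2_add L2_mult_left inner_L2_add_right inner_L2_mult_right uL wL distrib_left)
        fix l m and p :: "real^'n \<Rightarrow> complex" assume "p \<in> harmonic_polys m" "oscillator_eigenvalue b CARD('n) l m = ?\<mu> j"
        then show "Phi b l m p \<in> ?S" using R Phi_L2[OF b] by auto
      qed
      then show ?thesis using uL wL by blast
    qed
    then have u: "\<And>n. u n \<in> L2 ?M" and w: "\<And>n. w n \<in> L2 ?M"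
      and uwj: "\<And>n j. E.coef (w n) j = of_real (?\<mu> j) * E.coef (u n) j" by blast+
    have "E.coef g j = of_real (?\<mu> j) * E.coef f j" for j
    proof (rule LIMSEQ_unique)
      show "(\<lambda>n. E.coef (w n) j) \<longlonglongrightarrow> E.coef g j" by (intro tendsto_L2_inner w g E.e_L2 lim)
      show "(\<lambda>n. E.coef (w n) j) \<longlonglongrightarrow> of_real (?\<mu> j) * E.coef f j"
        unfolding uwj by (intro tendsto_mult tendsto_const tendsto_L2_inner u f E.e_L2 lim)
    qed
    then show "(f, g) \<in> E.diagonal_operator (\<lambda>j. of_real (?\<mu> j))"
      using f g by (simp add: E.diagonal_operator_def)
  next
    fix f g assume "(f, g) \<in> E.diagonal_operator (\<lambda>j. of_real (?\<mu> j))"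
    then have f: "f \<in> L2 ?M" and g: "g \<in> L2 ?M" and c: "\<And>j. E.coef g j = of_real (?\<mu> j) * E.coef f j"
      by (auto simp: E.diagonal_operator_def)
    have "eigenvector b j \<in> (oscillator_eigenspace b (?\<mu> j) :: (real^'n \<Rightarrow> complex) set)" for j
    proof (rule eigenvector_in_subspace[OF b fun_subspace_oscillator_eigenspace[OF b]])
      fix l m and p :: "real^'n \<Rightarrow> complex" assume "p \<in> harmonic_polys m" "oscillator_eigenvalue b CARD('n) l m = ?\<mu> j"
      then show "Phi b l m p \<in> oscillator_eigenspace b (?\<mu> j)" using Phi_oscillator_eigenspace[OF b, of p m l] by simp
    qed
    then have "\<forall>j. \<exists>h. (eigenvector b j, h) \<in> (oscillator_graph b :: (real^'n) op_graph) \<and>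
        (\<forall>x. x \<noteq> 0 \<longrightarrow> h x = of_real (?\<mu> j) * eigenvector b j x)"
      unfolding oscillator_eigenspace_def by blast
    then obtain h where h: "\<And>j. (eigenvector b j, h j) \<in> (oscillator_graph b :: (real^'n) op_graph)"
      "\<And>j x. x \<noteq> 0 \<Longrightarrow> h j x = of_real (?\<mu> j) * eigenvector b j x" by metis
    define u where "u n = E.partial_sum (E.coef f) n" for n
    define w where "w n x = (\<Sum>j<n. E.coef f j * h j x)" for n x
    have "(u n, w n) \<in> oscillator_graph b" for n
    proof (induction n)
      case 0
      show ?case using oscillator_graph_scale[OF b h(1)[of 0], of 0]
        by (simp add: u_def w_def[abs_def] E.partial_sum_def[abs_def])
    next
      case (Suc n)
      from oscillator_graph_add[OF b Suc.IH oscillator_graph_scale[OF b h(1)[of n], of "E.coef f n"]]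
      show ?case by (simp add: u_def w_def[abs_def] E.partial_sum_def[abs_def])
    qed
    moreover have "tendsto_L2 ?M u f" unfolding u_def by (rule E.expansion[OF f])
    moreover have "tendsto_L2 ?M w g"
    proof -
      have "w n x = E.partial_sum (E.coef g) n x" if "x \<noteq> 0" for n x
        unfolding w_def E.partial_sum_def using h(2)[OF that] c by (intro sum.cong) (auto simp: mult_ac)
      note wS = this
      have "sqnorm_L2 ?M (\<lambda>x. w n x - g x) = sqnorm_L2 ?M (\<lambda>x. E.partial_sum (E.coef g) n x - g x)" for n
        unfolding sqnorm_L2_def
      proof (intro nn_integral_cong_AE)
        show "AE x in ?M. ennreal ((cmod (w n x - g x))\<^sup>2) = ennreal ((cmod (E.partial_sum (E.coef g) n x - g x))\<^sup>2)"
          using AE_weighted_nonzero by eventually_elim (simp add: wS)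
      qed
      then show ?thesis using E.expansion[OF g] unfolding tendsto_L2_def by simp
    qed
    ultimately show "(f, g) \<in> graph_closure ?M (oscillator_graph b)"
      unfolding graph_closure_def using f g by blast
  qed
qed

section \<open>The generalized Fourier transform\<close>

definition fourier_eigenvalue :: "'n::finite itself \<Rightarrow> real \<Rightarrow> nat \<Rightarrow> complex" where
  "fourier_eigenvalue _ b j = exp (of_real pi * \<i> * of_real (b + real CARD('n) / 2) / 2) * exp (of_real pi * \<i> / 4 * of_real (eigenvalue TYPE('n) b j))"

lemma gen_fourier_coef:
  fixes f :: "real^'n::finite \<Rightarrow> complex"
  assumes b: "b > - real CARD('n) / 2" and f: "f \<in> L2 (weighted_measure b)"
  shows "gen_fourier b f \<in> L2 (weighted_measure b)"
    and "inner_L2 (weighted_measure b) (gen_fourier b f) (eigenvector b j)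
      = fourier_eigenvalue TYPE('n) b j * inner_L2 (weighted_measure b) f (eigenvector b j)"
proof -
  let ?M = "weighted_measure b :: (real^'n) measure"
  interpret E: complete_orthosystem ?M "eigenvector b" by (rule complete_eigenvectors[OF b])
  let ?\<phi> = "\<lambda>s. exp (of_real pi * \<i> / 4 * complex_of_real s)"
  have m: "?\<phi> \<in> borel_measurable borel" by (intro borel_measurable_continuous_onI continuous_intros)
  have bd: "cmod (?\<phi> s) \<le> 1" for s by simp
  note F = E.functional_calculus_diagonal[OF m bd f, of "eigenvalue TYPE('n) b", folded oscillator_graph_closure[OF b]]
  show "gen_fourier b f \<in> L2 ?M"
    unfolding gen_fourier_def by (intro L2_mult_left F(1))
  show "E.coef (gen_fourier b f) j = fourier_eigenvalue TYPE('n) b j * E.coef f j"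
    unfolding gen_fourier_def inner_L2_mult_left F(2) fourier_eigenvalue_def by (simp add: mult.assoc)
qed

lemma fourier_eigenvalue_inverse:
  assumes "eigenvalue TYPE('n::finite) b j = oscillator_eigenvalue b CARD('n) l m"
  shows "fourier_eigenvalue TYPE('n) b j = inverse (\<i> ^ (2 * l + m))"
proof -
  have e: "exp (\<i> * (of_real pi / 2)) = \<i>"
    using cis_conv_exp[of "pi / 2"] by simp
  have "fourier_eigenvalue TYPE('n) b j = exp (- (of_nat (2 * l + m) * (\<i> * (of_real pi / 2))))"
    unfolding fourier_eigenvalue_def assms exp_add[symmetric]
    by (rule arg_cong[where f = exp]) (simp add: oscillator_eigenvalue_def field_simps)
  also have "\<dots> = inverse (\<i> ^ (2 * l + m))"
    unfolding exp_minus exp_of_nat_mult e ..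
  finally show ?thesis .
qed

lemma fourier_eigenvalue_eq:
  assumes "eigenvalue TYPE('n::finite) b j = oscillator_eigenvalue b CARD('n) l m"
  shows "fourier_eigenvalue TYPE('n) b j = \<i> powi (- (2 * int l + int m))"
proof -
  have "inverse (\<i> ^ (2 * l + m)) = \<i> powi (- int (2 * l + m))"
    by (simp only: power_int_minus power_int_of_nat)
  then show ?thesis unfolding fourier_eigenvalue_inverse[OF assms] by simp
qed

lemma eigenvalue_cases:
  obtains l m where "eigenvalue TYPE('n::finite) b j = oscillator_eigenvalue b CARD('n) l m"
  unfolding eigenvalue_def spanning_eigenvalue_def by (metis case_prod_beta)

lemma fourier_eigenvalue_square:
  assumes "eigenvalue TYPE('n::finite) b j = oscillator_eigenvalue b CARD('n) l m"
  shows "(fourier_eigenvalue TYPE('n) b j)\<^sup>2 = (-1) ^ m"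
proof -
  have "(fourier_eigenvalue TYPE('n) b j)\<^sup>2 = inverse ((\<i>\<^sup>2) ^ (2 * l + m))"
    unfolding fourier_eigenvalue_inverse[OF assms] by (simp only: power_inverse power_mult[symmetric] mult.commute)
  also have "\<dots> = (-1) ^ m" by (simp add: power_add power_mult power_inverse[symmetric])
  finally show ?thesis .
qed

lemma fourier_eigenvalue_norm: "fourier_eigenvalue TYPE('n::finite) b j * cnj (fourier_eigenvalue TYPE('n) b j) = 1"
proof -
  have "cmod (fourier_eigenvalue TYPE('n) b j) = 1" by (simp add: fourier_eigenvalue_def norm_mult)
  then show ?thesis by (simp add: complex_norm_square[symmetric])
qed

text \<open>
  \<open>\<Phi>\<close> of degree \<open>m\<close> has parity \<open>(-1)\<^sup>m\<close>, the square of \<open>i\<^bsup>-(2l+m)\<^esup>\<close>.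
\<close>

lemma eigenvector_reflect:
  fixes x :: "real^'n::finite"
  assumes b: "b > - real CARD('n) / 2"
  shows "eigenvector b j (- x) = (fourier_eigenvalue TYPE('n) b j)\<^sup>2 * eigenvector b j x"
proof -
  let ?k = "(fourier_eigenvalue TYPE('n) b j)\<^sup>2"
  have "eigenvector b j \<in> {u :: real^'n \<Rightarrow> complex. \<forall>x. u (- x) = ?k * u x}"
  proof (rule eigenvector_in_subspace[OF b])
    show "fun_subspace {u :: real^'n \<Rightarrow> complex. \<forall>x. u (- x) = ?k * u x}"
      by (auto simp: fun_subspace_def algebra_simps)
    fix l m and p :: "real^'n \<Rightarrow> complex"
    assume p: "p \<in> harmonic_polys m" and eq: "oscillator_eigenvalue b CARD('n) l m = eigenvalue TYPE('n) b j"
    have "p (- x) = (-1) ^ m * p x" for x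
      using homogeneous_scaleR[OF harmonic_homogeneous[OF p], of "-1" x] by simp
    then show "Phi b l m p \<in> {u. \<forall>x. u (- x) = ?k * u x}"
      unfolding fourier_eigenvalue_square[OF eq[symmetric]] by (simp add: Phi_def mult_ac)
  qed
  then show ?thesis by simp
qed

text \<open>
  The harmonic polynomials of a given degree are invariant under conjugation, so the conjugate of an
  eigenvector expands into eigenvectors for the same eigenvalue.
\<close>

lemma gen_fourier_inner_cnj_eigenvector:
  fixes g :: "real^'n::finite \<Rightarrow> complex"
  assumes b: "b > - real CARD('n) / 2" and g: "g \<in> L2 (weighted_measure b)"
  shows "inner_L2 (weighted_measure b) (gen_fourier b g) (\<lambda>x. cnj (eigenvector b j x))
      = fourier_eigenvalue TYPE('n) b j * inner_L2 (weighted_measure b) g (\<lambda>x. cnj (eigenvector b j x))"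
proof -
  let ?M = "weighted_measure b :: (real^'n) measure" and ?w = "\<lambda>x. cnj (eigenvector b j x)"
  let ?k = "fourier_eigenvalue TYPE('n) b"
  interpret E: complete_orthosystem ?M "eigenvector b" by (rule complete_eigenvectors[OF b])
  have w: "?w \<in> L2 ?M" by (intro L2_cnj E.e_L2)
  have w0: "E.coef ?w i = 0" if ne: "eigenvalue TYPE('n) b i \<noteq> eigenvalue TYPE('n) b j" for i
  proof -
    have "eigenvector b j \<in> {u \<in> L2 ?M. inner_L2 ?M (\<lambda>x. cnj (u x)) (eigenvector b i) = 0}"
    proof (rule eigenvector_in_subspace[OF b])
      show "fun_subspace {u \<in> L2 ?M. inner_L2 ?M (\<lambda>x. cnj (u x)) (eigenvector b i) = 0}"
        unfolding fun_subspace_def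
        by (auto simp: L2_zero L2_add L2_mult_left L2_cnj inner_L2_add_left inner_L2_mult_left E.e_L2)
      fix l m and p :: "real^'n \<Rightarrow> complex"
      assume p: "p \<in> harmonic_polys m" and eq: "oscillator_eigenvalue b CARD('n) l m = eigenvalue TYPE('n) b j"
      have "(\<lambda>x. cnj (Phi b l m p x)) = Phi b l m (\<lambda>x. cnj (p x))" by (simp add: Phi_def)
      then show "Phi b l m p \<in> {u \<in> L2 ?M. inner_L2 ?M (\<lambda>x. cnj (u x)) (eigenvector b i) = 0}"
        using inner_Phi_eigenvector[OF b harmonic_cnj[OF p], of l i] ne eq Phi_L2[OF b p] by simp
    qed
    then show ?thesis by simp
  qed
  have k: "?k i = ?k j" if "eigenvalue TYPE('n) b i = eigenvalue TYPE('n) b j" for i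
    using that by (simp add: fourier_eigenvalue_def)
  have "(\<lambda>i. E.coef (gen_fourier b g) i * cnj (E.coef ?w i)) sums inner_L2 ?M (gen_fourier b g) ?w"
    by (intro E.Parseval_inner gen_fourier_coef[OF b g] w)
  moreover have "(\<lambda>i. ?k j * (E.coef g i * cnj (E.coef ?w i))) sums (?k j * inner_L2 ?M g ?w)"
    by (intro sums_mult E.Parseval_inner g w)
  moreover have "E.coef (gen_fourier b g) i * cnj (E.coef ?w i) = ?k j * (E.coef g i * cnj (E.coef ?w i))" for i
    using w0[of i] k[of i] gen_fourier_coef(2)[OF b g, of i] by (cases "eigenvalue TYPE('n) b i = eigenvalue TYPE('n) b j") auto
  ultimately show ?thesis by (simp only: sums_unique2)
qed

lemma distr_weighted_uminus: "distr (weighted_measure b :: (real^'n::finite) measure) borel uminus = weighted_measure b"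
proof -
  have d: "distr lborel borel uminus = (lborel :: (real^'n) measure)" 
    using lborel_affine[of "-1" "0 :: real^'n"] by (simp add: density_1)
  have "weighted_measure b = density (distr lborel borel uminus) (\<lambda>x :: real^'n. ennreal (norm x powr (2 * b)))"
    unfolding weighted_measure_def d ..
  also have "\<dots> = distr (density lborel (\<lambda>x :: real^'n. ennreal (norm (- x) powr (2 * b)))) borel uminus"
    by (subst density_distr) auto
  finally show ?thesis by (simp add: weighted_measure_def)
qed

lemma L2_reflect:
  fixes f :: "real^'n::finite \<Rightarrow> complex"
  assumes f: "f \<in> L2 (weighted_measure b)"
  shows "(\<lambda>x. f (- x)) \<in> L2 (weighted_measure b)"
proof -
  have [measurable]: "f \<in> borel_measurable borel"
    using L2_measurable[OF f] by (simp add: measurable_cong_sets[OF sets_weighted_measure refl])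
  have "integrable (distr (weighted_measure b) borel uminus) (\<lambda>x. (cmod (f x))\<^sup>2)"
    unfolding distr_weighted_uminus by (rule L2_integrable_sq[OF f])
  then have "integrable (weighted_measure b) (\<lambda>x. (cmod (f (- x)))\<^sup>2)"
    by (subst (asm) integrable_distr_eq) auto
  then show ?thesis by (simp add: L2_def)
qed

lemma inner_reflect:
  fixes f g :: "real^'n::finite \<Rightarrow> complex"
  assumes f: "f \<in> L2 (weighted_measure b)" and g: "g \<in> L2 (weighted_measure b)"
  shows "inner_L2 (weighted_measure b) (\<lambda>x. f (- x)) g = inner_L2 (weighted_measure b) f (\<lambda>x. g (- x))"
proof -
  have [measurable]: "f \<in> borel_measurable borel" "g \<in> borel_measurable borel"
    using L2_measurable[OF f] L2_measurable[OF g] by (simp_all add: measurable_cong_sets[OF sets_weighted_measure refl])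
  have "inner_L2 (weighted_measure b) f (\<lambda>x. g (- x)) = (\<integral>x. f x * cnj (g (- x)) \<partial>distr (weighted_measure b) borel uminus)"
    unfolding inner_L2_def distr_weighted_uminus ..
  also have "\<dots> = inner_L2 (weighted_measure b) (\<lambda>x. f (- x)) g"
    unfolding inner_L2_def by (subst integral_distr) auto
  finally show ?thesis by simp
qed

theorem theorem2p4p3:
  fixes b :: real
  assumes b: "b > - real CARD('n::finite) / 2"
  shows
    "(\<forall>l m. \<forall>p :: real^'n \<Rightarrow> complex. p \<in> harmonic_polys m \<longrightarrow>
       (AE x in weighted_measure b.
         gen_fourier b (Phi b l m p) x = \<i> powi (- (2 * int l + int m)) * Phi b l m p x)) \<and>
     (\<forall>f :: real^'n \<Rightarrow> complex. f \<in> L2 (weighted_measure b) \<longrightarrow>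
       (AE x in weighted_measure b. gen_fourier b (gen_fourier b f) x = f (- x)) \<and>
       (AE x in weighted_measure b. (gen_fourier b ^^ 4) f x = f x) \<and>
       (AE x in weighted_measure b. gen_fourier b (gen_fourier_conj b f) x = f x) \<and>
       (AE x in weighted_measure b. gen_fourier_conj b (gen_fourier b f) x = f x))"
proof -
  let ?M = "weighted_measure b :: (real^'n) measure" and ?k = "fourier_eigenvalue TYPE('n) b"
  interpret E: complete_orthosystem ?M "eigenvector b" by (rule complete_eigenvectors[OF b])
  note F = gen_fourier_coef[OF b]
  have conj_L2: "gen_fourier_conj b f \<in> L2 ?M" if "f \<in> L2 ?M" for f
    unfolding gen_fourier_conj_def by (intro L2_cnj F(1) that)
  have conj_coef: "E.coef (gen_fourier_conj b f) j = cnj (?k j) * E.coef f j" if f: "f \<in> L2 ?M" for f j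
  proof -
    have "E.coef (gen_fourier_conj b f) j = cnj (inner_L2 ?M (gen_fourier b (\<lambda>y. cnj (f y))) (\<lambda>x. cnj (eigenvector b j x)))"
      unfolding gen_fourier_conj_def by (subst inner_L2_cnj[symmetric]) simp
    also have "\<dots> = cnj (?k j) * cnj (inner_L2 ?M (\<lambda>y. cnj (f y)) (\<lambda>x. cnj (eigenvector b j x)))"
      using gen_fourier_inner_cnj_eigenvector[OF b L2_cnj[OF f], of j] by simp
    also have "\<dots> = cnj (?k j) * E.coef f j" unfolding inner_L2_cnj by simp
    finally show ?thesis .
  qed
  have sq: "(?k j)\<^sup>2 = 1 \<or> (?k j)\<^sup>2 = -1" for j
  proof -
    obtain l m where "eigenvalue TYPE('n) b j = oscillator_eigenvalue b CARD('n) l m" by (rule eigenvalue_cases)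
    from fourier_eigenvalue_square[OF this] show ?thesis by (cases "even m") auto
  qed
  have 1: "AE x in ?M. gen_fourier b (Phi b l m p) x = \<i> powi (- (2 * int l + int m)) * Phi b l m p x"
    if p: "p \<in> harmonic_polys m" for l m p
  proof (rule E.eq_AE_of_coef)
    have Phi: "Phi b l m p \<in> L2 ?M" by (rule Phi_L2[OF b p])
    show "gen_fourier b (Phi b l m p) \<in> L2 ?M" by (rule F(1)[OF Phi])
    show "(\<lambda>x. \<i> powi (- (2 * int l + int m)) * Phi b l m p x) \<in> L2 ?M" by (rule L2_mult_left[OF Phi])
    show "E.coef (gen_fourier b (Phi b l m p)) j = E.coef (\<lambda>x. \<i> powi (- (2 * int l + int m)) * Phi b l m p x) j" for j
    proof (cases "oscillator_eigenvalue b CARD('n) l m = eigenvalue TYPE('n) b j")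
      case True
      then show ?thesis
        unfolding F(2)[OF Phi] inner_L2_mult_left using fourier_eigenvalue_eq[OF True[symmetric]] by simp
    next
      case False
      then show ?thesis
        unfolding F(2)[OF Phi] inner_L2_mult_left inner_Phi_eigenvector[OF b p False] by simp
    qed
  qed
  have 2: "AE x in ?M. gen_fourier b (gen_fourier b f) x = f (- x)" if f: "f \<in> L2 ?M" for f
  proof (rule E.eq_AE_of_coef)
    show "gen_fourier b (gen_fourier b f) \<in> L2 ?M" by (intro F(1) f)
    show "(\<lambda>x. f (- x)) \<in> L2 ?M" by (rule L2_reflect[OF f])
    fix j
    have "E.coef (\<lambda>x. f (- x)) j = inner_L2 ?M f (\<lambda>x. (?k j)\<^sup>2 * eigenvector b j x)"
      unfolding inner_reflect[OF f E.e_L2] eigenvector_reflect[OF b] ..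
    also have "\<dots> = (?k j)\<^sup>2 * E.coef f j"
    proof -
      have "cnj ((?k j)\<^sup>2) = (?k j)\<^sup>2" using sq[of j] by (metis complex_cnj_one complex_cnj_minus)
      then show ?thesis by (simp only: inner_L2_mult_right)
    qed
    finally show "E.coef (gen_fourier b (gen_fourier b f)) j = E.coef (\<lambda>x. f (- x)) j"
      using F[OF f] F(2)[OF F(1)[OF f]] by (simp add: power2_eq_square)
  qed
  have 3: "AE x in ?M. (gen_fourier b ^^ 4) f x = f x" if f: "f \<in> L2 ?M" for f
  proof (rule E.eq_AE_of_coef)
    have F4: "(gen_fourier b ^^ 4) f = gen_fourier b (gen_fourier b (gen_fourier b (gen_fourier b f)))"
      by (simp add: eval_nat_numeral)
    show "(gen_fourier b ^^ 4) f \<in> L2 ?M" unfolding F4 by (intro F(1) f)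
    fix j
    have "E.coef ((gen_fourier b ^^ 4) f) j = ((?k j)\<^sup>2)\<^sup>2 * E.coef f j"
      unfolding F4 using f by (simp add: F power2_eq_square)
    moreover have "((?k j)\<^sup>2)\<^sup>2 = 1" using sq[of j] by (elim disjE) (simp_all only: power2_minus one_power2)
    ultimately show "E.coef ((gen_fourier b ^^ 4) f) j = E.coef f j" by (simp only: mult_1_left)
  qed (rule f)
  have 4: "AE x in ?M. gen_fourier b (gen_fourier_conj b f) x = f x" if f: "f \<in> L2 ?M" for f
    using f fourier_eigenvalue_norm[where 'n = 'n]
    by (intro E.eq_AE_of_coef F(1) conj_L2) (auto simp: F conj_L2 conj_coef simp flip: mult.assoc)
  have 5: "AE x in ?M. gen_fourier_conj b (gen_fourier b f) x = f x" if f: "f \<in> L2 ?M" for f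
    using f fourier_eigenvalue_norm[where 'n = 'n]
    by (intro E.eq_AE_of_coef F(1) conj_L2) (auto simp: F conj_L2 conj_coef mult.commute simp flip: mult.assoc)
  show ?thesis using 1 2 3 4 5 by blast
qed

end
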